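(* Consider the random triangle removal process on $n$ vertices, let $C>0$ be an absolute constant and let $\tau_\star$ be as defined in the context. For every $L>0$ there is some $0<\delta<1$ such that with high probability, for all $t\le\tau_\star$, every extension graph $H$ on $v_H\le L$ vertices and every injection $\varphi: I_H\to V_G$: (i) if $H$ is balanced then $|\Psi_{H,\varphi}-\mathcal S_H|\le \mathcal S_H\,\zeta^{\delta}$ for all $t\le t^-_H(\sqrt\delta)$; (ii) if $H$ is strictly balanced then $|\Psi_{H,\varphi}-\mathcal S_H|\le (\mathcal S_H)^{1-\sqrt\delta}(\log n)^{\rho}$ with $\rho=3e^{v_H-\iota_H}$, for all $t$ with $t^-_H(\sqrt\delta)\le t\le t_H$.
   Context: Random triangle removal process: $G(0)=K_n$ on vertex set $V_G$, $|V_G|=n$; as long as $G(i)$ has a triangle, $G(i+1)$ is obtained by deleting the three edges of a uniformly random triangle of $G(i)$. Let $t=i/n^2$, $p=p(t)=1-6t$; all times are of the form $i/n^2$. $Y_u$ denotes the degree of $u$ in $G(i)$, $Y_{u,v}$ the co-degree of distinct $u,v$, $Q$ the number of triangles, and $\zeta=n^{-1/2}p^{-1}\log n$. $\tau_\star$ is the minimal $t>0$ at which one of the following fails: $|Y_u/(np)-1|<C\zeta$ for all $u$; $|Y_{u,v}/(np^2)-1|<C\zeta$ for all $u\ne v$; $|Q/(\frac16n^3p^3)-1|<C\zeta^2$; or the standing requirement that $p(t)$ is such that $\log(1/\zeta)/\log\log n\to\infty$. An extension graph is a graph $H=(V_H,E_H)$ with a set $I_H\subseteq V_H$ of distinguished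 vertices forming an independent set; $e_H=|E_H|$, $v_H=|V_H|$, $\iota_H=|I_H|$. Its scaling is $\mathcal S_H=\mathcal S_H(n,p)=n^{v_H-\iota_H}p^{e_H}$ and its density is $m_H=e_H/(v_H-\iota_H)$. A subextension $K\subset H$ is an extension graph with $V_K\subseteq V_H$, $E_K\subseteq E_H$ and $I_K=I_H$. $H$ is balanced if $m_H\ge m_K$ for every subextension $K$, and strictly balanced if $m_H>m_K$ for every subextension $K$ with $E_K\subsetneq E_H$. For an injection $\varphi:I_H\to V_G$, $\Psi_{H,\varphi}$ is the number of injective maps $\psi:V_H\to V_G$ with $\psi|_{I_H}=\varphi$ and $\psi(a)\psi(b)\in E(G(i))$ for all $ab\in E_H$. Define $t_H=\min\{t:\mathcal S_H(n,p(t))\le 1\}$ and, for $r\ge0$, $t^-_H(r)=\min\{t:\mathcal S_H(n,p(t))\le \zeta^{-r}\}$. "With high probability" means with probability tending to $1$ as $n\to\infty$. *)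

theory Defs
  imports "HOL-Probability.Probability" "HOL-Library.FuncSet" "HOL-Library.Extended_Real"
begin

type_synonym graph = "nat set set"   (* a set of 2-element vertex sets *)

definition complete_graph :: "nat \<Rightarrow> graph" where
  "complete_graph n = {e. e \<subseteq> {..<n} \<and> card e = 2}"

definition triangles :: "graph \<Rightarrow> nat set set" where
  "triangles G = {T. card T = 3 \<and> (\<forall>e. e \<subseteq> T \<and> card e = 2 \<longrightarrow> e \<in> G)}"

definition remove_triangle :: "nat set \<Rightarrow> graph \<Rightarrow> graph" where
  "remove_triangle T G = G - {e. e \<subseteq> T \<and> card e = 2}"

definition tr_step :: "graph \<Rightarrow> graph pmf" where
  "tr_step G = (if triangles G = {} then return_pmf G
               else map_pmf (\<lambda>T. remove_triangle T G) (pmf_of_set (triangles G)))"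

fun tr_run :: "nat \<Rightarrow> graph \<Rightarrow> graph list pmf" where
  "tr_run 0 G = return_pmf [G]"
| "tr_run (Suc k) G = bind_pmf (tr_step G) (\<lambda>G'. map_pmf (\<lambda>xs. G # xs) (tr_run k G'))"

text \<open>The full trajectory of the random triangle removal process on n vertices,
  G(0) = K_n, ..., G(N) with N = n choose 2 (the process has certainly stopped
  by then, since every step deletes three edges).\<close>
definition tr_process :: "nat \<Rightarrow> graph list pmf" where
  "tr_process n = tr_run (n choose 2) (complete_graph n)"

definition graph_at :: "graph list \<Rightarrow> nat \<Rightarrow> graph" where
  "graph_at xs i = xs ! min i (length xs - 1)"

definition time :: "nat \<Rightarrow> nat \<Rightarrow> real" where
  "time n i = real i / (real n)^2"

definition pp :: "real \<Rightarrow> real" where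
  "pp t = 1 - 6 * t"

definition zeta :: "nat \<Rightarrow> real \<Rightarrow> real" where
  "zeta n t = ln (real n) / (sqrt (real n) * pp t)"

definition deg :: "graph \<Rightarrow> nat \<Rightarrow> nat" where
  "deg G u = card {v. {u, v} \<in> G}"

definition codeg :: "graph \<Rightarrow> nat \<Rightarrow> nat \<Rightarrow> nat" where
  "codeg G u v = card {w. {u, w} \<in> G \<and> {v, w} \<in> G}"

definition num_triangles :: "graph \<Rightarrow> nat" where
  "num_triangles G = card (triangles G)"

definition bounds_fail :: "real \<Rightarrow> nat \<Rightarrow> graph \<Rightarrow> nat \<Rightarrow> bool" where
  "bounds_fail C n G i =
     (let t = time n i; p = pp t; z = zeta n t in
        (\<exists>u<n. \<not> \<bar>real (deg G u) / (real n * p) - 1\<bar> < C * z)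
      \<or> (\<exists>u<n. \<exists>v<n. u \<noteq> v \<and> \<not> \<bar>real (codeg G u v) / (real n * p^2) - 1\<bar> < C * z)
      \<or> \<not> \<bar>real (num_triangles G) / (real n ^ 3 * p ^ 3 / 6) - 1\<bar> < C * z^2)"

definition tau_star_idx :: "real \<Rightarrow> (nat \<Rightarrow> real) \<Rightarrow> nat \<Rightarrow> graph list \<Rightarrow> nat" where
  "tau_star_idx C Tmax n xs =
     (LEAST i. 1 \<le> i \<and> (bounds_fail C n (graph_at xs i) i \<or> time n i > Tmax n))"

definition ext_graph :: "nat set \<Rightarrow> nat set set \<Rightarrow> nat set \<Rightarrow> bool" where
  "ext_graph V E I \<longleftrightarrow> finite V \<and> (\<forall>e\<in>E. e \<subseteq> V \<and> card e = 2) \<and> I \<subseteq> V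
     \<and> (\<forall>e\<in>E. \<not> e \<subseteq> I)"

definition scaling :: "nat set \<Rightarrow> nat set set \<Rightarrow> nat set \<Rightarrow> nat \<Rightarrow> real \<Rightarrow> real" where
  "scaling V E I n p = real n ^ (card V - card I) * p ^ card E"

definition density :: "nat set \<Rightarrow> nat set set \<Rightarrow> nat set \<Rightarrow> real" where
  "density V E I = real (card E) / real (card V - card I)"

definition subext :: "nat set \<Rightarrow> nat set set \<Rightarrow> nat set \<Rightarrow> nat set \<Rightarrow> nat set set \<Rightarrow> nat set \<Rightarrow> bool" where
  "subext VK EK IK V E I \<longleftrightarrow> ext_graph VK EK IK \<and> VK \<subseteq> V \<and> EK \<subseteq> E \<and> IK = I"

definition balanced :: "nat set \<Rightarrow> nat set set \<Rightarrow> nat set \<Rightarrow> bool" where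
  "balanced V E I \<longleftrightarrow> (\<forall>VK EK. subext VK EK I V E I \<longrightarrow> density V E I \<ge> density VK EK I)"

definition strictly_balanced :: "nat set \<Rightarrow> nat set set \<Rightarrow> nat set \<Rightarrow> bool" where
  "strictly_balanced V E I \<longleftrightarrow>
     (\<forall>VK EK. subext VK EK I V E I \<and> EK \<subset> E \<longrightarrow> density V E I > density VK EK I)"

definition Psi :: "nat \<Rightarrow> graph \<Rightarrow> nat set \<Rightarrow> nat set set \<Rightarrow> nat set \<Rightarrow> (nat \<Rightarrow> nat) \<Rightarrow> nat" where
  "Psi n G V E I \<phi> = card {\<psi> \<in> V \<rightarrow>\<^sub>E {..<n}. inj_on \<psi> V \<and> (\<forall>a\<in>I. \<psi> a = \<phi> a)
                                   \<and> (\<forall>e\<in>E. \<psi> ` e \<in> G)}"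

text \<open>t_H and t^-_H(r) as extended reals (infinity if the defining set is empty);
  times range over the grid i/n^2.\<close>
definition t_H :: "nat \<Rightarrow> nat set \<Rightarrow> nat set set \<Rightarrow> nat set \<Rightarrow> ereal" where
  "t_H n V E I = Inf {ereal (time n i) | i. scaling V E I n (pp (time n i)) \<le> 1}"

definition t_H_minus :: "nat \<Rightarrow> nat set \<Rightarrow> nat set set \<Rightarrow> nat set \<Rightarrow> real \<Rightarrow> ereal" where
  "t_H_minus n V E I r = Inf {ereal (time n i) | i.
      scaling V E I n (pp (time n i)) \<le> zeta n (time n i) powr (- r)}"

end

theory Submission
  imports Defs "HOL-Real_Asymp.Real_Asymp"
begin

text \<open>
  Let \<open>\<Psi>\<close> count the copies of an extension graph with \<open>e\<close> edges and let \<open>S\<close> be its scaling. While the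
  degree conditions hold, every edge lies in \<open>n p\<^sup>2 (1 + O(\<zeta>))\<close> of the \<open>n\<^sup>3 p\<^sup>3 / 6\<close> triangles and two
  edges share at most one triangle, so one step destroys \<open>\<Psi> r (1 + O(\<zeta>))\<close> copies on average, where
  \<open>r = 6 e / (n\<^sup>2 p)\<close>; this is the relative decrease of \<open>S\<close>. If in addition one step never destroys more
  than \<open>m S\<close> copies, then \<open>exp (\<plusminus> \<theta>\<^sub>i \<Psi>)\<close> with \<open>\<theta>\<^sub>i = \<lambda> exp (\<plusminus> w\<^sub>i) / S\<close> is a supermartingale for a
  correction \<open>w\<^sub>i\<close> of order \<open>\<zeta> + \<lambda> m log n\<close>. Markov's inequality with the best \<open>\<lambda>\<close> shows that
  \<open>\<Psi> / S - 1\<close> is of order \<open>\<zeta> + \<surd>y + y\<close>, \<open>y = m log\<^sup>3 n\<close>, except with probability \<open>exp (- log\<^sup>2 n)\<close>.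

  The copies destroyed through a given edge are copies of the same graph rooted at two further vertices.
  So \<open>m\<close> is controlled, by induction on the number \<open>v\<^sub>H - \<iota>\<^sub>H\<close> of free vertices, through the crude bound
  \<open>\<Psi> \<le> A (log n)\<^bsup>3 (v\<^sub>H - \<iota>\<^sub>H)\<^esup> S (1 + g)\<close>, where \<open>g\<close> is the sum of \<open>1 / S\<^sub>K\<close> over the induced
  subextensions \<open>K\<close> with at least one edge. If \<open>H\<close> is balanced and \<open>S \<ge> 1/2\<close> then
  \<open>S\<^sub>K \<ge> S\<^bsup>1 / (v\<^sub>H - \<iota>\<^sub>H)\<^esup> / 2\<close>, hence \<open>g\<close> is a negative power of \<open>S\<close>, and both claims follow with
  \<open>\<delta> = 1 / (16 N\<^sup>2)\<close> where \<open>N = max 1 \<lfloor>L\<rfloor>\<close>. Strict balancedness is used only through balancedness: if the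
  density is at least 1 it excludes isolated free vertices, and otherwise \<open>S\<close> stays above \<open>\<zeta>\<^bsup>-\<surd>\<delta>\<^esup>\<close>.
\<close>

subsection \<open>Triangles and copies of an extension graph\<close>

definition copies :: "nat \<Rightarrow> graph \<Rightarrow> nat set \<Rightarrow> nat set set \<Rightarrow> nat set \<Rightarrow> (nat \<Rightarrow> nat) \<Rightarrow> (nat \<Rightarrow> nat) set" where
  "copies n G V E I \<phi> = {\<psi> \<in> V \<rightarrow>\<^sub>E {..<n}. inj_on \<psi> V \<and> (\<forall>a\<in>I. \<psi> a = \<phi> a)
                                   \<and> (\<forall>e\<in>E. \<psi> ` e \<in> G)}"

lemma Psi_card_copies: "Psi n G V E I \<phi> = card (copies n G V E I \<phi>)"
  by (simp add: Psi_def copies_def)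

lemma finite_copies: "finite V \<Longrightarrow> finite (copies n G V E I \<phi>)"
  unfolding copies_def by (rule finite_subset[OF _ finite_PiE[of V "\<lambda>_. {..<n}"]]) auto

lemma edge_elim:
  assumes "G \<subseteq> complete_graph n" "e \<in> G"
  obtains u v where "e = {u, v}" "u \<noteq> v" "u < n" "v < n"
proof -
  have "card e = 2" "e \<subseteq> {..<n}" using assms unfolding complete_graph_def by auto
  then show ?thesis using that by (auto simp: card_2_iff)
qed

text \<open>\<open>triangles\<close> does not mention the vertex set; a vertex of \<open>T\<close>
  lies below \<open>n\<close> because it is an end of an edge of \<open>G\<close>.\<close>

lemma triangle_subset:
  assumes "G \<subseteq> complete_graph n" "T \<in> triangles G"
  shows "T \<subseteq> {..<n}" "card T = 3" "finite T"
proof -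
  show c: "card T = 3" using assms by (simp add: triangles_def)
  show f: "finite T" using c by (metis card.infinite zero_neq_numeral)
  show "T \<subseteq> {..<n}"
  proof
    fix x assume x: "x \<in> T"
    have "card (T - {x}) = 2" using c x f by simp
    then obtain y where "y \<in> T" "y \<noteq> x" by (metis card_2_iff' insert_Diff insert_iff Diff_iff singleton_iff)
    then have "{x, y} \<in> G" using assms(2) x by (auto simp: triangles_def)
    then show "x \<in> {..<n}" using assms(1) by (auto simp: complete_graph_def)
  qed
qed

lemma finite_triangles:
  assumes "G \<subseteq> complete_graph n"
  shows "finite (triangles G)"
  by (rule finite_subset[of _ "Pow {..<n}"]) (use triangle_subset(1)[OF assms] in auto)

text \<open>The third vertex of a triangle through \<open>{u, v}\<close> is a common neighbour of
  both ends, and every common neighbour arises exactly once.\<close>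

lemma triangles_through_edge:
  assumes G: "G \<subseteq> complete_graph n" and e: "{u, v} \<in> G" and uv: "u \<noteq> v"
  shows "card {T \<in> triangles G. {u, v} \<subseteq> T} = codeg G u v"
proof -
  let ?W = "{w. {u, w} \<in> G \<and> {v, w} \<in> G}"
  have ne: "w \<noteq> u \<and> w \<noteq> v" if "w \<in> ?W" for w
    using that G by (auto simp: complete_graph_def subset_iff)
  have "bij_betw (\<lambda>w. {u, v, w}) ?W {T \<in> triangles G. {u, v} \<subseteq> T}"
  proof (rule bij_betwI')
    fix x y assume "x \<in> ?W" "y \<in> ?W"
    then show "({u, v, x} = {u, v, y}) = (x = y)" using ne by blast
  next
    fix w assume w: "w \<in> ?W"
    then have n: "w \<noteq> u" "w \<noteq> v" using ne by auto
    have "f \<in> G" if sub: "f \<subseteq> {u, v, w}" and c2: "card f = 2" for f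
    proof -
      obtain a b where "f = {a, b}" "a \<noteq> b" using c2 by (auto simp: card_2_iff)
      then show ?thesis using sub w e by (auto simp: insert_commute)
    qed
    then show "{u, v, w} \<in> {T \<in> triangles G. {u, v} \<subseteq> T}"
      using n uv by (auto simp: triangles_def)
  next
    fix T assume T: "T \<in> {T \<in> triangles G. {u, v} \<subseteq> T}"
    then have c: "card T = 3" "finite T" "u \<in> T" "v \<in> T" using triangle_subset[OF G] by auto
    then have "card (T - {u, v}) = 1" using uv by (subst card_Diff_subset) auto
    then obtain w where w: "T - {u, v} = {w}" by (auto simp: card_1_singleton_iff)
    then have "T = {u, v, w}" "w \<noteq> u" "w \<noteq> v" using c by auto
    moreover have "{u, w} \<in> G" "{v, w} \<in> G" using T calculation by (auto simp: triangles_def)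
    ultimately show "\<exists>x\<in>?W. T = {u, v, x}" by auto
  qed
  then show ?thesis by (simp add: codeg_def bij_betw_same_card)
qed

text \<open>Two distinct edges span at least three vertices, so the only triangle that can contain
  both is their union.\<close>

lemma triangles_through_two_edges:
  assumes G: "G \<subseteq> complete_graph n" and "card e = 2" "card f = 2" "e \<noteq> f"
  shows "card {T \<in> triangles G. e \<subseteq> T \<and> f \<subseteq> T} \<le> 1"
proof -
  have fin: "finite e" "finite f" using assms by (metis card.infinite zero_neq_numeral)+
  have "card e < card (e \<union> f)"
    by (rule psubset_card_mono) (use fin assms card_subset_eq[of e f] in \<open>auto simp: psubset_eq\<close>)
  then have c3: "3 \<le> card (e \<union> f)" using assms by simp
  have "{T \<in> triangles G. e \<subseteq> T \<and> f \<subseteq> T} \<subseteq> {e \<union> f}"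
  proof
    fix T assume T: "T \<in> {T \<in> triangles G. e \<subseteq> T \<and> f \<subseteq> T}"
    then have "e \<union> f \<subseteq> T" "card T = 3" "finite T" using triangle_subset[OF G] by auto
    then have "e \<union> f = T" using c3 by (intro card_seteq) auto
    then show "T \<in> {e \<union> f}" by simp
  qed
  then show ?thesis using card_mono[of "{e \<union> f}"] by fastforce
qed

text \<open>A Bonferroni inequality: each pair of sets overlaps in at most one element, and
  \<open>(card A)\<^sup>2\<close> generously bounds the number of pairs.\<close>

lemma card_UN_ge:
  assumes "finite A" "\<And>a. a \<in> A \<Longrightarrow> finite (B a)"
    and "\<And>a b. a \<in> A \<Longrightarrow> b \<in> A \<Longrightarrow> a \<noteq> b \<Longrightarrow> card (B a \<inter> B b) \<le> 1"
  shows "(\<Sum>a\<in>A. card (B a)) \<le> card (\<Union>a\<in>A. B a) + (card A)\<^sup>2"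
  using assms
proof (induction A rule: finite_induct)
  case empty
  then show ?case by simp
next
  case (insert x A)
  let ?U = "\<Union>a\<in>A. B a"
  have fU: "finite ?U" using insert by auto
  have "card (B x \<inter> ?U) \<le> (\<Sum>a\<in>A. card (B x \<inter> B a))"
    unfolding Int_UN_distrib by (rule card_UN_le) (use insert in auto)
  also have "\<dots> \<le> (\<Sum>a\<in>A. 1)" by (rule sum_mono) (use insert in auto)
  finally have i: "card (B x \<inter> ?U) \<le> card A" by simp
  have "card (B x) + card ?U = card (B x \<union> ?U) + card (B x \<inter> ?U)"
    by (rule card_Un_Int) (use insert fU in auto)
  moreover have "(\<Sum>a\<in>A. card (B a)) \<le> card ?U + (card A)\<^sup>2" using insert by auto
  ultimately show ?case using insert i by (simp add: power2_eq_square)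
qed

text \<open>Edges of \<open>G\<close> have exactly two vertices, so the image of an edge is deleted
  precisely when it lies inside \<open>T\<close>.\<close>

lemma copies_remove_triangle:
  assumes G: "G \<subseteq> complete_graph n" and E: "ext_graph V E I"
  shows "copies n (remove_triangle T G) V E I \<phi>
    = {\<psi> \<in> copies n G V E I \<phi>. \<not> (\<exists>h\<in>E. \<psi> ` h \<subseteq> T)}"
proof -
  have "card e = 2" if "e \<in> G" for e using that G by (auto simp: complete_graph_def)
  then show ?thesis by (auto simp: copies_def remove_triangle_def)
qed

text \<open>A copy with several edges inside \<open>T\<close> counts once. Summing over
  \<open>T\<close> therefore produces unions of sets of triangles, not plain sums over
  edges.\<close>

definition lost :: "nat \<Rightarrow> graph \<Rightarrow> nat set \<Rightarrow> nat set set \<Rightarrow> nat set \<Rightarrow> (nat \<Rightarrow> nat) \<Rightarrow> nat set \<Rightarrow> nat" where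
  "lost n G V E I \<phi> T = card {\<psi> \<in> copies n G V E I \<phi>. \<exists>h\<in>E. \<psi> ` h \<subseteq> T}"

lemma Psi_remove_triangle:
  assumes G: "G \<subseteq> complete_graph n" and E: "ext_graph V E I"
  shows "real (Psi n (remove_triangle T G) V E I \<phi>) = real (Psi n G V E I \<phi>) - real (lost n G V E I \<phi> T)"
proof -
  have f: "finite (copies n G V E I \<phi>)" using E by (intro finite_copies) (simp add: ext_graph_def)
  have un: "copies n G V E I \<phi> = copies n (remove_triangle T G) V E I \<phi> \<union> {\<psi> \<in> copies n G V E I \<phi>. \<exists>h\<in>E. \<psi> ` h \<subseteq> T}"
    unfolding copies_remove_triangle[OF assms] by auto
  have "card (copies n (remove_triangle T G) V E I \<phi> \<union> {\<psi> \<in> copies n G V E I \<phi>. \<exists>h\<in>E. \<psi> ` h \<subseteq> T})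
    = card (copies n (remove_triangle T G) V E I \<phi>) + lost n G V E I \<phi> T"
    unfolding lost_def by (rule card_Un_disjoint) (use f in \<open>auto simp: copies_remove_triangle[OF assms]\<close>)
  then have "card (copies n G V E I \<phi>) = card (copies n (remove_triangle T G) V E I \<phi>) + lost n G V E I \<phi> T"
    using un by argo
  then show ?thesis unfolding Psi_card_copies by simp
qed

lemma ext_graph_finite_edges: "ext_graph V E I \<Longrightarrow> finite E"
  unfolding ext_graph_def by (rule finite_subset[of _ "Pow V"]) auto

lemma card_edges_le:
  assumes E: "ext_graph V E I" and N: "card V \<le> N"
  shows "real (card E) \<le> real N ^ 2"
proof -
  have V: "finite V" using E by (simp add: ext_graph_def)
  have "E \<subseteq> (\<lambda>(a, b). {a, b}) ` (V \<times> V)"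
  proof
    fix h assume "h \<in> E"
    then have "card h = 2" "h \<subseteq> V" using E by (auto simp: ext_graph_def)
    then obtain a b where "h = {a, b}" by (auto simp: card_2_iff)
    then show "h \<in> (\<lambda>(a, b). {a, b}) ` (V \<times> V)" using \<open>h \<subseteq> V\<close> by auto
  qed
  then have "card E \<le> card (V \<times> V)" using V by (meson card_image_le card_mono finite_SigmaI finite_imageI order.trans)
  also have "\<dots> \<le> N * N" using N by (simp add: card_cartesian_product mult_le_mono)
  finally have "real (card E) \<le> real (N * N)" by (simp only: of_nat_le_iff)
  then show ?thesis by (simp add: power2_eq_square)
qed

text \<open>Double counting of the pairs of a copy and a triangle that destroys it.\<close>

lemma sum_lost:
  assumes G: "G \<subseteq> complete_graph n" and E: "ext_graph V E I"
  shows "(\<Sum>T\<in>triangles G. lost n G V E I \<phi> T)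
     = (\<Sum>\<psi>\<in>copies n G V E I \<phi>. card (\<Union>h\<in>E. {T \<in> triangles G. \<psi> ` h \<subseteq> T}))"
proof -
  have f: "finite (copies n G V E I \<phi>)" using E by (intro finite_copies) (simp add: ext_graph_def)
  have ft: "finite (triangles G)" by (rule finite_triangles[OF G])
  have "(\<Sum>T\<in>triangles G. lost n G V E I \<phi> T)
      = (\<Sum>T\<in>triangles G. \<Sum>\<psi>\<in>copies n G V E I \<phi>. if \<exists>h\<in>E. \<psi> ` h \<subseteq> T then 1 else 0)"
    unfolding lost_def using f by (intro sum.cong refl) (simp add: sum.If_cases Int_def)
  also have "\<dots> = (\<Sum>\<psi>\<in>copies n G V E I \<phi>. \<Sum>T\<in>triangles G. if \<exists>h\<in>E. \<psi> ` h \<subseteq> T then 1 else 0)"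
    by (rule sum.swap)
  also have "\<dots> = (\<Sum>\<psi>\<in>copies n G V E I \<phi>. card {T \<in> triangles G. \<exists>h\<in>E. \<psi> ` h \<subseteq> T})"
    using ft by (intro sum.cong refl) (simp add: sum.If_cases Int_def)
  also have "\<dots> = (\<Sum>\<psi>\<in>copies n G V E I \<phi>. card (\<Union>h\<in>E. {T \<in> triangles G. \<psi> ` h \<subseteq> T}))"
    by (intro sum.cong refl arg_cong[of _ _ card]) auto
  finally show ?thesis .
qed

text \<open>The image of each edge lies in as many triangles as the co-degree of its ends. The union
  bound over the edges gives the upper estimate; in the lower one \<open>card_UN_ge\<close> costs at
  most \<open>(card E)\<^sup>2\<close> per copy.\<close>

lemma sum_lost_bounds:
  fixes lo hi :: real
  assumes G: "G \<subseteq> complete_graph n" and E: "ext_graph V E I"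
    and cd: "\<And>u v. u < n \<Longrightarrow> v < n \<Longrightarrow> u \<noteq> v \<Longrightarrow> lo \<le> codeg G u v \<and> codeg G u v \<le> hi"
  shows "real (Psi n G V E I \<phi>) * (card E * lo - (real (card E))\<^sup>2) \<le> (\<Sum>T\<in>triangles G. real (lost n G V E I \<phi> T))"
    and "(\<Sum>T\<in>triangles G. real (lost n G V E I \<phi> T)) \<le> real (Psi n G V E I \<phi>) * (card E * hi)"
proof -
  let ?C = "copies n G V E I \<phi>"
  let ?B = "\<lambda>\<psi> h. {T \<in> triangles G. \<psi> ` h \<subseteq> T}"
  have ft: "finite (triangles G)" by (rule finite_triangles[OF G])
  have fE: "finite E" by (rule ext_graph_finite_edges[OF E])
  have one: "lo \<le> card (?B \<psi> h) \<and> card (?B \<psi> h) \<le> hi" if "\<psi> \<in> ?C" "h \<in> E" for \<psi> h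
  proof -
    have g: "\<psi> ` h \<in> G" using that by (auto simp: copies_def)
    then obtain u v where uv: "\<psi> ` h = {u, v}" "u \<noteq> v" "u < n" "v < n" using edge_elim[OF G] by metis
    then show ?thesis using cd[of u v] triangles_through_edge[OF G, of u v] g by simp
  qed
  \<comment> \<open>Injectivity of \<open>\<psi>\<close> keeps the images of distinct edges
    distinct.\<close>
  have two: "card (?B \<psi> h \<inter> ?B \<psi> h') \<le> 1" if "\<psi> \<in> ?C" "h \<in> E" "h' \<in> E" "h \<noteq> h'" for \<psi> h h'
  proof -
    have "h \<subseteq> V" "h' \<subseteq> V" "card h = 2" "card h' = 2" "inj_on \<psi> V" using that E by (auto simp: ext_graph_def copies_def)
    then have "\<psi> ` h \<noteq> \<psi> ` h'" "card (\<psi> ` h) = 2" "card (\<psi> ` h') = 2" using that(4)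
      by (auto simp: inj_on_image_eq_iff card_image inj_on_subset)
    moreover have "?B \<psi> h \<inter> ?B \<psi> h' = {T \<in> triangles G. \<psi> ` h \<subseteq> T \<and> \<psi> ` h' \<subseteq> T}" by auto
    ultimately show ?thesis using triangles_through_two_edges[OF G] by metis
  qed
  have s: "(\<Sum>T\<in>triangles G. real (lost n G V E I \<phi> T)) = (\<Sum>\<psi>\<in>?C. real (card (\<Union>h\<in>E. ?B \<psi> h)))"
    by (simp only: of_nat_sum[symmetric] sum_lost[OF G E])
  have l: "card E * lo - (real (card E))\<^sup>2 \<le> card (\<Union>h\<in>E. ?B \<psi> h)" if "\<psi> \<in> ?C" for \<psi>
  proof -
    have "(\<Sum>h\<in>E. lo) \<le> (\<Sum>h\<in>E. real (card (?B \<psi> h)))" by (rule sum_mono) (use one that in auto)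
    moreover have "(\<Sum>h\<in>E. card (?B \<psi> h)) \<le> card (\<Union>h\<in>E. ?B \<psi> h) + (card E)\<^sup>2"
      by (rule card_UN_ge) (use fE ft two that in auto)
    then have "(\<Sum>h\<in>E. real (card (?B \<psi> h))) \<le> real (card (\<Union>h\<in>E. ?B \<psi> h)) + (real (card E))\<^sup>2"
      by (simp only: of_nat_sum[symmetric] of_nat_add[symmetric] of_nat_power[symmetric] of_nat_le_iff)
    ultimately show ?thesis by simp
  qed
  have u: "card (\<Union>h\<in>E. ?B \<psi> h) \<le> card E * hi" if "\<psi> \<in> ?C" for \<psi>
  proof -
    have "card (\<Union>h\<in>E. ?B \<psi> h) \<le> (\<Sum>h\<in>E. card (?B \<psi> h))" by (rule card_UN_le[OF fE])
    then have "real (card (\<Union>h\<in>E. ?B \<psi> h)) \<le> (\<Sum>h\<in>E. real (card (?B \<psi> h)))"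
      by (simp only: of_nat_sum[symmetric] of_nat_le_iff)
    also have "\<dots> \<le> (\<Sum>h\<in>E. hi)" by (rule sum_mono) (use one that in auto)
    finally show ?thesis by simp
  qed
  show "real (Psi n G V E I \<phi>) * (card E * lo - (real (card E))\<^sup>2) \<le> (\<Sum>T\<in>triangles G. real (lost n G V E I \<phi> T))"
    unfolding s Psi_card_copies using sum_mono[of ?C "\<lambda>_. card E * lo - (real (card E))\<^sup>2", OF l] by simp
  show "(\<Sum>T\<in>triangles G. real (lost n G V E I \<phi> T)) \<le> real (Psi n G V E I \<phi>) * (card E * hi)"
    unfolding s Psi_card_copies using sum_mono[of ?C _ "\<lambda>_. card E * hi", OF u] by simp
qed

subsection \<open>The process and events of high probability\<close>

lemma tr_step_support:
  assumes G: "G \<subseteq> complete_graph n" and "G' \<in> set_pmf (tr_step G)"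
  shows "G' \<subseteq> G"
proof (cases "triangles G = {}")
  case False
  then show ?thesis using assms finite_triangles[OF G]
    by (auto simp: tr_step_def remove_triangle_def)
qed (use assms in \<open>simp add: tr_step_def\<close>)

lemma tr_run_support:
  assumes "G \<subseteq> complete_graph n" "xs \<in> set_pmf (tr_run k G)"
  shows "length xs = Suc k" and "xs ! 0 = G" and "\<forall>j\<le>k. xs ! j \<subseteq> complete_graph n"
proof -
  have "length xs = Suc k \<and> xs ! 0 = G \<and> (\<forall>j\<le>k. xs ! j \<subseteq> complete_graph n)"
    using assms
  proof (induction k arbitrary: G xs)
    case 0
    then show ?case by simp
  next
    case (Suc k)
    then obtain G' ys where G': "G' \<in> set_pmf (tr_step G)" "ys \<in> set_pmf (tr_run k G')" "xs = G # ys"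
      by auto
    have "G' \<subseteq> complete_graph n" using tr_step_support[OF Suc.prems(1) G'(1)] Suc.prems(1) by blast
    then have IH: "length ys = Suc k" "\<forall>j\<le>k. ys ! j \<subseteq> complete_graph n" using Suc.IH G' by blast+
    have "xs ! j \<subseteq> complete_graph n" if "j \<le> Suc k" for j
      using that IH G' Suc.prems(1) by (cases j) auto
    then show ?case using IH G' by auto
  qed
  then show "length xs = Suc k" "xs ! 0 = G" "\<forall>j\<le>k. xs ! j \<subseteq> complete_graph n" by auto
qed

text \<open>Markov's inequality for a supermartingale stopped at the first time the predicate \<open>good\<close> fails.\<close>
lemma tr_run_supermartingale:
  fixes \<Phi> :: "nat \<Rightarrow> graph \<Rightarrow> real"
  assumes step: "\<And>i G. i < s + T \<Longrightarrow> G \<subseteq> complete_graph n \<Longrightarrow> good i G \<Longrightarrow>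
      (\<integral>\<^sup>+ G'. ennreal (\<Phi> (Suc i) G') \<partial>tr_step G) \<le> ennreal (\<Phi> i G)"
    and "G \<subseteq> complete_graph n" "T \<le> k"
  shows "emeasure (tr_run k G) {xs. (\<forall>j<T. good (s + j) (xs ! j)) \<and> 1 \<le> \<Phi> (s + T) (xs ! T)} \<le> ennreal (\<Phi> s G)"
  using assms
proof (induction T arbitrary: k G s)
  case 0
  have "xs ! 0 = G" if "xs \<in> set_pmf (tr_run k G)" for xs using tr_run_support(2)[OF 0(2) that] .
  then have "emeasure (tr_run k G) {xs. 1 \<le> \<Phi> s (xs ! 0)} = emeasure (tr_run k G) {xs. 1 \<le> \<Phi> s G}"
    by (intro emeasure_eq_AE AE_pmfI) auto
  also have "\<dots> \<le> ennreal (\<Phi> s G)"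
  proof (cases "1 \<le> \<Phi> s G")
    case True
    have "emeasure (measure_pmf (tr_run k G)) {xs. 1 \<le> \<Phi> s G} \<le> 1" by (rule measure_pmf.emeasure_le_1)
    also have "1 \<le> ennreal (\<Phi> s G)" using True by simp
    finally show ?thesis .
  qed simp
  finally show ?case by simp
next
  case (Suc T)
  obtain k' where k: "k = Suc k'" using Suc.prems by (cases k) auto
  let ?A = "{xs. (\<forall>j<Suc T. good (s + j) (xs ! j)) \<and> 1 \<le> \<Phi> (s + Suc T) (xs ! Suc T)}"
  let ?B = "{xs. (\<forall>j<T. good (Suc s + j) (xs ! j)) \<and> 1 \<le> \<Phi> (Suc s + T) (xs ! T)}"
  have A: "G # ys \<in> ?A \<longleftrightarrow> good s G \<and> ys \<in> ?B" for ys
    by (auto simp: All_less_Suc2)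
  show ?case
  proof (cases "good s G")
    case False
    \<comment> \<open>If \<open>good\<close> fails at the first graph, the event is empty whatever
      follows.\<close>
    have "emeasure (tr_run k G) ?A = (\<integral>\<^sup>+ G'. emeasure (tr_run k' G') {} \<partial>tr_step G)"
      unfolding k tr_run.simps emeasure_bind_pmf emeasure_map_pmf
      by (intro nn_integral_cong arg_cong2[of _ _ _ _ emeasure] refl) (use A False in \<open>auto simp: vimage_def\<close>)
    then show ?thesis by simp
  next
    case True
    have "emeasure (tr_run k G) ?A = (\<integral>\<^sup>+ G'. emeasure (tr_run k' G') ?B \<partial>tr_step G)"
      unfolding k tr_run.simps emeasure_bind_pmf emeasure_map_pmf
      by (intro nn_integral_cong arg_cong2[of _ _ _ _ emeasure] refl) (use A True in \<open>simp add: vimage_def\<close>)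
    \<comment> \<open>With the first graph peeled off, the induction hypothesis bounds the rest of
      the run, started at \<open>Suc s\<close>; the one-step hypothesis then averages over
      \<open>G'\<close>.\<close>
    also have "\<dots> \<le> (\<integral>\<^sup>+ G'. ennreal (\<Phi> (Suc s) G') \<partial>tr_step G)"
    proof (intro nn_integral_mono_AE AE_pmfI)
      fix G' assume "G' \<in> set_pmf (tr_step G)"
      then have "G' \<subseteq> complete_graph n" using tr_step_support[OF Suc.prems(2)] Suc.prems(2) by blast
      then show "emeasure (tr_run k' G') ?B \<le> ennreal (\<Phi> (Suc s) G')"
        by (intro Suc.IH) (use Suc.prems k in auto)
    qed
    also have "\<dots> \<le> ennreal (\<Phi> s G)" by (rule Suc.prems(1)) (use Suc.prems True in auto)
    finally show ?thesis .
  qed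
qed

section \<open>Combining events of high probability\<close>

definition whp :: "(nat \<Rightarrow> graph list \<Rightarrow> bool) \<Rightarrow> bool" where
  "whp P \<longleftrightarrow> (\<lambda>n. measure_pmf.prob (tr_process n) {xs. P n xs}) \<longlonglongrightarrow> 1"

text \<open>\<open>P\<close> is an event already under control and \<open>F n x\<close> are the
  exceptional events: at most \<open>c n\<close> of them, each of probability at most
  \<open>b n\<close>. Trajectories in \<open>P\<close> can violate \<open>Q\<close> only inside one
  of these.\<close>

lemma whp_union_bound:
  fixes b :: "nat \<Rightarrow> real"
  assumes P: "whp P"
    and ev: "eventually (\<lambda>n. (\<forall>xs\<in>set_pmf (tr_process n). P n xs \<longrightarrow> Q n xs \<or> (\<exists>x\<in>X n. xs \<in> F n x))
        \<and> finite (X n) \<and> real (card (X n)) \<le> c n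
        \<and> (\<forall>x\<in>X n. measure_pmf.prob (tr_process n) (F n x) \<le> b n) \<and> 0 \<le> b n) sequentially"
    and lim: "(\<lambda>n. c n * b n) \<longlonglongrightarrow> 0"
  shows "whp Q"
  unfolding whp_def
proof (rule tendsto_sandwich)
  show "eventually (\<lambda>n. measure_pmf.prob (tr_process n) {xs. P n xs} - c n * b n
      \<le> measure_pmf.prob (tr_process n) {xs. Q n xs}) sequentially"
    using ev
  proof eventually_elim
    case (elim n)
    let ?p = "measure_pmf.prob (tr_process n)"
    have "?p {xs. P n xs} \<le> ?p ({xs. Q n xs} \<union> (\<Union>x\<in>X n. F n x))"
      by (intro measure_pmf.finite_measure_mono_AE AE_pmfI) (use elim in auto)
    also have "\<dots> \<le> ?p {xs. Q n xs} + ?p (\<Union>x\<in>X n. F n x)"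
      by (intro measure_Un_le) auto
    also have "?p (\<Union>x\<in>X n. F n x) \<le> (\<Sum>x\<in>X n. ?p (F n x))"
      by (rule measure_UNION_le) (use elim in auto)
    also have "\<dots> \<le> (\<Sum>x\<in>X n. b n)" by (rule sum_mono) (use elim in auto)
    also have "\<dots> \<le> c n * b n" using elim by (simp add: mult_right_mono)
    finally show ?case by simp
  qed
  show "eventually (\<lambda>n. measure_pmf.prob (tr_process n) {xs. Q n xs} \<le> 1) sequentially" by simp
  show "(\<lambda>n. measure_pmf.prob (tr_process n) {xs. P n xs} - c n * b n) \<longlonglongrightarrow> 1"
    using tendsto_diff[OF P[unfolded whp_def] lim] by simp
qed simp

lemma whp_mono:
  assumes "whp P" "eventually (\<lambda>n. \<forall>xs\<in>set_pmf (tr_process n). P n xs \<longrightarrow> Q n xs) sequentially"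
  shows "whp Q"
  by (rule whp_union_bound[OF assms(1), where X = "\<lambda>_. {}" and c = "\<lambda>_. 0" and b = "\<lambda>_. 0" and F = "\<lambda>_ _. {}"])
     (use assms(2) in \<open>auto elim: eventually_mono\<close>)

lemma whp_True: "whp (\<lambda>n xs. True)"
  by (simp add: whp_def)

lemma whp_conj:
  assumes P: "whp P" and Q: "whp Q"
  shows "whp (\<lambda>n xs. P n xs \<and> Q n xs)"
  unfolding whp_def
proof (rule tendsto_sandwich)
  show "eventually (\<lambda>n. measure_pmf.prob (tr_process n) {xs. P n xs} + measure_pmf.prob (tr_process n) {xs. Q n xs} - 1
      \<le> measure_pmf.prob (tr_process n) {xs. P n xs \<and> Q n xs}) sequentially"
  proof (intro always_eventually allI)
    fix n
    let ?p = "measure_pmf.prob (tr_process n)"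
    have "?p {xs. P n xs} \<le> ?p ({xs. P n xs \<and> Q n xs} \<union> (UNIV - {xs. Q n xs}))"
      by (intro measure_pmf.finite_measure_mono) auto
    also have "\<dots> \<le> ?p {xs. P n xs \<and> Q n xs} + ?p (UNIV - {xs. Q n xs})"
      by (intro measure_Un_le) auto
    also have "?p (UNIV - {xs. Q n xs}) = 1 - ?p {xs. Q n xs}"
      using measure_pmf.prob_compl[of "{xs. Q n xs}" "tr_process n"] by simp
    finally show "?p {xs. P n xs} + ?p {xs. Q n xs} - 1 \<le> ?p {xs. P n xs \<and> Q n xs}" by simp
  qed
  show "(\<lambda>n. measure_pmf.prob (tr_process n) {xs. P n xs} + measure_pmf.prob (tr_process n) {xs. Q n xs} - 1) \<longlonglongrightarrow> 1"
    using tendsto_diff[OF tendsto_add[OF P[unfolded whp_def] Q[unfolded whp_def]] tendsto_const[of 1]] by simp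
  show "eventually (\<lambda>n. measure_pmf.prob (tr_process n) {xs. P n xs \<and> Q n xs} \<le> 1) sequentially" by simp
qed simp

text \<open>Serves to collect the concentration events for all relevant numbers of free vertices at
  the end.\<close>

lemma whp_all_le:
  fixes m :: nat
  assumes "\<And>k. k \<le> m \<Longrightarrow> whp (P k)"
  shows "whp (\<lambda>n xs. \<forall>k\<le>m. P k n xs)"
  using assms
proof (induction m)
  case 0
  then show ?case by simp
next
  case (Suc m)
  have "whp (\<lambda>n xs. (\<forall>k\<le>m. P k n xs) \<and> P (Suc m) n xs)"
    by (rule whp_conj) (use Suc in auto)
  moreover have "(\<lambda>n xs. \<forall>k\<le>Suc m. P k n xs) = (\<lambda>n xs. (\<forall>k\<le>m. P k n xs) \<and> P (Suc m) n xs)"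
    by (auto simp: le_Suc_eq fun_eq_iff)
  ultimately show ?case by simp
qed

subsection \<open>The one-step exponential moment\<close>

text \<open>For negative \<open>x\<close> put \<open>y = - x\<close>: the identity
  \<open>(1 - y + y\<^sup>2) * (1 + y) = 1 + y ^ 3\<close> together with
  \<open>1 + y \<le> exp y\<close> bounds \<open>exp (- y)\<close>.\<close>

lemma exp_quadratic_bound:
  fixes x :: real
  assumes "\<bar>x\<bar> \<le> 1"
  shows "exp x \<le> 1 + x + x\<^sup>2"
proof (cases "0 \<le> x")
  case True
  then show ?thesis using assms by (intro exp_bound) auto
next
  case False
  define y where "y = - x"
  have y: "0 \<le> y" using False by (simp add: y_def)
  have "1 \<le> 1 + y ^ 3" using y by simp
  also have "\<dots> = (1 - y + y\<^sup>2) * (1 + y)" by (simp add: algebra_simps power2_eq_square power3_eq_cube)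
  also have "\<dots> \<le> (1 - y + y\<^sup>2) * exp y"
  proof (rule mult_left_mono)
    show "1 + y \<le> exp y" by (rule exp_ge_add_one_self)
    show "0 \<le> 1 - y + y\<^sup>2" using assms y by (simp add: y_def)
  qed
  finally have "exp (- y) \<le> 1 - y + y\<^sup>2"
    by (simp add: exp_minus field_simps)
  then show ?thesis by (simp add: y_def)
qed

text \<open>The conditional expectation, given \<open>G\<close>, of the number of copies destroyed
  by the next step.\<close>

definition mean_lost :: "nat \<Rightarrow> graph \<Rightarrow> nat set \<Rightarrow> nat set set \<Rightarrow> nat set \<Rightarrow> (nat \<Rightarrow> nat) \<Rightarrow> real" where
  "mean_lost n G V E I \<phi> = (\<Sum>T\<in>triangles G. real (lost n G V E I \<phi> T)) / real (num_triangles G)"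

text \<open>The quadratic bound is applied to each triangle. Since no triangle destroys more than
  \<open>M\<close> copies, the second moment is at most \<open>M\<close> times the mean, and
  \<open>1 + y \<le> exp y\<close> returns to exponential form. A Freedman-type estimate, valid for
  both signs of \<open>s\<close>.\<close>

lemma tr_step_exp_moment:
  fixes s M :: real
  assumes G: "G \<subseteq> complete_graph n" and E: "ext_graph V E I" and ne: "triangles G \<noteq> {}"
    and M: "\<And>T. T \<in> triangles G \<Longrightarrow> real (lost n G V E I \<phi> T) \<le> M" and sM: "\<bar>s\<bar> * M \<le> 1"
  shows "(\<integral>\<^sup>+ G'. ennreal (exp (s * real (Psi n G' V E I \<phi>) + c)) \<partial>tr_step G)
    \<le> ennreal (exp (s * real (Psi n G V E I \<phi>) - s * mean_lost n G V E I \<phi> + s\<^sup>2 * M * mean_lost n G V E I \<phi> + c))"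
proof -
  let ?Q = "real (card (triangles G))"
  let ?l = "\<lambda>T. real (lost n G V E I \<phi> T)"
  let ?P = "real (Psi n G V E I \<phi>)"
  let ?m = "mean_lost n G V E I \<phi>"
  have fin: "finite (triangles G)" by (rule finite_triangles[OF G])
  then have Q: "?Q > 0" using ne by (simp add: card_gt_0_iff)
  have "(\<integral>\<^sup>+ G'. ennreal (exp (s * real (Psi n G' V E I \<phi>) + c)) \<partial>tr_step G)
    = ennreal (\<integral> G'. exp (s * real (Psi n G' V E I \<phi>) + c) \<partial>tr_step G)"
    by (rule nn_integral_eq_integral) (use ne fin in \<open>auto intro!: integrable_measure_pmf_finite simp: tr_step_def set_pmf_of_set[OF ne fin]\<close>)
  also have "(\<integral> G'. exp (s * real (Psi n G' V E I \<phi>) + c) \<partial>tr_step G)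
    = (\<Sum>T\<in>triangles G. exp (s * (?P - ?l T) + c)) / ?Q"
    using ne by (simp add: tr_step_def integral_pmf_of_set[OF ne fin] Psi_remove_triangle[OF G E])
  also have "\<dots> = exp (s * ?P + c) * ((\<Sum>T\<in>triangles G. exp (- (s * ?l T))) / ?Q)"
    by (simp add: sum_distrib_left right_diff_distrib exp_diff exp_add exp_minus divide_inverse mult_ac)
  also have "\<dots> \<le> exp (s * ?P + c) * exp (- s * ?m + s\<^sup>2 * M * ?m)"
  proof (intro mult_left_mono)
    have one: "exp (- (s * ?l T)) \<le> 1 - s * ?l T + s\<^sup>2 * M * ?l T" if T: "T \<in> triangles G" for T
    proof -
      have "\<bar>s\<bar> * ?l T \<le> \<bar>s\<bar> * M" by (intro mult_left_mono M T) simp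
      then have "exp (- (s * ?l T)) \<le> 1 + - (s * ?l T) + (- (s * ?l T))\<^sup>2"
        using sM by (intro exp_quadratic_bound) (simp add: abs_mult)
      moreover have "s\<^sup>2 * (?l T * ?l T) \<le> s\<^sup>2 * (M * ?l T)" by (intro mult_left_mono mult_right_mono M T) auto
      ultimately show ?thesis by (simp add: power_mult_distrib power2_eq_square[of "?l T"] algebra_simps)
    qed
    have "(\<Sum>T\<in>triangles G. exp (- (s * ?l T))) \<le> (\<Sum>T\<in>triangles G. 1 - s * ?l T + s\<^sup>2 * M * ?l T)"
      by (rule sum_mono) (rule one)
    also have "\<dots> = ?Q - s * (\<Sum>T\<in>triangles G. ?l T) + s\<^sup>2 * M * (\<Sum>T\<in>triangles G. ?l T)"
      by (simp add: sum.distrib sum_subtractf sum_distrib_left)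
    also have "\<dots> = ?Q * (1 + (- s * ?m + s\<^sup>2 * M * ?m))"
      using Q by (simp add: mean_lost_def num_triangles_def field_simps)
    also have "\<dots> \<le> ?Q * exp (- s * ?m + s\<^sup>2 * M * ?m)"
      by (intro mult_left_mono exp_ge_add_one_self) simp
    finally show "(\<Sum>T\<in>triangles G. exp (- (s * ?l T))) / ?Q \<le> exp (- s * ?m + s\<^sup>2 * M * ?m)"
      using Q by (simp add: field_simps)
  qed simp
  also have "\<dots> = exp (s * ?P - s * ?m + s\<^sup>2 * M * ?m + c)" by (simp add: exp_add[symmetric] algebra_simps)
  finally show ?thesis by (simp add: ennreal_leI)
qed

text \<open>The main term is \<open>card E * a / Q0 = r\<close> per copy, with
  \<open>a = n p\<^sup>2\<close> and \<open>Q0 = n\<^sup>3 p\<^sup>3 / 6\<close>. The constant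
  \<open>K\<close> collects the relative errors: \<open>3 * C\<close> covers the co-degrees and the
  division by the number of triangles, \<open>N2\<close> the Bonferroni loss.\<close>

lemma mean_lost_bounds:
  fixes C p z :: real
  assumes G: "G \<subseteq> complete_graph n" and E: "ext_graph V E I"
    and C: "C > 0" and n: "ln (real n) \<ge> 1" and p: "0 < p"
    and z: "z = ln (real n) / (sqrt (real n) * p)" and e: "real (card E) \<le> N2" and K: "K = 3 * C + N2" "K * z \<le> 1" "z \<le> 1"
    and cd: "\<And>u v. u < n \<Longrightarrow> v < n \<Longrightarrow> u \<noteq> v \<Longrightarrow> \<bar>real (codeg G u v) / (real n * p^2) - 1\<bar> \<le> C * z"
    and q: "\<bar>real (num_triangles G) / (real n ^ 3 * p ^ 3 / 6) - 1\<bar> \<le> C * z^2"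
    and r: "r = 6 * real (card E) / ((real n)\<^sup>2 * p)"
  shows "num_triangles G > 0"
    and "\<bar>mean_lost n G V E I \<phi> - real (Psi n G V E I \<phi>) * r\<bar> \<le> real (Psi n G V E I \<phi>) * r * (K * z)"
proof -
  let ?P = "real (Psi n G V E I \<phi>)" let ?e = "real (card E)" let ?Q = "real (num_triangles G)"
  have n0: "real n > 0" using n by (cases "n = 0") auto
  have z0: "z > 0" unfolding z using n n0 p by (intro divide_pos_pos mult_pos_pos) (linarith | simp)+
  define a where "a = real n * p^2"
  define Q0 where "Q0 = real n ^ 3 * p ^ 3 / 6"
  have a0: "a > 0" and Q0: "Q0 > 0" using n0 p by (simp_all add: a_def Q0_def)
  \<comment> \<open>This identity turns the absolute Bonferroni loss \<open>(card E)\<^sup>2\<close>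
    into the relative error \<open>(card E)\<^sup>2 * z\<^sup>2\<close> of \<open>a\<close>.\<close>
  have "z\<^sup>2 * a = (ln (real n))\<^sup>2" using n0 p by (simp add: z a_def power_divide power_mult_distrib)
  moreover have "(1::real) \<le> (ln (real n))\<^sup>2" using n by simp
  ultimately have za: "1 \<le> z\<^sup>2 * a" by simp
  have aQ: "?e * a = r * Q0" using n0 p by (simp add: r a_def Q0_def field_simps power2_eq_square power3_eq_cube)
  have N2: "N2 \<ge> 0" using e of_nat_0_le_iff[of "card E", where 'a=real] by linarith
  have zz: "z\<^sup>2 \<le> z" using z0 K(3) by (simp add: power2_eq_square mult_left_le)
  have "0 \<le> N2 * z" using N2 z0 by simp
  moreover have "K * z = 3 * (C * z) + N2 * z" by (simp add: K(1) algebra_simps)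
  ultimately have Cz: "3 * (C * z) \<le> 1" using K(2) by linarith
  have Cz2: "C * z\<^sup>2 \<le> C * z" using zz C by simp
  have Qb: "Q0 * (1 - C * z\<^sup>2) \<le> ?Q" "?Q \<le> Q0 * (1 + C * z\<^sup>2)"
    using q Q0 unfolding Q0_def[symmetric] by (auto simp: abs_le_iff field_simps)
  have pos1: "1 - C * z\<^sup>2 > 0" using Cz Cz2 C z0 by linarith
  then have "0 < Q0 * (1 - C * z\<^sup>2)" by (rule mult_pos_pos[OF Q0])
  then have Qpos: "?Q > 0" using Qb(1) by linarith
  then show "num_triangles G > 0" by simp
  have cb: "a * (1 - C * z) \<le> codeg G u v \<and> codeg G u v \<le> a * (1 + C * z)" if "u < n" "v < n" "u \<noteq> v" for u v
    using cd[OF that] a0 unfolding a_def[symmetric] by (auto simp: abs_le_iff field_simps)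
  have s: "?P * (?e * (a * (1 - C * z)) - ?e\<^sup>2) \<le> mean_lost n G V E I \<phi> * ?Q"
     "mean_lost n G V E I \<phi> * ?Q \<le> ?P * (?e * (a * (1 + C * z)))"
    using sum_lost_bounds[OF G E cb, of \<phi>] Qpos by (simp_all add: mean_lost_def)
  have r0: "r \<ge> 0" using r n0 p by simp
  have Kz: "0 \<le> K * z" using K C N2 z0 by simp
  \<comment> \<open>Since \<open>C * z\<^sup>2 \<le> 1/3\<close>, the right side is at least
    \<open>1 + (2/3) * K * z - C * z\<close>; this is where the factor 3 in \<open>K\<close> comes
    from.\<close>
  have up: "1 + C * z \<le> (1 + K * z) * (1 - C * z\<^sup>2)"
  proof -
    have "(K * z) * (C * z\<^sup>2) \<le> (K * z) * (1/3)"
      using Cz Cz2 Kz by (intro mult_left_mono) linarith+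
    moreover have "3 * (C * z) \<le> K * z" using K N2 z0 by (simp add: algebra_simps)
    ultimately show ?thesis using Cz2 by (simp add: algebra_simps) 
  qed
  have lo: "(1 - K * z) * (1 + C * z\<^sup>2) \<le> 1 - C * z - ?e * z\<^sup>2"
  proof -
    have "?e * z\<^sup>2 \<le> N2 * z" using e zz z0 by (intro mult_mono) auto
    moreover have "0 \<le> (K * z) * (C * z\<^sup>2)" using Kz C by simp
    moreover have "K * z = 3 * (C * z) + N2 * z" using K by (simp add: algebra_simps)
    moreover have "0 \<le> C * z" using C z0 by simp
    ultimately show ?thesis using Cz2 by (simp add: algebra_simps)
  qed
  have "mean_lost n G V E I \<phi> * ?Q \<le> ?P * (r * Q0 * (1 + C * z))"
    using s(2) by (simp add: aQ mult.assoc[symmetric])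
  also have "\<dots> \<le> ?P * (r * Q0 * ((1 + K * z) * (1 - C * z\<^sup>2)))"
    using up r0 Q0 by (intro mult_left_mono) auto
  also have "\<dots> = ?P * r * (1 + K * z) * (Q0 * (1 - C * z\<^sup>2))" by (simp add: mult_ac)
  also have "\<dots> \<le> ?P * r * (1 + K * z) * ?Q" using Qb(1) r0 Kz by (intro mult_left_mono) auto
  finally have 1: "mean_lost n G V E I \<phi> \<le> ?P * r * (1 + K * z)" using Qpos by simp
  have "?P * r * (1 - K * z) * ?Q \<le> ?P * r * (1 - K * z) * (Q0 * (1 + C * z\<^sup>2))"
    using Qb(2) r0 K(2) by (intro mult_left_mono) auto
  also have "\<dots> = ?P * (r * Q0 * ((1 - K * z) * (1 + C * z\<^sup>2)))" by (simp add: mult_ac)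
  also have "\<dots> \<le> ?P * (r * Q0 * (1 - C * z - ?e * z\<^sup>2))"
    using lo r0 Q0 by (intro mult_left_mono) auto
  also have "\<dots> = ?P * (?e * (a * (1 - C * z)) - ?e\<^sup>2 * (z\<^sup>2 * a))"
    unfolding aQ[symmetric] by (simp add: algebra_simps power2_eq_square)
  also have "\<dots> \<le> ?P * (?e * (a * (1 - C * z)) - ?e\<^sup>2)"
    using mult_left_mono[OF za, of "?e\<^sup>2"] by (intro mult_left_mono) auto
  also note s(1)
  finally have 2: "?P * r * (1 - K * z) \<le> mean_lost n G V E I \<phi>" using Qpos by simp
  show "\<bar>mean_lost n G V E I \<phi> - ?P * r\<bar> \<le> ?P * r * (K * z)"
    using 1 2 by (simp add: abs_le_iff algebra_simps)
qed

section \<open>Drift of the exponential potential in one step\<close>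

text \<open>Both parts come from Bernoulli's inequality; the second bounds \<open>1 + e x\<close> by
  \<open>(1 + x) ^ e\<close> and uses \<open>(1 - x\<^sup>2) ^ e \<le> 1\<close>.\<close>

lemma power_one_minus_bounds:
  fixes x :: real
  assumes "0 \<le> x" "x \<le> 1"
  shows "1 - real e * x \<le> (1 - x) ^ e" "(1 - x) ^ e * (1 + real e * x) \<le> 1"
proof -
  show "1 - real e * x \<le> (1 - x) ^ e" using Bernoulli_inequality[of "-x" e] assms by simp
  have "(1 - x) ^ e * (1 + real e * x) \<le> (1 - x) ^ e * (1 + x) ^ e"
    using Bernoulli_inequality[of x e] assms by (intro mult_left_mono) auto
  also have "\<dots> = (1 - x\<^sup>2) ^ e" by (simp add: power_mult_distrib[symmetric] algebra_simps power2_eq_square)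
  also have "\<dots> \<le> 1" using assms by (intro power_le_one) (auto simp: power_le_one abs_square_le_1)
  finally show "(1 - x) ^ e * (1 + real e * x) \<le> 1" .
qed

lemma exp_minus_double_le:
  fixes y :: real
  assumes "0 \<le> y" "y \<le> 1/2"
  shows "exp (- (2 * y)) \<le> 1 - y"
proof -
  have "y * y \<le> y * (1/2)" using assms by (intro mult_left_mono)
  then have "1 \<le> (1 - y) * (1 + 2 * y)" by (simp add: algebra_simps)
  also have "\<dots> \<le> (1 - y) * exp (2 * y)" using assms by (intro mult_left_mono exp_ge_add_one_self) auto
  finally show ?thesis by (simp add: exp_minus field_simps)
qed

text \<open>
  The inequality that makes \<open>exp (\<sigma> \<theta>\<^sub>i \<Psi>)\<close> a supermartingale; \<open>\<sigma> = \<plusminus>1\<close> treats both tails at once.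
  Here \<open>x = 6 / (n\<^sup>2 p)\<close>, \<open>\<mu>\<close> is the expected number of copies lost in the step, \<open>m S\<close> bounds that number,
  and primes refer to the next time.
\<close>
lemma potential_step:
  fixes lam w w' p x m S S' \<sigma> \<Psi> \<mu> \<kappa> r :: real
  assumes S: "S > 0" and S': "S' = S * (1 - x) ^ e" and x: "0 \<le> x" and r: "r = real e * x" "r \<le> 1/10" "e \<ge> 1"
    and \<sigma>: "\<sigma> = 1 \<or> \<sigma> = -1" and \<kappa>: "0 \<le> \<kappa>" "\<kappa> \<le> 1"
    and lam: "0 \<le> lam" "0 \<le> m" "16 * (lam * m) \<le> 1"
    and w: "0 \<le> w'" "w' \<le> 1/2" "w - w' \<ge> 2 * r * (r + 2 * \<kappa> + 16 * (lam * m))"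
    and \<mu>: "\<bar>\<mu> - \<Psi> * r\<bar> \<le> \<Psi> * r * \<kappa>" and \<Psi>: "0 \<le> \<Psi>"
    and \<theta>: "\<theta> = lam * exp (\<sigma> * w) / S" "\<theta>' = lam * exp (\<sigma> * w') / S'"
  shows "\<bar>\<sigma> * \<theta>'\<bar> * (m * S) \<le> 1"
    and "\<sigma> * \<theta>' * \<Psi> - \<sigma> * \<theta>' * \<mu> + (\<sigma> * \<theta>')\<^sup>2 * (m * S) * \<mu> \<le> \<sigma> * \<theta> * \<Psi>"
proof -
  define c where "c = (1 - x) ^ e"
  have r0: "0 \<le> r" using r x by simp
  have "x \<le> r" using r x by (simp add: mult_right_mono[of 1 "real e" x, simplified])
  then have x1: "x \<le> 1" using r by simp
  have c: "1 - r \<le> c" "c * (1 + r) \<le> 1" using power_one_minus_bounds[OF x x1, of e] r unfolding c_def by auto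
  have c0: "9/10 \<le> c" using c r by simp
  define E where "E = exp (\<sigma> * w')"
  have "E \<le> exp (1/2)" unfolding E_def using \<sigma> w by auto
  then have E: "0 < E" "E \<le> 2" using exp_half_le2 by (simp add: E_def, linarith)
  \<comment> \<open>The total relative error of the drift: \<open>\<kappa>\<close> from the mean,
    and 8 = 4 * 2 from the second-order term, where \<open>t \<le> 4 * (lam * m)\<close> and
    \<open>\<mu> \<le> 2 * (\<Psi> * r)\<close>.\<close>
  define q where "q = \<kappa> + 8 * (lam * m)"
  have lm: "0 \<le> lam * m" using lam by simp
  have q: "0 \<le> q" "q \<le> 3/2" using \<kappa> lam lm by (auto simp: q_def)
  have \<theta>'E: "\<theta>' = lam * E / (S * c)" by (simp add: \<theta> S' E_def c_def)
  have \<theta>'0: "0 \<le> \<theta>'" unfolding \<theta>'E using lam E S c0 by simp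
  define t where "t = \<theta>' * (m * S)"
  have t0: "0 \<le> t" using \<theta>'0 lam S by (simp add: t_def)
  have "t = (lam * m) * (E / c)" using S c0 by (simp add: t_def \<theta>'E)
  also have "\<dots> \<le> (lam * m) * 4" 
    by (intro mult_left_mono lm) (use E c0 in \<open>simp add: divide_le_eq\<close>)
  finally have t: "t \<le> 4 * (lam * m)" by simp
  then show "\<bar>\<sigma> * \<theta>'\<bar> * (m * S) \<le> 1" using \<sigma> \<theta>'0 lam unfolding t_def by (auto simp: abs_mult)
  have \<mu>b: "\<mu> \<le> \<Psi> * r + \<Psi> * r * \<kappa>" "\<Psi> * r - \<Psi> * r * \<kappa> \<le> \<mu>" using \<mu> by (auto simp: abs_le_iff)
  have Pr: "0 \<le> \<Psi> * r" using \<Psi> r0 by simp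
  have Prk: "\<Psi> * r * \<kappa> \<le> \<Psi> * r" using Pr \<kappa> by (simp add: mult_left_le)
  have \<mu>0: "0 \<le> \<mu>" "\<mu> \<le> 2 * (\<Psi> * r)" using \<mu>b Prk by auto
  have "t * \<mu> \<le> 4 * (lam * m) * (2 * (\<Psi> * r))" using t t0 \<mu>0 lm by (intro mult_mono) auto
  moreover have "- \<sigma> * \<mu> \<le> - \<sigma> * (\<Psi> * r) + \<Psi> * r * \<kappa>" using \<sigma> \<mu>b by auto
  ultimately have "\<sigma> * \<Psi> - \<sigma> * \<mu> + t * \<mu> \<le> \<Psi> * (\<sigma> - \<sigma> * r + r * q)"
    by (simp add: q_def algebra_simps)
  then have "\<theta>' * (\<sigma> * \<Psi> - \<sigma> * \<mu> + t * \<mu>) \<le> \<theta>' * (\<Psi> * (\<sigma> - \<sigma> * r + r * q))"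
    by (intro mult_left_mono \<theta>'0)
  also have "\<dots> = (lam * \<Psi> / S) * (E * (\<sigma> - \<sigma> * r + r * q) / c)" by (simp add: \<theta>'E)
  also have "\<dots> \<le> (lam * \<Psi> / S) * (\<sigma> * exp (\<sigma> * w))"
  proof (rule mult_left_mono)
    have rq: "0 \<le> r * q" using r0 q by simp
    have rlm: "0 \<le> r * (lam * m)" "0 \<le> r * \<kappa>" "0 \<le> r * r" using r0 lm \<kappa> by auto
    have w3: "w - w' \<ge> 2 * (r * r) + 4 * (r * \<kappa>) + 32 * (r * (lam * m))"
      using w(3) by (simp add: algebra_simps)
    have rq': "r * q = r * \<kappa> + 8 * (r * (lam * m))" by (simp add: q_def algebra_simps)
    show "E * (\<sigma> - \<sigma> * r + r * q) / c \<le> \<sigma> * exp (\<sigma> * w)"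
    proof (cases "\<sigma> = 1")
      case True
      \<comment> \<open>Upper tail: \<open>1 - r\<close> is paid for by the decrease
        \<open>c\<close> of the scaling, the excess \<open>r * q\<close> by the decrease of
        \<open>w\<close>.\<close>
      have "1 - r + r * q \<le> (1 - r) * (1 + 2 * (r * q))"
      proof -
        have "r * (r * q) \<le> (1/2) * (r * q)" using r(2) rq by (intro mult_right_mono) auto
        then show ?thesis by (simp add: algebra_simps)
      qed
      also have "\<dots> \<le> c * exp (2 * (r * q))" using c c0 r(2) rq by (intro mult_mono exp_ge_add_one_self) auto
      finally have "E * (1 - r + r * q) \<le> E * (c * exp (2 * (r * q)))" using E by (intro mult_left_mono) auto
      also have "\<dots> = c * exp (w' + 2 * (r * q))" using True by (simp add: E_def exp_add)
      also have "\<dots> \<le> c * exp w"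
      proof (rule mult_left_mono)
        have "w' + 2 * (r * q) \<le> w" using w3 rlm unfolding rq' by argo
        then show "exp (w' + 2 * (r * q)) \<le> exp w" by simp
      qed (use c0 in simp)
      finally show ?thesis using True c0 by (simp add: divide_le_eq mult.commute)
    next
      case False
      then have s: "\<sigma> = -1" using \<sigma> by simp
      \<comment> \<open>Lower tail: this case dictates the hypothesis on \<open>w - w'\<close>,
        whose right side is exactly \<open>2 * y\<close>. The term \<open>r * r\<close> arises
        because \<open>c\<close> may be as large as \<open>1 / (1 + r)\<close>.\<close>
      define y where "y = r * r + 2 * (r * q)"
      have "r * r \<le> r * (1/10)" "r * q \<le> (1/10) * (3/2)" using r(2) r0 q by (intro mult_left_mono mult_mono; simp)+
      then have y: "0 \<le> y" "y \<le> 1/2" using r0 rq rlm(3) r(2) unfolding y_def by linarith+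
      have "exp (- w) \<le> exp (- w' + - (2 * y))" using w3 rlm by (simp add: y_def rq')
      also have "\<dots> = E * exp (- (2 * y))" by (simp only: exp_add E_def s) simp
      also have "\<dots> \<le> E * (1 - y)" using exp_minus_double_le[OF y] E by (intro mult_left_mono) auto
      finally have "exp (- w) * c \<le> E * (1 - y) * c" using c0 by (intro mult_right_mono) auto
      also have "\<dots> = E * (c * (1 - y))" by simp
      also have "\<dots> \<le> E * (c * ((1 + r) * (1 - r - r * q)))"
      proof (intro mult_left_mono)
        have "r * (r * q) \<le> 1 * (r * q)" using r(2) rq by (intro mult_right_mono) auto
        then show "1 - y \<le> (1 + r) * (1 - r - r * q)" by (simp add: y_def algebra_simps)
      qed (use E c0 in auto)
      also have "\<dots> = E * ((c * (1 + r)) * (1 - r - r * q))" by simp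
      also have "\<dots> \<le> E * (1 * (1 - r - r * q))"
        using E c \<open>r * q \<le> (1/10) * (3/2)\<close> r(2) by (intro mult_left_mono mult_right_mono; linarith)
      finally show ?thesis using s c0 by (simp add: divide_le_eq algebra_simps)
    qed
    show "0 \<le> lam * \<Psi> / S" using lam \<Psi> S by simp
  qed
  also have "\<dots> = \<sigma> * \<theta> * \<Psi>" by (simp add: \<theta>)
  also have "\<theta>' * (\<sigma> * \<Psi> - \<sigma> * \<mu> + t * \<mu>) = \<sigma> * \<theta>' * \<Psi> - \<sigma> * \<theta>' * \<mu> + (\<sigma> * \<theta>')\<^sup>2 * (m * S) * \<mu>"
    using \<sigma> by (auto simp: t_def power2_eq_square algebra_simps)
  finally show "\<sigma> * \<theta>' * \<Psi> - \<sigma> * \<theta>' * \<mu> + (\<sigma> * \<theta>')\<^sup>2 * (m * S) * \<mu> \<le> \<sigma> * \<theta> * \<Psi>" .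
qed

section \<open>Induced subextensions and the copies lost in one step\<close>

definition induced :: "nat set set \<Rightarrow> nat set \<Rightarrow> nat set set" where
  "induced E U = {e \<in> E. e \<subseteq> U}"

definition edge_hosts :: "nat set \<Rightarrow> nat set set \<Rightarrow> nat set \<Rightarrow> nat set set" where
  "edge_hosts V E I = {U. I \<subseteq> U \<and> U \<subseteq> V \<and> induced E U \<noteq> {}}"

text \<open>Up to constants and logarithms this bounds the fraction of copies that a single triangle
  can destroy: fixing the image of a subextension costs a factor of its scaling.\<close>

definition gsum :: "nat set \<Rightarrow> nat set set \<Rightarrow> nat set \<Rightarrow> nat \<Rightarrow> real \<Rightarrow> real" where
  "gsum V E I n p = (\<Sum>U\<in>edge_hosts V E I. 1 / scaling U (induced E U) I n p)"

lemma scaling_pos: "n > 0 \<Longrightarrow> p > 0 \<Longrightarrow> scaling V E I n p > 0"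
  by (simp add: scaling_def)

lemma finite_edge_hosts: "ext_graph V E I \<Longrightarrow> finite (edge_hosts V E I)"
  unfolding edge_hosts_def by (rule finite_subset[of _ "Pow V"]) (auto simp: ext_graph_def)

lemma gsum_nonneg: "n > 0 \<Longrightarrow> p > 0 \<Longrightarrow> 0 \<le> gsum V E I n p"
  unfolding gsum_def by (intro sum_nonneg) (simp add: scaling_pos less_imp_le)

lemma gsum_ge:
  assumes "ext_graph V E I" "n > 0" "p > 0" "U \<in> edge_hosts V E I"
  shows "1 / scaling U (induced E U) I n p \<le> gsum V E I n p"
  unfolding gsum_def
  by (rule member_le_sum) (use assms in \<open>auto simp: scaling_pos less_imp_le finite_edge_hosts\<close>)

lemma gsum_antimono:
  assumes "n > 0" "0 < p'" "p' \<le> p"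
  shows "gsum V E I n p \<le> gsum V E I n p'"
  unfolding gsum_def scaling_def
  by (intro sum_mono divide_left_mono mult_left_mono power_mono mult_pos_pos zero_less_power) (use assms in auto)

lemma gsum_pos:
  assumes E: "ext_graph V E I" and "E \<noteq> {}" "n > 0" "p > 0"
  shows "gsum V E I n p > 0"
proof -
  have "induced E V = E" "I \<subseteq> V" using E by (auto simp: induced_def ext_graph_def)
  then have "V \<in> edge_hosts V E I" using assms by (simp add: edge_hosts_def)
  from gsum_ge[OF E assms(3,4) this] show ?thesis
    by (rule less_le_trans[rotated]) (simp add: scaling_pos assms)
qed

text \<open>All root maps \<open>\<phi>\<close> are allowed, injective or not, because
  \<open>lost_le\<close> prescribes images of further roots that may collide. The bound covers at
  most \<open>k\<close> free vertices, since rooting an edge uses up one or two of them.\<close>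

definition upper_bounds :: "nat \<Rightarrow> real \<Rightarrow> nat \<Rightarrow> nat \<Rightarrow> real \<Rightarrow> graph \<Rightarrow> bool" where
  "upper_bounds n A N k p G \<longleftrightarrow> (\<forall>V E I \<phi>. ext_graph V E I \<and> card V \<le> N \<and> card V - card I \<le> k \<longrightarrow>
     real (Psi n G V E I \<phi>) \<le> A * ln (real n) ^ (3 * k) * (scaling V E I n p * (1 + gsum V E I n p)))"

text \<open>For \<open>J \<subseteq> U\<close> the scaling of \<open>U\<close> over \<open>I\<close>
  is that of \<open>J\<close> over \<open>I\<close> times that of \<open>U\<close> over
  \<open>J\<close>. So the sum for the new roots, divided by the scaling of \<open>J\<close>, is
  part of the old sum. The summand 1 is absorbed because \<open>J\<close> itself hosts the edge
  \<open>h\<close>; hence the factor 2.\<close>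

lemma ext_graph_extend_root:
  assumes E: "ext_graph V E I" and h: "h \<in> E" and np: "n > 0" "p > 0"
  defines "J \<equiv> I \<union> h" and "E' \<equiv> {e \<in> E. \<not> e \<subseteq> I \<union> h}"
  shows "ext_graph V E' J" and "card V - card J < card V - card I"
    and "scaling V E' J n p * (1 + gsum V E' J n p) \<le> 2 * (scaling V E I n p * gsum V E I n p)"
proof -
  have fV: "finite V" and IV: "I \<subseteq> V" and hV: "h \<subseteq> V" and hI: "\<not> h \<subseteq> I"
    using E h by (auto simp: ext_graph_def)
  have JV: "J \<subseteq> V" and IJ: "I \<subseteq> J" using IV hV by (auto simp: J_def)
  have fJ: "finite J" using JV fV finite_subset by auto
  have "I \<subset> J" using hI by (auto simp: J_def)
  then have IJc: "card I < card J" using fJ psubset_card_mono by blast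
  have JVc: "card J \<le> card V" using JV fV card_mono by blast
  show "ext_graph V E' J" using E JV by (auto simp: ext_graph_def E'_def J_def)
  show "card V - card J < card V - card I" using IJc JVc by simp
  have fE: "finite E" by (rule ext_graph_finite_edges[OF E])
  let ?sJ = "scaling J (induced E J) I n p"
  have split: "scaling U (induced E U) I n p = ?sJ * scaling U (induced E' U) J n p"
    if U: "J \<subseteq> U" "U \<subseteq> V" for U
  proof -
    have "induced E U = induced E J \<union> induced E' U" "induced E J \<inter> induced E' U = {}"
      using U by (auto simp: induced_def E'_def J_def)
    then have "card (induced E U) = card (induced E J) + card (induced E' U)"
      using fE by (simp add: card_Un_disjoint induced_def E'_def)
    moreover have "card J \<le> card U" using U fV by (intro card_mono) (auto intro: finite_subset)
    then have "card U - card I = (card J - card I) + (card U - card J)" using IJc by simp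
    ultimately show ?thesis by (simp add: scaling_def power_add)
  qed
  have sJ: "?sJ > 0" by (rule scaling_pos[OF np])
  have "h \<in> induced E J" using h by (auto simp: induced_def J_def)
  then have Jh: "J \<in> edge_hosts V E I" using IJ JV by (auto simp: edge_hosts_def)
  have "induced E V = E" "induced E' V = E'" using E by (auto simp: induced_def ext_graph_def E'_def)
  then have sV: "scaling V E I n p = ?sJ * scaling V E' J n p" using split[OF JV] by simp
  have 1: "1 \<le> ?sJ * gsum V E I n p" using gsum_ge[OF E np Jh] sJ by (simp add: divide_le_eq mult.commute)
  have "gsum V E' J n p = (\<Sum>U\<in>edge_hosts V E' J. ?sJ * (1 / scaling U (induced E U) I n p))"
    unfolding gsum_def using sJ by (intro sum.cong refl) (auto simp: edge_hosts_def split)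
  also have "\<dots> \<le> (\<Sum>U\<in>edge_hosts V E I. ?sJ * (1 / scaling U (induced E U) I n p))"
  proof (rule sum_mono2[OF finite_edge_hosts[OF E]])
    show "edge_hosts V E' J \<subseteq> edge_hosts V E I" using IJ by (auto simp: edge_hosts_def induced_def E'_def)
  qed (use sJ scaling_pos[OF np] in \<open>auto simp: less_imp_le\<close>)
  also have "\<dots> = ?sJ * gsum V E I n p" by (simp add: gsum_def sum_distrib_left)
  finally have "1 + gsum V E' J n p \<le> 2 * (?sJ * gsum V E I n p)" using 1 by simp
  then have "scaling V E' J n p * (1 + gsum V E' J n p) \<le> scaling V E' J n p * (2 * (?sJ * gsum V E I n p))"
    by (intro mult_left_mono) (simp_all add: scaling_pos[OF np] less_imp_le)
  then show "scaling V E' J n p * (1 + gsum V E' J n p) \<le> 2 * (scaling V E I n p * gsum V E I n p)"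
    by (simp add: sV mult_ac)
qed

text \<open>A destroyed copy sends both ends of some edge \<open>h\<close> into \<open>T\<close>.
  There are 9 ordered pairs in \<open>T \<times> T\<close>, and each turns the count into one with
  fewer free vertices, controlled by \<open>upper_bounds\<close>; with the factor 2 from rerooting
  this gives 18.\<close>

lemma lost_le:
  assumes G: "G \<subseteq> complete_graph n" and E: "ext_graph V E I" and N: "card V \<le> N" and k: "card V - card I \<le> Suc k"
    and ub: "upper_bounds n A N k p G" and T: "T \<in> triangles G" and np: "n > 0" "p > 0" and A: "A \<ge> 0" "ln (real n) \<ge> 0"
  shows "real (lost n G V E I \<phi> T) \<le> 18 * real (card E) * A * ln (real n) ^ (3 * k) * gsum V E I n p * scaling V E I n p"
proof -
  let ?B = "2 * A * ln (real n) ^ (3 * k) * (scaling V E I n p * gsum V E I n p)"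
  have fV: "finite V" using E by (simp add: ext_graph_def)
  have T3: "card T = 3" "finite T" using triangle_subset[OF G T] by auto
  have fc: "finite (copies n G V E I \<phi>)" by (rule finite_copies[OF fV])
  have one: "real (card {\<psi> \<in> copies n G V E I \<phi>. \<psi> ` h \<subseteq> T}) \<le> 9 * ?B" if h: "h \<in> E" for h
  proof -
    have "card h = 2" using E h by (auto simp: ext_graph_def)
    then obtain a b where ab: "h = {a, b}" "a \<noteq> b" by (auto simp: card_2_iff)
    let ?J = "I \<union> h" let ?E' = "{e \<in> E. \<not> e \<subseteq> I \<union> h}"
    let ?c = "\<lambda>(u, v). copies n G V ?E' ?J (\<phi>(a := u, b := v))"
    have "{\<psi> \<in> copies n G V E I \<phi>. \<psi> ` h \<subseteq> T} \<subseteq> (\<Union>uv\<in>T \<times> T. ?c uv)"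
    proof
      fix \<psi> assume \<psi>: "\<psi> \<in> {\<psi> \<in> copies n G V E I \<phi>. \<psi> ` h \<subseteq> T}"
      then have "\<psi> \<in> ?c (\<psi> a, \<psi> b)" "(\<psi> a, \<psi> b) \<in> T \<times> T" using ab by (auto simp: copies_def)
      then show "\<psi> \<in> (\<Union>uv\<in>T \<times> T. ?c uv)" by blast
    qed
    then have "card {\<psi> \<in> copies n G V E I \<phi>. \<psi> ` h \<subseteq> T} \<le> card (\<Union>uv\<in>T \<times> T. ?c uv)"
      by (intro card_mono) (use T3 finite_copies[OF fV] in auto)
    also have "\<dots> \<le> (\<Sum>uv\<in>T \<times> T. card (?c uv))" by (rule card_UN_le) (use T3 in auto)
    finally have "real (card {\<psi> \<in> copies n G V E I \<phi>. \<psi> ` h \<subseteq> T}) \<le> (\<Sum>uv\<in>T \<times> T. real (card (?c uv)))"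
      by (simp only: of_nat_sum[symmetric] of_nat_le_iff)
    also have "\<dots> \<le> (\<Sum>uv\<in>T \<times> T. ?B)"
    proof (rule sum_mono)
      fix uv :: "nat \<times> nat"
      obtain u v where uv: "uv = (u, v)" by force
      note r = ext_graph_extend_root[OF E h np]
      have "real (card (?c uv)) \<le> A * ln (real n) ^ (3 * k) * (scaling V ?E' ?J n p * (1 + gsum V ?E' ?J n p))"
        using ub[unfolded upper_bounds_def, rule_format, of V ?E' ?J "\<phi>(a := u, b := v)"] r(1,2) N k
        by (simp add: uv Psi_card_copies)
      also have "\<dots> \<le> A * ln (real n) ^ (3 * k) * (2 * (scaling V E I n p * gsum V E I n p))"
        using r(3) A by (intro mult_left_mono) auto
      finally show "real (card (?c uv)) \<le> ?B" by simp
    qed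
    also have "\<dots> = 9 * ?B" using T3 by (simp add: card_cartesian_product)
    finally show ?thesis .
  qed
  have "{\<psi> \<in> copies n G V E I \<phi>. \<exists>h\<in>E. \<psi> ` h \<subseteq> T} = (\<Union>h\<in>E. {\<psi> \<in> copies n G V E I \<phi>. \<psi> ` h \<subseteq> T})" by auto
  then have "lost n G V E I \<phi> T \<le> (\<Sum>h\<in>E. card {\<psi> \<in> copies n G V E I \<phi>. \<psi> ` h \<subseteq> T})"
    unfolding lost_def by (simp add: card_UN_le[OF ext_graph_finite_edges[OF E]])
  then have "real (lost n G V E I \<phi> T) \<le> (\<Sum>h\<in>E. real (card {\<psi> \<in> copies n G V E I \<phi>. \<psi> ` h \<subseteq> T}))"
    by (simp only: of_nat_sum[symmetric] of_nat_le_iff)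
  also have "\<dots> \<le> (\<Sum>h\<in>E. 9 * ?B)" by (rule sum_mono) (rule one)
  finally show ?thesis by (simp add: mult_ac)
qed

subsection \<open>Initial counts and the time scale\<close>

text \<open>A copy is determined by its values on the free vertices.\<close>

lemma Psi_le_power:
  assumes V: "finite V" and I: "I \<subseteq> V"
  shows "Psi n G V E I \<phi> \<le> n ^ (card V - card I)"
proof -
  have "inj_on (\<lambda>\<psi>. restrict \<psi> (V - I)) (copies n G V E I \<phi>)"
  proof (rule inj_onI)
    fix f g assume f: "f \<in> copies n G V E I \<phi>" and g: "g \<in> copies n G V E I \<phi>"
      and eq: "restrict f (V - I) = restrict g (V - I)"
    show "f = g"
    proof (rule extensionalityI[of _ V])
      show "f \<in> extensional V" "g \<in> extensional V" using f g by (auto simp: copies_def PiE_def)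
      fix x assume "x \<in> V"
      then show "f x = g x" using f g fun_cong[OF eq, of x] by (cases "x \<in> I") (auto simp: copies_def)
    qed
  qed
  moreover have "(\<lambda>\<psi>. restrict \<psi> (V - I)) ` copies n G V E I \<phi> \<subseteq> (V - I) \<rightarrow>\<^sub>E {..<n}"
    by (auto simp: copies_def)
  ultimately have "card (copies n G V E I \<phi>) \<le> card ((V - I) \<rightarrow>\<^sub>E {..<n})"
    using V by (intro card_inj_on_le[OF _ _ finite_PiE]) auto
  also have "\<dots> = n ^ (card V - card I)" using V I by (simp add: card_PiE card_Diff_subset finite_subset)
  finally show ?thesis by (simp add: Psi_card_copies)
qed

text \<open>The free vertices are embedded one at a time, and at least \<open>n - N\<close> values
  remain at each choice.\<close>

lemma card_injective_extensions_ge: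
  fixes \<phi> :: "nat \<Rightarrow> nat"
  assumes "finite D" "D \<inter> I = {}" "finite I" "card I + card D \<le> N" "inj_on \<phi> I" "\<phi> ` I \<subseteq> {..<n}"
  shows "(n - N) ^ card D \<le> card {\<psi> \<in> (I \<union> D) \<rightarrow>\<^sub>E {..<n}. inj_on \<psi> (I \<union> D) \<and> (\<forall>a\<in>I. \<psi> a = \<phi> a)}"
  using assms
proof (induction D rule: finite_induct)
  case empty
  let ?S = "{\<psi> \<in> (I \<union> {}) \<rightarrow>\<^sub>E {..<n}. inj_on \<psi> (I \<union> {}) \<and> (\<forall>a\<in>I. \<psi> a = \<phi> a)}"
  have "restrict \<phi> I \<in> ?S" using empty by (auto simp: inj_on_def)
  moreover have "finite ?S" using empty by (intro finite_subset[OF _ finite_PiE[of I "\<lambda>_. {..<n}"]]) auto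
  ultimately have "0 < card ?S" using card_gt_0_iff by blast
  then show ?case by (simp only: card.empty power_0 Suc_le_eq One_nat_def)
next
  case (insert x D)
  let ?S = "\<lambda>D. {\<psi> \<in> (I \<union> D) \<rightarrow>\<^sub>E {..<n}. inj_on \<psi> (I \<union> D) \<and> (\<forall>a\<in>I. \<psi> a = \<phi> a)}"
  let ?f = "\<lambda>(\<psi>::nat \<Rightarrow> nat, y). \<psi>(x := y)"
  have x: "x \<notin> I \<union> D" "x \<notin> I" using insert by auto
  have fS: "finite (?S D)" if "finite D" for D :: "nat set"
    using that insert.prems by (intro finite_subset[OF _ finite_PiE[of "I \<union> D" "\<lambda>_. {..<n}"]]) auto
  have "(n - N) ^ card (insert x D) = (n - N) ^ card D * (n - N)" using insert by simp
  also have "\<dots> \<le> card (?S D) * (n - N)" by (intro mult_right_mono insert.IH) (use insert in auto)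
  also have "\<dots> = (\<Sum>\<psi>\<in>?S D. n - N)" by simp
  also have "\<dots> \<le> (\<Sum>\<psi>\<in>?S D. card ({..<n} - \<psi> ` (I \<union> D)))"
  proof (rule sum_mono)
    fix \<psi> assume \<psi>: "\<psi> \<in> ?S D"
    have "card (\<psi> ` (I \<union> D)) \<le> card (I \<union> D)" by (rule card_image_le) (use insert in auto)
    also have "\<dots> \<le> N" using insert by (intro order.trans[OF card_Un_le]) simp
    finally show "n - N \<le> card ({..<n} - \<psi> ` (I \<union> D))"
      using diff_card_le_card_Diff[of "\<psi> ` (I \<union> D)" "{..<n}"] insert by simp
  qed
  also have "\<dots> = card (SIGMA \<psi>:?S D. {..<n} - \<psi> ` (I \<union> D))"
    using fS[OF insert(1)] by (simp add: card_SigmaI)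
  also have "\<dots> = card (?f ` (SIGMA \<psi>:?S D. {..<n} - \<psi> ` (I \<union> D)))"
  proof (rule card_image[symmetric], rule inj_onI)
    fix a b assume a: "a \<in> (SIGMA \<psi>:?S D. {..<n} - \<psi> ` (I \<union> D))" and b: "b \<in> (SIGMA \<psi>:?S D. {..<n} - \<psi> ` (I \<union> D))"
      and eq: "?f a = ?f b"
    obtain \<psi> y \<psi>' y' where ab: "a = (\<psi>, y)" "b = (\<psi>', y')" by force
    \<comment> \<open>Extensional functions have the default value at the new vertex, so the update
      at \<open>x\<close> can be undone.\<close>
    have u: "\<psi> x = undefined" "\<psi>' x = undefined" using a b ab x by (auto simp: PiE_def extensional_def)
    have eq': "\<psi>(x := y) = \<psi>'(x := y')" using eq ab by simp
    have "\<psi> z = \<psi>' z" for z using fun_cong[OF eq', of z] u by (cases "z = x") auto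
    then show "a = b" using fun_cong[OF eq', of x] ab by auto
  qed
  also have "\<dots> \<le> card (?S (insert x D))"
  proof (intro card_mono fS)
    show "?f ` (SIGMA \<psi>:?S D. {..<n} - \<psi> ` (I \<union> D)) \<subseteq> ?S (insert x D)"
    proof (rule image_subsetI)
      fix b assume b: "b \<in> (SIGMA \<psi>:?S D. {..<n} - \<psi> ` (I \<union> D))"
      obtain \<psi> y where beq: "b = (\<psi>, y)" by force
      have \<psi>: "\<psi> \<in> (I \<union> D) \<rightarrow>\<^sub>E {..<n}" "inj_on \<psi> (I \<union> D)" "\<forall>a\<in>I. \<psi> a = \<phi> a"
        and y: "y < n" "y \<notin> \<psi> ` (I \<union> D)" using b by (auto simp: beq)
      have ins: "I \<union> insert x D = insert x (I \<union> D)" by simp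
      have "\<psi>(x := y) \<in> insert x (I \<union> D) \<rightarrow>\<^sub>E {..<n}" using PiE_fun_upd[of y "\<lambda>_. {..<n}" x \<psi> "I \<union> D"] \<psi>(1) y by simp
      moreover have "inj_on (\<psi>(x := y)) (I \<union> D)" by (rule inj_on_fun_updI[OF \<psi>(2) y(2)])
      then have "inj_on (\<psi>(x := y)) (insert x (I \<union> D))"
        using x(1) y(2) by (auto simp: inj_on_insert image_iff)
      moreover have "\<forall>a\<in>I. (\<psi>(x := y)) a = \<phi> a" using \<psi>(3) x(2) by auto
      ultimately show "?f b \<in> ?S (insert x D)" unfolding beq ins by simp
    qed
  qed (use insert in auto)
  finally show ?case .
qed

text \<open>In \<open>K_n\<close> every injective extension of the roots is a copy; Bernoulli's
  inequality turns \<open>(1 - N / n) ^ k\<close> with \<open>k \<le> N\<close> into the relative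
  error \<open>N\<^sup>2 / n\<close>.\<close>

lemma Psi_complete_graph_bounds:
  assumes E: "ext_graph V E I" and N: "card V \<le> N" "N \<le> n" "n > 0" and \<phi>: "inj_on \<phi> I" "\<phi> ` I \<subseteq> {..<n}"
  shows "real n ^ (card V - card I) * (1 - (real N)\<^sup>2 / real n) \<le> real (Psi n (complete_graph n) V E I \<phi>)"
    and "real (Psi n (complete_graph n) V E I \<phi>) \<le> real n ^ (card V - card I)"
proof -
  have V: "finite V" "I \<subseteq> V" using E by (auto simp: ext_graph_def)
  then have fI: "finite I" "I \<union> (V - I) = V" using finite_subset by auto
  have c: "card (V - I) = card V - card I" "card I \<le> card V" using V fI by (simp_all add: card_Diff_subset card_mono)
  show "real (Psi n (complete_graph n) V E I \<phi>) \<le> real n ^ (card V - card I)"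
    using Psi_le_power[OF V, of n "complete_graph n" E \<phi>] by (simp flip: of_nat_power)
  have eq: "copies n (complete_graph n) V E I \<phi> = {\<psi> \<in> V \<rightarrow>\<^sub>E {..<n}. inj_on \<psi> V \<and> (\<forall>a\<in>I. \<psi> a = \<phi> a)}"
  proof -
    have "\<psi> ` e \<in> complete_graph n" if "\<psi> \<in> V \<rightarrow>\<^sub>E {..<n}" "inj_on \<psi> V" "e \<in> E" for \<psi> e
    proof -
      have e: "e \<subseteq> V" "card e = 2" using E that by (auto simp: ext_graph_def)
      then have "card (\<psi> ` e) = 2" using that by (simp add: card_image inj_on_subset)
      then show ?thesis using that e by (auto simp: complete_graph_def)
    qed
    then show ?thesis by (auto simp: copies_def)
  qed
  have "(n - N) ^ card (V - I) \<le> Psi n (complete_graph n) V E I \<phi>"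
    using card_injective_extensions_ge[of "V - I" I N \<phi> n] V fI \<phi> N c Diff_disjoint[of I V]
    by (simp add: Int_commute Psi_card_copies eq)
  then have "real ((n - N) ^ (card V - card I)) \<le> real (Psi n (complete_graph n) V E I \<phi>)"
    unfolding c(1) of_nat_le_iff .
  moreover have "real n ^ (card V - card I) * (1 - (real N)\<^sup>2 / real n) \<le> real ((n - N) ^ (card V - card I))"
  proof -
    have k: "card V - card I \<le> N" using N by simp
    have "real (card V - card I) * (real N / real n) \<le> real N * (real N / real n)"
      using k by (intro mult_right_mono) auto
    then have "1 - (real N)\<^sup>2 / real n \<le> 1 - real (card V - card I) * (real N / real n)"
      by (simp add: power2_eq_square)
    also have "\<dots> \<le> (1 - real N / real n) ^ (card V - card I)"
      by (rule power_one_minus_bounds) (use N in auto)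
    finally have "real n ^ (card V - card I) * (1 - (real N)\<^sup>2 / real n) \<le> real n ^ (card V - card I) * (1 - real N / real n) ^ (card V - card I)"
      by (intro mult_left_mono) auto
    also have "\<dots> = (real n * (1 - real N / real n)) ^ (card V - card I)" by (simp add: power_mult_distrib)
    also have "real n * (1 - real N / real n) = real (n - N)" using N by (simp add: field_simps of_nat_diff)
    finally show ?thesis by simp
  qed
  ultimately show "real n ^ (card V - card I) * (1 - (real N)\<^sup>2 / real n) \<le> real (Psi n (complete_graph n) V E I \<phi>)"
    by linarith
qed

section \<open>Changes of \<open>p\<close>, of \<open>\<zeta>\<close> and of \<open>ln p\<close> in
  one step\<close>

lemma pp_time_Suc:
  assumes "n > 0" "pp (time n i) > 0"
  shows "pp (time n (Suc i)) = pp (time n i) * (1 - 6 / ((real n)\<^sup>2 * pp (time n i)))"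
proof -
  have "pp (time n i) * (1 - 6 / ((real n)\<^sup>2 * pp (time n i))) = pp (time n i) - 6 / (real n)\<^sup>2"
    using assms by (simp add: right_diff_distrib)
  then show ?thesis by (simp add: pp_def time_def add_divide_distrib)
qed

lemma pp_time_antimono: "n > 0 \<Longrightarrow> i \<le> j \<Longrightarrow> pp (time n j) \<le> pp (time n i)"
  by (simp add: pp_def time_def divide_right_mono)

lemma pp_time_le_1: "pp (time n i) \<le> 1"
  by (simp add: pp_def time_def)

text \<open>\<open>\<zeta>\<close> is proportional to \<open>1 / p\<close>, so a step multiplies it
  by \<open>1 / (1 - x) \<ge> 1 + x\<close>. Errors of size \<open>\<zeta> x\<close> per step thus
  telescope to at most the final \<open>\<zeta>\<close>.\<close>

lemma zeta_Suc_diff_ge: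
  assumes n: "n > 0" "ln (real n) \<ge> 0" and p: "pp (time n i) > 0" "pp (time n (Suc i)) > 0"
  shows "zeta n (time n i) * (6 / ((real n)\<^sup>2 * pp (time n i))) \<le> zeta n (time n (Suc i)) - zeta n (time n i)"
proof -
  let ?p = "pp (time n i)" let ?x = "6 / ((real n)\<^sup>2 * ?p)"
  have z: "0 \<le> zeta n (time n i)" using n p by (simp add: zeta_def)
  have q: "pp (time n (Suc i)) = ?p * (1 - ?x)" by (rule pp_time_Suc[OF n(1) p(1)])
  have x: "0 < 1 - ?x" using p unfolding q by (simp add: zero_less_mult_iff)
  have x0: "0 \<le> ?x" using p by simp
  have "zeta n (time n (Suc i)) = zeta n (time n i) * (1 / (1 - ?x))" unfolding zeta_def q by simp
  moreover have "(1 + y) * (1 - y) \<le> 1" for y :: real by (simp add: algebra_simps)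
  then have "1 + ?x \<le> 1 / (1 - ?x)" using pos_le_divide_eq[OF x] by blast
  then have "zeta n (time n i) * (1 + ?x) \<le> zeta n (time n i) * (1 / (1 - ?x))" using z by (intro mult_left_mono)
  ultimately show ?thesis by (simp add: algebra_simps)
qed

text \<open>The analogue for errors of size \<open>x\<close> per step: they telescope to the
  decrease of \<open>ln p\<close>.\<close>

lemma ln_pp_Suc_diff_ge:
  assumes n: "n > 0" and p: "pp (time n i) > 0" "pp (time n (Suc i)) > 0"
  shows "6 / ((real n)\<^sup>2 * pp (time n i)) \<le> ln (pp (time n i)) - ln (pp (time n (Suc i)))"
proof -
  let ?p = "pp (time n i)" let ?x = "6 / ((real n)\<^sup>2 * ?p)"
  have q: "pp (time n (Suc i)) = ?p * (1 - ?x)" by (rule pp_time_Suc[OF n(1) p(1)])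
  have x: "0 < 1 - ?x" using p unfolding q by (simp add: zero_less_mult_iff)
  have "ln (1 - ?x) \<le> - ?x" by (rule ln_one_minus_pos_upper_bound) (use x p in auto)
  moreover have "ln (pp (time n (Suc i))) = ln ?p + ln (1 - ?x)" unfolding q by (rule ln_mult_pos[OF p(1) x])
  ultimately show ?thesis by simp
qed

subsection \<open>Concentration at a fixed time\<close>

definition regular :: "real \<Rightarrow> nat \<Rightarrow> graph \<Rightarrow> nat \<Rightarrow> bool" where
  "regular C n G i \<longleftrightarrow> (\<forall>u<n. \<forall>v<n. u \<noteq> v \<longrightarrow>
       \<bar>real (codeg G u v) / (real n * (pp (time n i))\<^sup>2) - 1\<bar> \<le> C * zeta n (time n i))
     \<and> \<bar>real (num_triangles G) / (real n ^ 3 * pp (time n i) ^ 3 / 6) - 1\<bar> \<le> C * (zeta n (time n i))\<^sup>2"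

lemma zeta_mono:
  assumes "n > 0" "ln (real n) \<ge> 0" "i \<le> j" "pp (time n j) > 0"
  shows "zeta n (time n i) \<le> zeta n (time n j)"
  unfolding zeta_def
  by (intro divide_left_mono mult_left_mono mult_pos_pos pp_time_antimono)
     (use assms pp_time_antimono[of n i j] in auto)

text \<open>\<open>potential_step\<close> and \<open>tr_step_exp_moment\<close> make
  \<open>\<Phi>\<close> a supermartingale as long as the graph is good. On the bad event it ends at
  1 or more, while it starts at \<open>exp (- (lam * \<epsilon> / 2))\<close> or less.\<close>

lemma fixed_time_tail:
  fixes C A \<sigma> lam \<epsilon> \<eta> m :: real
  assumes E: "ext_graph V E I" and N: "card V \<le> N" and k: "card V - card I = Suc k" and Ene: "E \<noteq> {}"
    and \<phi>: "inj_on \<phi> I" "\<phi> ` I \<subseteq> {..<n}"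
    and C: "C > 0" and A: "A \<ge> 0" and ln1: "ln (real n) \<ge> 1" and nN: "60 * real N ^ 2 \<le> real n"
    and T: "T \<le> n choose 2" and pT: "1 / sqrt (real n) \<le> pp (time n T)"
    and z1: "zeta n (time n T) \<le> 1" and Kz: "(3 * C + real N ^ 2) * zeta n (time n T) \<le> 1"
    and m: "m = 18 * real N ^ 2 * A * ln (real n) ^ (3 * k) * gsum V E I n (pp (time n T))"
    and lam: "lam \<ge> 0" "16 * (lam * m) \<le> 1"
    and \<eta>: "\<eta> = 2 * real N ^ 2 * (1 + 2 * (3 * C + real N ^ 2)) * zeta n (time n T) + 32 * real N ^ 2 * (lam * m) * ln (real n)"
      "\<eta> \<le> 1/2"
    and \<epsilon>: "4 * \<eta> + 2 * (real N ^ 2 / real n) \<le> \<epsilon>" and \<sigma>: "\<sigma> = 1 \<or> \<sigma> = -1"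
  shows "measure_pmf.prob (tr_process n)
      {xs. (\<forall>j<T. regular C n (xs ! j) j \<and> upper_bounds n A N k (pp (time n j)) (xs ! j))
         \<and> \<epsilon> * scaling V E I n (pp (time n T)) \<le> \<sigma> * (real (Psi n (xs ! T) V E I \<phi>) - scaling V E I n (pp (time n T)))}
    \<le> exp (- (lam * \<epsilon> / 2))"
proof -
  define e where "e = real (card E)"
  define K where "K = 3 * C + real N ^ 2"
  define z where "z i = zeta n (time n i)" for i
  define p where "p i = pp (time n i)" for i
  define S where "S i = scaling V E I n (p i)" for i
  define x where "x i = 6 / ((real n)\<^sup>2 * p i)" for i
  \<comment> \<open>The correction that vanishes at \<open>T\<close>. Its first part pays for the
    terms \<open>r + 2 * \<kappa>\<close> of \<open>potential_step\<close>, both of order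
    \<open>z\<close>; its second part pays for \<open>16 * (lam * m)\<close>.\<close>
  define w where "w i = 2 * e * (1 + 2 * K) * (z T - z i) + 32 * e * (lam * m) * (ln (p i) - ln (p T))" for i
  define \<theta> where "\<theta> i = lam * exp (\<sigma> * w i) / S i" for i
  \<comment> \<open>Chosen so that at time \<open>T\<close>, where \<open>w\<close> is 0, the
    exponent is nonnegative exactly when the deviation in direction \<open>\<sigma>\<close> reaches
    \<open>\<epsilon> * S T\<close>.\<close>
  define c where "c = - \<sigma> * lam - lam * \<epsilon>"
  define \<Phi> where "\<Phi> i G = exp (\<sigma> * \<theta> i * real (Psi n G V E I \<phi>) + c)" for i G
  have n1: "real n > 1" 
  proof (rule ccontr)
    assume "\<not> 1 < real n"
    then have "n = 0 \<or> n = 1" by auto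
    then show False using ln1 by auto
  qed
  then have n0: "n > 0" by simp
  have V: "finite V" "I \<subseteq> V" using E by (auto simp: ext_graph_def)
  have fE: "finite E" by (rule ext_graph_finite_edges[OF E])
  have e1: "e \<ge> 1" "card E \<ge> 1" using Ene fE by (auto simp: e_def Suc_le_eq card_gt_0_iff)
  have eN: "e \<le> real N ^ 2" unfolding e_def by (rule card_edges_le[OF E N])
  have K0: "K \<ge> 1" using C eN e1 by (simp add: K_def)
  have pTp: "p T > 0" 
  proof -
    have "0 < 1 / sqrt (real n)" using n0 by simp
    then show ?thesis using pT unfolding p_def by linarith
  qed
  have pm: "p T \<le> p i" if "i \<le> T" for i using pp_time_antimono[OF n0 that] by (simp add: p_def)
  have pp: "p i > 0" if "i \<le> T" for i using pm[OF that] pTp by linarith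
  have zm: "z i \<le> z T" if "i \<le> T" for i using zeta_mono[OF n0 _ that] ln1 pTp by (simp add: z_def p_def)
  have z0: "0 \<le> z i" if "i \<le> T" for i using pp[OF that] ln1 by (simp add: z_def zeta_def p_def)
  have S0: "S i > 0" if "i \<le> T" for i unfolding S_def by (rule scaling_pos[OF n0 pp[OF that]])
  have g0: "gsum V E I n (p T) > 0" by (rule gsum_pos[OF E Ene n0 pTp])
  have m0: "m \<ge> 0" unfolding m p_def[symmetric] using A ln1 g0 by simp
  have lm0: "0 \<le> lam * m" using lam m0 by simp
  \<comment> \<open>The last bound puts the quadratic error \<open>r * r\<close> under the
    \<open>\<zeta>\<close> part of \<open>w\<close>.\<close>
  have xi: "0 \<le> x i" "e * x i \<le> 1/10" "e * x i \<le> z i" if "i \<le> T" for i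
  proof -
    show "0 \<le> x i" using pp[OF that] by (simp add: x_def)
    have sq1: "1 \<le> sqrt (real n)" using n1 by simp
    have "1 / sqrt (real n) \<le> p i" using pT pm[OF that] unfolding p_def by linarith
    then have pi: "1 \<le> sqrt (real n) * p i" using sq1 by (simp add: divide_le_eq mult.commute)
    have nn: "(real n)\<^sup>2 = real n * (sqrt (real n) * sqrt (real n))" by (simp add: power2_eq_square)
    have ne: "60 * e \<le> real n" using eN nN by simp
    have g1: "1 \<le> sqrt (real n) * (sqrt (real n) * p i)" using mult_mono[OF sq1 pi] sq1 by simp
    have g2: "1 \<le> sqrt (real n) * ln (real n)" using mult_mono[OF sq1 ln1] sq1 by simp
    have "60 * e \<le> (real n)\<^sup>2 * p i"
      using ne mult_left_mono[OF g1, of "real n"] by (simp add: nn mult_ac)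
    then show "e * x i \<le> 1/10" using pp[OF that] n0 by (simp add: x_def divide_le_eq)
    have "e * 6 \<le> real n * (sqrt (real n) * ln (real n))"
      using ne e1(1) mult_left_mono[OF g2, of "real n"] by linarith
    then have "e * 6 / ((real n)\<^sup>2 * p i) \<le> real n * (sqrt (real n) * ln (real n)) / ((real n)\<^sup>2 * p i)"
      using pp[OF that] by (intro divide_right_mono) auto
    also have "\<dots> = z i" using pp[OF that] n0 unfolding z_def zeta_def p_def[symmetric]
      by (subst frac_eq_eq) (simp, simp, simp only: nn mult_ac)
    finally show "e * x i \<le> z i" by (simp add: x_def)
  qed
  have wstep: "w i - w (Suc i) \<ge> 2 * (e * x i) * (e * x i + 2 * (K * z i) + 16 * (lam * m))" if "Suc i \<le> T" for i
  proof -
    have i: "i \<le> T" using that by simp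
    have "z i * x i \<le> z (Suc i) - z i"
      unfolding z_def x_def p_def by (rule zeta_Suc_diff_ge) (use n0 ln1 pp[OF i] pp[OF that] in \<open>auto simp: p_def\<close>)
    then have "2 * e * (1 + 2 * K) * (z i * x i) \<le> 2 * e * (1 + 2 * K) * (z (Suc i) - z i)"
      using e1 K0 by (intro mult_left_mono) auto
    moreover have "x i \<le> ln (p i) - ln (p (Suc i))"
      unfolding x_def p_def by (rule ln_pp_Suc_diff_ge) (use n0 pp[OF i] pp[OF that] in \<open>auto simp: p_def\<close>)
    then have "32 * e * (lam * m) * x i \<le> 32 * e * (lam * m) * (ln (p i) - ln (p (Suc i)))"
      using e1 lm0 by (intro mult_left_mono) auto
    moreover have "2 * (e * x i) * (e * x i) \<le> 2 * (e * x i) * z i"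
      using xi[OF i] e1 by (intro mult_left_mono) auto
    ultimately show ?thesis by (simp add: w_def algebra_simps)
  qed
  have wb: "0 \<le> w i" "w i \<le> \<eta>" if "i \<le> T" for i
  proof -
    have l: "ln (p T) \<le> ln (p i)" "ln (p i) \<le> 0" using pm[OF that] pp[OF that] pTp pp_time_le_1[of n i] by (auto simp: p_def)
    show "0 \<le> w i" unfolding w_def using zm[OF that] l e1 K0 lam(1) m0 by (intro add_nonneg_nonneg mult_nonneg_nonneg) auto
    have "1 / p T \<le> sqrt (real n)" using pT pTp n0 unfolding p_def[symmetric] by (simp add: field_simps)
    also have "sqrt (real n) \<le> real n" using n1 by (simp add: real_le_lsqrt power2_eq_square)
    finally have "ln (1 / p T) \<le> ln (real n)" using pTp n0 by (subst ln_le_cancel_iff) auto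
    then have "ln (p i) - ln (p T) \<le> ln (real n)" using l pTp by (simp add: ln_div)
    then have "32 * e * (lam * m) * (ln (p i) - ln (p T)) \<le> 32 * real N ^ 2 * (lam * m) * ln (real n)"
      using eN e1 lam(1) m0 l by (intro mult_mono mult_nonneg_nonneg) auto
    moreover have "2 * e * (1 + 2 * K) * (z T - z i) \<le> 2 * real N ^ 2 * (1 + 2 * K) * z T"
      using eN e1 K0 z0[OF that] zm[OF that] by (intro mult_mono) auto
    ultimately show "w i \<le> \<eta>" by (simp add: w_def \<eta>(1) K_def z_def)
  qed
  have step: "(\<integral>\<^sup>+ G'. ennreal (\<Phi> (Suc i) G') \<partial>tr_step G) \<le> ennreal (\<Phi> i G)"
    if i: "i < 0 + T" and G: "G \<subseteq> complete_graph n" and good: "regular C n G i \<and> upper_bounds n A N k (p i) G" for i G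
  proof -
    have iT: "i \<le> T" "Suc i \<le> T" using i by auto
    let ?\<mu> = "mean_lost n G V E I \<phi>" let ?P = "real (Psi n G V E I \<phi>)"
    have "K * z i \<le> K * z T" using K0 by (intro mult_left_mono zm iT) simp
    then have Kzi: "K * z i \<le> 1" using Kz by (simp add: K_def z_def)
    have r: "6 * real (card E) / ((real n)\<^sup>2 * p i) = e * x i" by (simp add: e_def x_def)
    have z1i: "z i \<le> 1" using z1 zm[OF iT(1)] by (simp add: z_def)
    have cd: "\<bar>real (codeg G u v) / (real n * (p i)\<^sup>2) - 1\<bar> \<le> C * z i" if "u < n" "v < n" "u \<noteq> v" for u v
      using good that by (auto simp: regular_def p_def z_def)
    have q: "\<bar>real (num_triangles G) / (real n ^ 3 * p i ^ 3 / 6) - 1\<bar> \<le> C * (z i)\<^sup>2"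
      using good by (auto simp: regular_def p_def z_def)
    have zi: "z i = ln (real n) / (sqrt (real n) * p i)" by (simp add: z_def zeta_def p_def)
    have "num_triangles G > 0 \<and> \<bar>?\<mu> - ?P * (e * x i)\<bar> \<le> ?P * (e * x i) * (K * z i)"
      using mean_lost_bounds[OF G E C ln1 pp[OF iT(1)] zi eN[unfolded e_def] K_def Kzi z1i cd q r[symmetric]] by blast
    then have ne: "triangles G \<noteq> {}" and \<mu>: "\<bar>?\<mu> - ?P * (e * x i)\<bar> \<le> ?P * (e * x i) * (K * z i)"
      by (auto simp: num_triangles_def)
    have SS: "S (Suc i) = S i * (1 - x i) ^ card E"
      using pp_time_Suc[OF n0, of i] pp[OF iT(1)] by (simp add: S_def scaling_def p_def x_def power_mult_distrib)
    note ps = potential_step[OF S0[OF iT(1)] SS xi(1)[OF iT(1)], of "e * x i" \<sigma> "K * z i" lam m "w (Suc i)" "w i"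
        ?\<mu> ?P "\<theta> i" "\<theta> (Suc i)"]
    have ps1: "\<bar>\<sigma> * \<theta> (Suc i)\<bar> * (m * S i) \<le> 1"
      by (rule ps(1)) (use xi[OF iT(1)] e1 \<sigma> Kzi K0 z0[OF iT(1)] lam m0 wb[OF iT(2)] \<eta>(2) wstep[OF iT(2)] \<mu> in \<open>auto simp: e_def \<theta>_def\<close>)
    have ps2: "\<sigma> * \<theta> (Suc i) * ?P - \<sigma> * \<theta> (Suc i) * ?\<mu> + (\<sigma> * \<theta> (Suc i))\<^sup>2 * (m * S i) * ?\<mu> \<le> \<sigma> * \<theta> i * ?P"
      by (rule ps(2)) (use xi[OF iT(1)] e1 \<sigma> Kzi K0 z0[OF iT(1)] lam m0 wb[OF iT(2)] \<eta>(2) wstep[OF iT(2)] \<mu> in \<open>auto simp: e_def \<theta>_def\<close>)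
    \<comment> \<open>\<open>gsum\<close> grows as \<open>p\<close> falls, so \<open>m\<close>,
      computed at time \<open>T\<close>, serves at every earlier time.\<close>
    have M: "real (lost n G V E I \<phi> t) \<le> m * S i" if t: "t \<in> triangles G" for t
    proof -
      have "real (lost n G V E I \<phi> t) \<le> 18 * real (card E) * A * ln (real n) ^ (3 * k) * gsum V E I n (p i) * S i"
        unfolding S_def by (rule lost_le[OF G E N _ _ t n0 pp[OF iT(1)]]) (use k good A ln1 in auto)
      also have "\<dots> \<le> m * S i"
        unfolding m p_def[symmetric]
        by (intro mult_mono gsum_antimono)
           (use eN e1 A ln1 S0[OF iT(1)] pm[OF iT(1)] pTp n0 gsum_nonneg[OF n0 pp[OF iT(1)]] g0 in \<open>auto simp: e_def intro!: mult_nonneg_nonneg\<close>)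
      finally show ?thesis .
    qed
    have "(\<integral>\<^sup>+ G'. ennreal (\<Phi> (Suc i) G') \<partial>tr_step G)
      \<le> ennreal (exp (\<sigma> * \<theta> (Suc i) * ?P - \<sigma> * \<theta> (Suc i) * ?\<mu> + (\<sigma> * \<theta> (Suc i))\<^sup>2 * (m * S i) * ?\<mu> + c))"
      unfolding \<Phi>_def by (rule tr_step_exp_moment[OF G E ne M ps1])
    also have "\<dots> \<le> ennreal (\<Phi> i G)" unfolding \<Phi>_def using ps2 by (intro ennreal_leI) simp
    finally show ?thesis .
  qed
  have markov: "emeasure (tr_process n) {xs. (\<forall>j<T. regular C n (xs ! (j)) (0 + j) \<and> upper_bounds n A N k (p (0 + j)) (xs ! j))
      \<and> 1 \<le> \<Phi> (0 + T) (xs ! T)} \<le> ennreal (\<Phi> 0 (complete_graph n))"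
    unfolding tr_process_def
    by (rule tr_run_supermartingale[where s = 0 and T = T and n = n and \<Phi> = \<Phi>
          and good = "\<lambda>j G. regular C n G j \<and> upper_bounds n A N k (p j) G"]) (use step T in auto)
  have init: "\<Phi> 0 (complete_graph n) \<le> exp (- (lam * \<epsilon> / 2))"
  proof -
    define X where "X = real (Psi n (complete_graph n) V E I \<phi>) / S 0"
    have "p 0 = 1" by (simp add: p_def pp_def time_def)
    then have S00: "S 0 = real n ^ (card V - card I)" by (simp add: S_def scaling_def)
    have Nn: "N \<le> n" using nN n1 
    proof -
      have "real N \<le> real N ^ 2" by (cases "N = 0") (simp_all add: power2_eq_square)
      then show ?thesis using nN by linarith
    qed
    define b where "b = real N ^ 2 / real n"
    have X: "1 - b \<le> X" "X \<le> 1"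
      using Psi_complete_graph_bounds[OF E N Nn n0 \<phi>] n0 by (simp_all add: X_def S00 b_def field_simps)
    have "real N ^ 2 \<le> real n" using nN zero_le_power2[of "real N"] by linarith
    then have b0: "0 \<le> b" "b \<le> 1" using n0 by (simp_all add: b_def divide_le_eq del: of_nat_power)
    have w0: "0 \<le> w 0" "w 0 \<le> \<eta>" using wb[of 0] by auto
    \<comment> \<open>The hypothesis makes \<open>\<epsilon>\<close> at least twice this bound, so
      half of \<open>\<epsilon>\<close> survives in the exponent.\<close>
    have "\<sigma> * exp (\<sigma> * w 0) * X - \<sigma> \<le> 2 * \<eta> + b"
    proof (cases "\<sigma> = 1")
      case True
      have "exp (w 0) * X \<le> exp (w 0) * 1" using X by (intro mult_left_mono) auto
      also have "\<dots> \<le> 1 + 2 * w 0" using w0 \<eta>(2) real_exp_bound_lemma[of "w 0"] by simp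
      finally show ?thesis unfolding True mult_1_left using w0 b0(1) by linarith
    next
      case False
      then have s: "\<sigma> = -1" using \<sigma> by simp
      have "1 - \<eta> \<le> exp (- w 0)" using exp_ge_add_one_self[of "- w 0"] w0 by linarith
      then have "(1 - \<eta>) * (1 - b) \<le> exp (- w 0) * X" using X b0 \<eta>(2) by (intro mult_mono) auto
      moreover have "0 \<le> \<eta> * b" using w0 b0 by (intro mult_nonneg_nonneg) auto
      ultimately have "1 - \<eta> - b \<le> exp (- w 0) * X" by (simp add: algebra_simps)
      then have "- 1 * exp (- 1 * w 0) * X - - 1 \<le> 2 * \<eta> + b" using w0 by simp
      then show ?thesis unfolding s .
    qed
    then have "\<sigma> * exp (\<sigma> * w 0) * X - \<sigma> - \<epsilon> \<le> - (\<epsilon> / 2)" using \<epsilon> by (simp add: b_def)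
    then have "lam * (\<sigma> * exp (\<sigma> * w 0) * X - \<sigma> - \<epsilon>) \<le> lam * - (\<epsilon> / 2)" using lam by (intro mult_left_mono)
    then show ?thesis by (simp add: \<Phi>_def \<theta>_def c_def X_def algebra_simps)
  qed
  have "emeasure (tr_process n) {xs. (\<forall>j<T. regular C n (xs ! j) j \<and> upper_bounds n A N k (p j) (xs ! j))
         \<and> \<epsilon> * S T \<le> \<sigma> * (real (Psi n (xs ! T) V E I \<phi>) - S T)}
     \<le> emeasure (tr_process n) {xs. (\<forall>j<T. regular C n (xs ! (j)) (0 + j) \<and> upper_bounds n A N k (p (0 + j)) (xs ! j))
      \<and> 1 \<le> \<Phi> (0 + T) (xs ! T)}"
  proof (intro emeasure_mono subsetI CollectI conjI; clarsimp)
    fix xs assume h: "\<epsilon> * S T \<le> \<sigma> * (real (Psi n (xs ! T) V E I \<phi>) - S T)"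
    have "w T = 0" by (simp add: w_def)
    then have "\<sigma> * \<theta> T * real (Psi n (xs ! T) V E I \<phi>) + c = (lam / S T) * (\<sigma> * (real (Psi n (xs ! T) V E I \<phi>) - S T) - \<epsilon> * S T)"
      using S0[of T] by (simp add: \<theta>_def c_def field_simps)
    also have "\<dots> \<ge> 0" using h lam S0[of T] by simp
    finally show "1 \<le> \<Phi> T (xs ! T)" by (simp add: \<Phi>_def)
  qed
  also note markov
  also have "ennreal (\<Phi> 0 (complete_graph n)) \<le> ennreal (exp (- (lam * \<epsilon> / 2)))" by (rule ennreal_leI[OF init])
  finally show ?thesis
    by (simp add: measure_pmf.emeasure_eq_measure S_def p_def)
qed

text \<open>With \<open>y = B * ln n ^ (3 * k + 3) * g\<close>, the relative deviation is the drift
  error \<open>z\<close> plus a Gaussian term \<open>sqrt y\<close> and a Poisson term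
  \<open>y\<close>.\<close>

definition dev :: "real \<Rightarrow> real \<Rightarrow> nat \<Rightarrow> nat \<Rightarrow> real \<Rightarrow> real \<Rightarrow> real" where
  "dev c B k n z g = c * (z + sqrt (B * ln (real n) ^ (3 * k + 3) * g) + B * ln (real n) ^ (3 * k + 3) * g)"

text \<open>The first summand is 8 times the coefficient of \<open>\<zeta>\<close> in
  \<open>\<eta>\<close> of \<open>fixed_time_tail\<close>. In the second, 1028 = 2 * 512 + 4: twice
  the constant in the choice of \<open>lam\<close>, and room for the initial error.\<close>

definition dev_const :: "real \<Rightarrow> nat \<Rightarrow> real" where
  "dev_const C N = 16 * real N ^ 2 * (1 + 2 * (3 * C + real N ^ 2)) + 1028 * real N ^ 2"

text \<open>\<open>fixed_time_tail\<close> with a nearly optimal \<open>lam\<close>: as large as the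
  constraints on \<open>lam * m * ln n\<close> permit, which suffices for the exponent
  \<open>(ln n)\<^sup>2\<close>.\<close>

lemma deviation_tail:
  fixes C A \<sigma> :: real
  assumes E: "ext_graph V E I" and N: "card V \<le> N" and k: "card V - card I = Suc k" and Ene: "E \<noteq> {}"
    and \<phi>: "inj_on \<phi> I" "\<phi> ` I \<subseteq> {..<n}"
    and C: "C > 0" and A: "A > 0" and ln1: "ln (real n) \<ge> 1" and nN: "60 * real N ^ 2 \<le> real n"
    and T: "T \<le> n choose 2" and pT: "1 / sqrt (real n) \<le> pp (time n T)"
    and z1: "8 * real N ^ 2 * (1 + 2 * (3 * C + real N ^ 2)) * zeta n (time n T) \<le> 1"
    and \<sigma>: "\<sigma> = 1 \<or> \<sigma> = -1"
  shows "measure_pmf.prob (tr_process n)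
      {xs. (\<forall>j<T. regular C n (xs ! j) j \<and> upper_bounds n A N k (pp (time n j)) (xs ! j))
         \<and> dev (dev_const C N) (18 * real N ^ 2 * A) k n (zeta n (time n T)) (gsum V E I n (pp (time n T))) * scaling V E I n (pp (time n T))
            \<le> \<sigma> * (real (Psi n (xs ! T) V E I \<phi>) - scaling V E I n (pp (time n T)))}
    \<le> exp (- (ln (real n))\<^sup>2)"
proof -
  define l where "l = ln (real n)"
  define z where "z = zeta n (time n T)"
  define g where "g = gsum V E I n (pp (time n T))"
  define m where "m = 18 * real N ^ 2 * A * l ^ (3 * k) * g"
  define y where "y = m * l ^ 3"
  define c where "c = dev_const C N"
  define \<epsilon> where "\<epsilon> = c * (z + sqrt y + y)"
  \<comment> \<open>512 = 32 * 16 makes the second term of \<open>\<eta>\<close> equal to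
    \<open>min 1 \<epsilon> / 16\<close>.\<close>
  define c2 where "c2 = 512 * real N ^ 2"
  define lam where "lam = min 1 \<epsilon> / (c2 * m * l)"
  have V: "finite V" "I \<subseteq> V" using E by (auto simp: ext_graph_def)
  have "card V \<ge> 1" using k by simp
  then have N1: "real N \<ge> 1" using N by simp
  then have N2: "real N ^ 2 \<ge> 1" by simp
  have n0: "n > 0" using ln1 by (cases "n = 0") auto
  have l1: "l \<ge> 1" using ln1 by (simp add: l_def)
  have "0 < 1 / sqrt (real n)" using n0 by simp
  then have p0: "pp (time n T) > 0" using pT by linarith
  have g0: "g > 0" unfolding g_def by (rule gsum_pos[OF E Ene n0 p0])
  have m0: "m > 0" unfolding m_def using A l1 g0 N1 by (intro mult_pos_pos zero_less_power) auto
  have y0: "y > 0" unfolding y_def using m0 l1 by simp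
  have z0: "z \<ge> 0" unfolding z_def zeta_def using p0 ln1 by simp
  have q0: "0 \<le> 16 * real N ^ 2 * (1 + 2 * (3 * C + real N ^ 2))"
    using C by (intro mult_nonneg_nonneg add_nonneg_nonneg) auto
  have c: "c \<ge> 1" "c \<ge> 2 * c2" "c2 \<ge> 1"
    using q0 N2 unfolding c_def dev_const_def c2_def by linarith+
  have c0: "c \<ge> 8 * (2 * real N ^ 2 * (1 + 2 * (3 * C + real N ^ 2))) + 4 * real N ^ 2"
    using N2 by (simp add: c_def dev_const_def)
  have \<epsilon>0: "\<epsilon> > 0" unfolding \<epsilon>_def using c z0 y0 by (intro mult_pos_pos add_pos_pos add_nonneg_pos) auto
  have lam0: "0 \<le> lam" unfolding lam_def using \<epsilon>0 c m0 l1 by simp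
  have lml: "lam * m * l = min 1 \<epsilon> / c2" using m0 l1 c by (simp add: lam_def)
  have lm: "lam * m \<le> lam * m * l" using l1 lam0 m0 mult_left_mono[of 1 l "lam * m"] by simp
  have mc2: "min 1 \<epsilon> / c2 \<le> 1 / 512" using N2 \<epsilon>0 by (simp add: c2_def divide_le_eq min_le_iff_disj)
  have lm16: "16 * (lam * m) \<le> 1" using lm lml mc2 by linarith
  have b: "0 \<le> 3 * C" "0 \<le> real N ^ 2" using C by auto
  have K1: "1 \<le> 1 + 2 * (3 * C + real N ^ 2)" "3 * C + real N ^ 2 \<le> 1 + 2 * (3 * C + real N ^ 2)" 
    using b by (simp, argo)
  have big: "3 * C + real N ^ 2 \<le> 8 * real N ^ 2 * (1 + 2 * (3 * C + real N ^ 2))" "1 \<le> 8 * real N ^ 2 * (1 + 2 * (3 * C + real N ^ 2))"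
    using mult_mono[of 1 "8 * real N ^ 2" "3 * C + real N ^ 2", OF _ K1(2)] mult_mono[of 1 "8 * real N ^ 2" 1, OF _ K1(1)] N2 b by simp_all
  have zz: "z \<le> 1" "(3 * C + real N ^ 2) * z \<le> 1"
    using mult_right_mono[OF big(1) z0] mult_right_mono[OF big(2) z0] z1 unfolding z_def[symmetric] by linarith+
  define a where "a = 2 * real N ^ 2 * (1 + 2 * (3 * C + real N ^ 2))"
  define \<eta> where "\<eta> = a * z + 32 * real N ^ 2 * (lam * m) * l"
  have "32 * real N ^ 2 * (lam * m) * l = 32 * real N ^ 2 * (lam * m * l)" by simp
  also have "\<dots> = min 1 \<epsilon> / 16" unfolding lml using N1 by (simp add: c2_def)
  finally have \<eta>': "\<eta> = a * z + min 1 \<epsilon> / 16" by (simp add: \<eta>_def)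
  have az: "4 * (a * z) \<le> 1" using z1 by (simp add: a_def z_def)
  have \<eta>2: "\<eta> \<le> 1/2" unfolding \<eta>' using az by simp
  \<comment> \<open>Lets the initial error \<open>N\<^sup>2 / n\<close> be charged to the
    \<open>\<zeta>\<close> term of \<open>\<epsilon>\<close>.\<close>
  have nz: "1 / real n \<le> z"
  proof -
    have "1 / real n \<le> 1 / sqrt (real n)"
      using n0 by (intro divide_left_mono) (auto simp: real_le_lsqrt power2_eq_square sqrt_le_D intro!: real_le_lsqrt)
    also have "\<dots> \<le> l / (sqrt (real n) * pp (time n T))"
      using n0 p0 l1 pp_time_le_1[of n T] by (intro frac_le) (auto simp: mult_left_le)
    finally show ?thesis by (simp add: z_def zeta_def l_def)
  qed
  have \<epsilon>b: "4 * \<eta> + 2 * (real N ^ 2 / real n) \<le> \<epsilon>"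
  proof -
    have "real N ^ 2 / real n \<le> real N ^ 2 * z" using mult_left_mono[OF nz, of "real N ^ 2"] by simp
    moreover have "(8 * a + 4 * real N ^ 2) * z \<le> c * z" using c0 z0 by (intro mult_right_mono) (auto simp: a_def)
    moreover have "c * z \<le> \<epsilon>" unfolding \<epsilon>_def using c y0 by (intro mult_left_mono) auto
    moreover have "(8 * a + 4 * real N ^ 2) * z = 8 * (a * z) + 4 * (real N ^ 2 * z)" by (simp add: algebra_simps)
    moreover have "min 1 \<epsilon> \<le> \<epsilon>" by simp
    ultimately show ?thesis unfolding \<eta>' using \<epsilon>0 by argo
  qed
  \<comment> \<open>The term \<open>y\<close> of \<open>\<epsilon>\<close> serves the case
    \<open>\<epsilon> \<ge> 1\<close> and the term \<open>sqrt y\<close> the case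
    \<open>\<epsilon> < 1\<close>; in both,
    \<open>min 1 \<epsilon> * \<epsilon> \<ge> c * y\<close>, and dividing by
    \<open>c2 * m * l\<close> leaves \<open>(c / c2) * l\<^sup>2\<close>.\<close>
  have exponent: "l\<^sup>2 \<le> lam * \<epsilon> / 2"
  proof -
    have sy: "0 \<le> sqrt y" using y0 by simp
    have 1: "c * y \<le> \<epsilon>" unfolding \<epsilon>_def using c z0 sy by (intro mult_left_mono) auto
    have "c * sqrt y \<le> \<epsilon>" unfolding \<epsilon>_def using c z0 y0 by (intro mult_left_mono) auto
    then have "(c * sqrt y) * (c * sqrt y) \<le> \<epsilon> * \<epsilon>" using c sy \<epsilon>0 by (intro mult_mono) auto
    then have "c * (c * y) \<le> \<epsilon> * \<epsilon>" using y0 by (simp add: mult_ac)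
    moreover have "1 * (c * y) \<le> c * (c * y)" using c y0 by (intro mult_right_mono) auto
    ultimately have "c * y \<le> min 1 \<epsilon> * \<epsilon>" using 1 by (simp add: min_def)
    then have "c * y / (c2 * m * l) \<le> min 1 \<epsilon> * \<epsilon> / (c2 * m * l)" using c m0 l1 by (intro divide_right_mono) auto
    moreover have "c * y / (c2 * m * l) = (c / c2) * l\<^sup>2" using m0 l1 c by (simp add: y_def field_simps power2_eq_square power3_eq_cube)
    moreover have "2 * l\<^sup>2 \<le> (c / c2) * l\<^sup>2" using c by (intro mult_right_mono) (auto simp: le_divide_eq)
    moreover have "min 1 \<epsilon> * \<epsilon> / (c2 * m * l) = lam * \<epsilon>" by (simp add: lam_def)
    ultimately show ?thesis by linarith
  qed
  have d: "dev (dev_const C N) (18 * real N ^ 2 * A) k n (zeta n (time n T)) (gsum V E I n (pp (time n T))) = \<epsilon>"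
    by (simp add: dev_def \<epsilon>_def c_def z_def y_def m_def l_def g_def power_add mult_ac)
  have "measure_pmf.prob (tr_process n)
      {xs. (\<forall>j<T. regular C n (xs ! j) j \<and> upper_bounds n A N k (pp (time n j)) (xs ! j))
         \<and> \<epsilon> * scaling V E I n (pp (time n T)) \<le> \<sigma> * (real (Psi n (xs ! T) V E I \<phi>) - scaling V E I n (pp (time n T)))}
    \<le> exp (- (lam * \<epsilon> / 2))"
    by (rule fixed_time_tail[OF E N k Ene \<phi> C _ ln1 nN T pT _ _ _ lam0 lm16 _ \<eta>2 \<epsilon>b \<sigma>])
       (use A zz in \<open>auto simp: z_def m_def l_def g_def \<eta>_def a_def\<close>)
  also have "\<dots> \<le> exp (- (ln (real n))\<^sup>2)" using exponent by (simp add: l_def)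
  finally show ?thesis unfolding d .
qed

text \<open>Extension graphs have arbitrary natural numbers as vertices. Invariance under
  relabelling moves them into \<open>{..<N}\<close>, so that the union bound runs over a finite
  set.\<close>

lemma relabel:
  assumes E: "ext_graph V E I" and f: "inj_on f V"
  shows "ext_graph (f ` V) ((`) f ` E) (f ` I)"
    and "card (f ` V) = card V" and "card (f ` I) = card I" and "card ((`) f ` E) = card E"
    and "Psi n G (f ` V) ((`) f ` E) (f ` I) (\<phi> \<circ> inv_into V f) = Psi n G V E I \<phi>"
    and "gsum (f ` V) ((`) f ` E) (f ` I) n p = gsum V E I n p"
proof -
  have V: "finite V" "I \<subseteq> V" and Ev: "\<And>e. e \<in> E \<Longrightarrow> e \<subseteq> V \<and> card e = 2 \<and> \<not> e \<subseteq> I" using E by (auto simp: ext_graph_def)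
  have EP: "E \<subseteq> Pow V" using Ev by auto
  have fP: "inj_on ((`) f) (Pow V)" by (rule inj_on_image_Pow[OF f])
  have sub: "f ` A \<subseteq> f ` B \<longleftrightarrow> A \<subseteq> B" if "A \<subseteq> V" "B \<subseteq> V" for A B
    using inj_on_image_subset_iff[OF f that] .
  have crd: "card (f ` A) = card A" if "A \<subseteq> V" for A using card_image[OF inj_on_subset[OF f that]] .
  show "ext_graph (f ` V) ((`) f ` E) (f ` I)" using V Ev sub crd by (auto simp: ext_graph_def)
  show "card (f ` V) = card V" "card (f ` I) = card I" using crd V by auto
  show "card ((`) f ` E) = card E" using card_image[OF inj_on_subset[OF fP EP]] .
  have inv: "inv_into V f (f x) = x" if "x \<in> V" for x using inv_into_f_f[OF f that] .
  have "bij_betw (\<lambda>\<psi>. restrict (\<psi> \<circ> inv_into V f) (f ` V)) (copies n G V E I \<phi>)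
     (copies n G (f ` V) ((`) f ` E) (f ` I) (\<phi> \<circ> inv_into V f))"
  proof (rule bij_betw_byWitness[where f' = "\<lambda>\<psi>. restrict (\<psi> \<circ> f) V"])
    show "\<forall>\<psi>\<in>copies n G V E I \<phi>. restrict (restrict (\<psi> \<circ> inv_into V f) (f ` V) \<circ> f) V = \<psi>"
      using inv by (auto simp: copies_def PiE_def extensional_def fun_eq_iff restrict_def)
    show "\<forall>\<psi>\<in>copies n G (f ` V) ((`) f ` E) (f ` I) (\<phi> \<circ> inv_into V f). restrict (restrict (\<psi> \<circ> f) V \<circ> inv_into V f) (f ` V) = \<psi>"
      using inv by (auto simp: copies_def PiE_def extensional_def fun_eq_iff restrict_def)
    show "(\<lambda>\<psi>. restrict (\<psi> \<circ> inv_into V f) (f ` V)) ` copies n G V E I \<phi> \<subseteq> copies n G (f ` V) ((`) f ` E) (f ` I) (\<phi> \<circ> inv_into V f)"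
    proof (rule image_subsetI)
      fix \<psi> assume \<psi>: "\<psi> \<in> copies n G V E I \<phi>"
      let ?\<psi> = "restrict (\<psi> \<circ> inv_into V f) (f ` V)"
      have v: "?\<psi> (f x) = \<psi> x" if "x \<in> V" for x using that inv by simp
      have im: "?\<psi> ` f ` e = \<psi> ` e" if "e \<subseteq> V" for e
        unfolding image_image by (rule image_cong) (use that v in auto)
      have "inj_on ?\<psi> (f ` V)" using \<psi> v by (auto simp: inj_on_def copies_def)
      then show "?\<psi> \<in> copies n G (f ` V) ((`) f ` E) (f ` I) (\<phi> \<circ> inv_into V f)"
        using \<psi> v im Ev V inv by (auto simp: copies_def subset_iff Pi_iff)
    qed
    show "(\<lambda>\<psi>. restrict (\<psi> \<circ> f) V) ` copies n G (f ` V) ((`) f ` E) (f ` I) (\<phi> \<circ> inv_into V f) \<subseteq> copies n G V E I \<phi>"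
    proof (rule image_subsetI)
      fix \<psi> assume \<psi>: "\<psi> \<in> copies n G (f ` V) ((`) f ` E) (f ` I) (\<phi> \<circ> inv_into V f)"
      have im: "restrict (\<psi> \<circ> f) V ` e = \<psi> ` f ` e" if "e \<subseteq> V" for e
        unfolding image_image by (rule image_cong) (use that in auto)
      have "inj_on (restrict (\<psi> \<circ> f) V) V" using \<psi> f by (auto simp: inj_on_def copies_def)
      then show "restrict (\<psi> \<circ> f) V \<in> copies n G V E I \<phi>"
        using \<psi> im Ev V inv by (auto simp: copies_def subset_iff Pi_iff PiE_def)
    qed
  qed
  then show "Psi n G (f ` V) ((`) f ` E) (f ` I) (\<phi> \<circ> inv_into V f) = Psi n G V E I \<phi>"
    by (simp add: Psi_card_copies bij_betw_same_card)
  have ind: "induced ((`) f ` E) (f ` U) = (`) f ` induced E U" if "U \<subseteq> V" for U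
    using sub Ev that by (auto simp: induced_def)
  have hosts: "edge_hosts (f ` V) ((`) f ` E) (f ` I) = (`) f ` edge_hosts V E I"
  proof (intro subset_antisym subsetI)
    fix W assume W: "W \<in> edge_hosts (f ` V) ((`) f ` E) (f ` I)"
    then obtain U where U: "U \<subseteq> V" "W = f ` U" by (auto simp: edge_hosts_def subset_image_iff)
    then show "W \<in> (`) f ` edge_hosts V E I" using W ind[OF U(1)] sub V by (auto simp: edge_hosts_def)
  next
    fix W assume "W \<in> (`) f ` edge_hosts V E I"
    then obtain U where U: "W = f ` U" "U \<in> edge_hosts V E I" by auto
    then show "W \<in> edge_hosts (f ` V) ((`) f ` E) (f ` I)" using ind[of U] by (auto simp: edge_hosts_def)
  qed
  have "inj_on ((`) f) (edge_hosts V E I)" by (rule inj_on_subset[OF fP]) (auto simp: edge_hosts_def)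
  then have "gsum (f ` V) ((`) f ` E) (f ` I) n p
     = (\<Sum>U\<in>edge_hosts V E I. 1 / scaling (f ` U) (induced ((`) f ` E) (f ` U)) (f ` I) n p)"
    unfolding gsum_def hosts by (simp add: sum.reindex)
  also have "\<dots> = gsum V E I n p" unfolding gsum_def
  proof (intro sum.cong refl)
    fix U assume U: "U \<in> edge_hosts V E I"
    then have "U \<subseteq> V" by (auto simp: edge_hosts_def)
    moreover have "card ((`) f ` induced E U) = card (induced E U)"
      by (rule card_image, rule inj_on_subset[OF fP]) (use EP in \<open>auto simp: induced_def\<close>)
    ultimately show "1 / scaling (f ` U) (induced ((`) f ` E) (f ` U)) (f ` I) n p = 1 / scaling U (induced E U) I n p"
      using crd V by (simp add: scaling_def ind)
  qed
  finally show "gsum (f ` V) ((`) f ` E) (f ` I) n p = gsum V E I n p" .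
qed

subsection \<open>Asymptotics along the stopping time\<close>

lemma ln_powr_over_sqrt: "(\<lambda>n. 2 * ln (real n) / sqrt (real n) * ln (real n) powr a) \<longlonglongrightarrow> 0"
  by real_asymp

lemma polynomial_times_exp_ln_square: 
  fixes c a :: real
  shows "(\<lambda>n. c * real n powr a * exp (- (ln (real n))\<^sup>2)) \<longlonglongrightarrow> 0"
  by real_asymp

text \<open>What \<open>i \<le> tau_star_idx\<close> says about the horizon: the last index may
  overshoot it by one step, and the search for a failure starts at index 1.\<close>

definition admissible :: "(nat \<Rightarrow> real) \<Rightarrow> nat \<Rightarrow> nat \<Rightarrow> bool" where
  "admissible Tmax n i \<longleftrightarrow> i \<le> 1 \<or> time n (i - 1) \<le> Tmax n"

lemma eventually_ln_ge: "eventually (\<lambda>n. ln (real n) \<ge> c) sequentially"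
  using filterlim_at_top[of "\<lambda>n. ln (real n)" sequentially]
    filterlim_compose[OF ln_at_top filterlim_real_sequentially] by auto

lemma eventually_real_ge: "eventually (\<lambda>n. real n \<ge> c) sequentially"
  using filterlim_at_top[of "\<lambda>n. real n" sequentially] filterlim_real_sequentially by auto

text \<open>By the standing requirement \<open>\<zeta>\<close> at the horizon is below every fixed
  negative power of \<open>ln n\<close>, and one further step at most halves \<open>p\<close>.
  Positivity of \<open>p\<close> also keeps \<open>i\<close> within the recorded trajectory.\<close>

lemma admissible_bounds:
  assumes hpos: "eventually (\<lambda>n. 0 < pp (Tmax n)) sequentially"
    and hreq: "filterlim (\<lambda>n. ln (1 / zeta n (Tmax n)) / ln (ln (real n))) at_top sequentially"
    and a: "a \<ge> 0"
  shows "eventually (\<lambda>n. \<forall>i. admissible Tmax n i \<longrightarrow>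
     1 / sqrt (real n) \<le> pp (time n i) \<and> zeta n (time n i) \<le> ln (real n) powr (- a) \<and> i \<le> n choose 2) sequentially"
proof -
  \<comment> \<open>The extra power of the logarithm pays for the factor 2 lost in the last
    step.\<close>
  have e1: "eventually (\<lambda>n. a + 1 \<le> ln (1 / zeta n (Tmax n)) / ln (ln (real n))) sequentially"
    using hreq unfolding filterlim_at_top by blast
  have e2: "eventually (\<lambda>n. 2 * ln (real n) / sqrt (real n) * ln (real n) powr a < 1) sequentially"
    using ln_powr_over_sqrt[of a] by (rule order_tendstoD) simp
  show ?thesis
    using e1 e2 hpos eventually_ln_ge[of 2] eventually_real_ge[of 12]
  proof eventually_elim
    case (elim n)
    define l where "l = ln (real n)"
    have l2: "l \<ge> 2" using elim by (simp add: l_def)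
    have n0: "n > 0" "real n \<ge> 12" using elim by auto
    define s where "s = sqrt (real n)"
    have s1: "s \<ge> 1" "s * s = real n" "s > 0" using n0 by (auto simp: s_def)
    have small: "2 * l / s \<le> l powr (- a)"
    proof -
      have "2 * l / s * l powr a \<le> 1" using elim by (simp add: l_def s_def)
      then show ?thesis unfolding powr_minus_divide using l2 by (simp add: le_divide_eq)
    qed
    have main: "1 / s \<le> pp (time n i) \<and> zeta n (time n i) \<le> l powr (- a)" if i: "admissible Tmax n i" for i
    proof (cases "i \<le> 1")
      case True
      have "6 / (real n)\<^sup>2 \<le> 6 / 12\<^sup>2" using n0 by (intro divide_left_mono power_mono) auto
      moreover have "real i / (real n)\<^sup>2 \<le> 1 / (real n)\<^sup>2" using True by (intro divide_right_mono) auto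
      ultimately have p: "pp (time n i) \<ge> 1/2" by (simp add: pp_def time_def)
      have "s \<ge> 2" using real_le_rsqrt[of 2 "real n"] n0 by (simp add: s_def)
      then have "1 / s \<le> 1 / 2" by (intro divide_left_mono) auto
      moreover have "zeta n (time n i) \<le> 2 * l / s"
      proof -
        have "l / (s * pp (time n i)) \<le> l / (s * (1/2))"
          using p l2 s1 by (intro divide_left_mono mult_left_mono) auto
        then show ?thesis by (simp add: zeta_def l_def s_def mult.commute)
      qed
      ultimately show ?thesis using p small by linarith
    next
      case False
      then obtain j where j: "i = Suc j" "j \<ge> 1" by (cases i) auto
      have tj: "time n j \<le> Tmax n" using i False j by (simp add: admissible_def)
      define P where "P = pp (Tmax n)"
      have P0: "P > 0" using elim by (simp add: P_def)
      have pj: "P \<le> pp (time n j)" using tj by (simp add: P_def pp_def)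
      define Z where "Z = zeta n (Tmax n)"
      have Z: "Z = l / (s * P)" by (simp add: Z_def zeta_def l_def s_def P_def)
      have Z0: "Z > 0" using Z l2 s1 P0 by simp
      have "(a + 1) * ln l \<le> ln (1 / Z)"
        using elim l2 by (simp add: le_divide_eq l_def Z_def)
      then have "ln (l powr (a + 1)) \<le> ln (1 / Z)" using l2 by (simp add: ln_powr)
      then have la: "l powr (a + 1) \<le> 1 / Z" using l2 Z0 by (subst (asm) ln_le_cancel_iff) auto
      have lp: "l powr (a + 1) = l * l powr a" using l2 by (simp add: powr_add)
      have la1: "1 \<le> l powr a" using l2 a by (simp add: ge_one_powr_ge_zero)
      have "l * l powr a * l \<le> s * P" using la l2 s1 P0 by (simp add: lp Z le_divide_eq)
      moreover have "2 * 1 * 1 \<le> l * l powr a * l" using l2 la1 by (intro mult_mono) auto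
      ultimately have sP: "2 \<le> s * P" by linarith
      have step: "pp (time n i) = pp (time n j) - 6 / (real n)\<^sup>2"
        by (simp add: j pp_def time_def add_divide_distrib)
      have "12 * 1 \<le> real n * s" using n0 s1 by (intro mult_mono) auto
      then have "6 \<le> (real n * s) * (s * P) / 4" using sP mult_mono[of 12 "real n * s" 2 "s * P"] by simp
      also have "\<dots> = (real n * (s * s)) * P / 4" by simp
      also have "\<dots> = (real n)\<^sup>2 * (P / 4)" by (simp add: s1(2) power2_eq_square)
      finally have "6 / (real n)\<^sup>2 \<le> P / 4" using n0 by (simp add: divide_le_eq mult.commute)
      then have pi: "P / 2 \<le> pp (time n i)" using step pj P0 by linarith
      have "1 / s \<le> P / 2" using sP s1 by (simp add: divide_le_eq mult.commute)
      moreover have "zeta n (time n i) \<le> l powr (- a)"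
      proof -
        have "zeta n (time n i) = l / (s * pp (time n i))" by (simp add: zeta_def l_def s_def)
        also have "\<dots> \<le> l / (s * (P / 2))" using pi P0 s1 l2 by (intro divide_left_mono mult_left_mono mult_pos_pos) auto
        also have "\<dots> = 2 * Z" by (simp add: Z)
        also have "\<dots> \<le> l * Z" using l2 Z0 by simp
        also have "\<dots> \<le> l powr (- a)"
        proof -
          have "l * Z * l powr a \<le> 1" using la Z0 unfolding lp by (simp add: le_divide_eq mult_ac)
          then show ?thesis unfolding powr_minus_divide using l2 by (simp add: le_divide_eq)
        qed
        finally show ?thesis .
      qed
      ultimately show ?thesis using pi by linarith
    qed
    \<comment> \<open>\<open>p > 0\<close> means \<open>6 i < n\<^sup>2\<close>, and
      \<open>n\<^sup>2 \<le> 3 n (n - 1)\<close> is six times the binomial coefficient.\<close>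
    have "i \<le> n choose 2" if i: "admissible Tmax n i" for i
    proof -
      have "0 < 1 / s" using s1 by simp
      then have "pp (time n i) > 0" using main[OF i] by linarith
      then have "6 * real i < (real n)\<^sup>2" using n0 by (simp add: pp_def time_def divide_less_eq)
      also have "\<dots> \<le> 3 * (real n * (real n - 1))" using n0 by (simp add: power2_eq_square algebra_simps)
      also have "\<dots> = 6 * real (n choose 2)" using n0 by (simp add: binomial_gbinomial gbinomial_prod_rev numeral_2_eq_2 field_simps)
      finally show ?thesis by simp
    qed
    then show ?case using main by (auto simp: l_def s_def)
  qed
qed

text \<open>No index from 1 up to \<open>i - 1\<close> satisfies the predicate whose least solution
  defines the stopping index.\<close>

lemma before_tau_star:
  assumes "i \<le> tau_star_idx C Tmax n xs"
  shows "admissible Tmax n i" and "\<And>j. 1 \<le> j \<Longrightarrow> j < i \<Longrightarrow> regular C n (graph_at xs j) j"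
proof -
  have *: "\<not> bounds_fail C n (graph_at xs j) j \<and> time n j \<le> Tmax n" if "1 \<le> j" "j < i" for j
    using not_less_Least[of j "\<lambda>i. 1 \<le> i \<and> (bounds_fail C n (graph_at xs i) i \<or> time n i > Tmax n)"] assms that
    by (force simp: tau_star_idx_def)
  show "admissible Tmax n i" using *[of "i - 1"] by (cases "i \<le> 1") (auto simp: admissible_def)
  show "regular C n (graph_at xs j) j" if "1 \<le> j" "j < i" for j
    using *[OF that] unfolding bounds_fail_def regular_def Let_def
    by (meson not_less order.strict_implies_order)
qed

lemma codeg_complete_graph:
  assumes "u < n" "v < n" "u \<noteq> v"
  shows "codeg (complete_graph n) u v = n - 2"
proof -
  have "{w. {u, w} \<in> complete_graph n \<and> {v, w} \<in> complete_graph n} = {..<n} - {u, v}"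
    using assms by (auto simp: complete_graph_def card_insert_if)
  then show ?thesis using assms by (simp add: codeg_def card_Diff_subset)
qed

lemma num_triangles_complete_graph: "num_triangles (complete_graph n) = n choose 3"
proof -
  have "triangles (complete_graph n) = {T. T \<subseteq> {..<n} \<and> card T = 3}"
  proof (intro subset_antisym subsetI)
    fix T assume "T \<in> triangles (complete_graph n)"
    then show "T \<in> {T. T \<subseteq> {..<n} \<and> card T = 3}" using triangle_subset[OF order.refl] by blast
  next
    fix T assume "T \<in> {T. T \<subseteq> {..<n} \<and> card T = 3}"
    then show "T \<in> triangles (complete_graph n)" by (auto simp: triangles_def complete_graph_def)
  qed
  then show ?thesis by (simp add: num_triangles_def n_subsets)
qed

text \<open>Time 0 is outside the range of the stopping rule. In \<open>K_n\<close> the relative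
  errors are \<open>2 / n\<close> and about \<open>3 / n\<close>, below \<open>\<zeta>\<close> and
  \<open>\<zeta>\<^sup>2\<close> up to the factor \<open>C\<close>.\<close>

lemma eventually_regular_complete_graph:
  assumes C: "C > 0"
  shows "eventually (\<lambda>n. regular C n (complete_graph n) 0) sequentially"
proof -
  have "eventually (\<lambda>n. 2 / real n \<le> C * (ln (real n) / sqrt (real n))) sequentially" using C by real_asymp
  moreover have "eventually (\<lambda>n. 3 / real n \<le> C * (ln (real n) / sqrt (real n))\<^sup>2) sequentially" using C by real_asymp
  ultimately show ?thesis using eventually_real_ge[of 3]
  proof eventually_elim
    case (elim n)
    have n3: "real n \<ge> 3" "n \<ge> 3" using elim by auto
    have p: "pp (time n 0) = 1" "zeta n (time n 0) = ln (real n) / sqrt (real n)" by (simp_all add: pp_def time_def zeta_def)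
    have "real (n - 2) / real n - 1 = - (2 / real n)" using n3 by (simp add: of_nat_diff field_simps)
    then have c: "\<bar>real (n - 2) / real n - 1\<bar> \<le> C * (ln (real n) / sqrt (real n))" using elim by simp
    have "real (n choose 3) = real n * (real n - 1) * (real n - 2) / 6"
      using n3 by (simp add: binomial_gbinomial gbinomial_prod_rev numeral_3_eq_3 field_simps)
    moreover have "x * (x - 1) * (x - 2) / 6 / (x ^ 3 / 6) - 1 = - (3 / x) + 2 / x\<^sup>2" if "x > 0" for x :: real
      using that by (simp add: field_simps power2_eq_square power3_eq_cube)
    ultimately have "real (n choose 3) / (real n ^ 3 / 6) - 1 = - (3 / real n) + 2 / (real n)\<^sup>2"
      using n3 by simp
    moreover have "2 / (real n)\<^sup>2 \<le> 3 / real n" using n3 by (simp add: field_simps power2_eq_square)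
    moreover have "0 \<le> 2 / (real n)\<^sup>2" by simp
    ultimately have "\<bar>real (n choose 3) / (real n ^ 3 / 6) - 1\<bar> \<le> C * (ln (real n) / sqrt (real n))\<^sup>2"
      using elim(2) by linarith
    moreover have "real (codeg (complete_graph n) u v) / (real n * 1\<^sup>2) = real (n - 2) / real n"
      if "u < n" "v < n" "u \<noteq> v" for u v
      using codeg_complete_graph[OF that] by simp
    moreover have "real (num_triangles (complete_graph n)) / (real n ^ 3 * 1 ^ 3 / 6) = real (n choose 3) / (real n ^ 3 / 6)"
      by (simp add: num_triangles_complete_graph)
    ultimately show ?case unfolding regular_def p using c by metis
  qed
qed

subsection \<open>Concentration with high probability\<close>

definition concentrated :: "real \<Rightarrow> real \<Rightarrow> nat \<Rightarrow> nat \<Rightarrow> nat \<Rightarrow> nat \<Rightarrow> graph \<Rightarrow> bool" where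
  "concentrated c B N k n i G \<longleftrightarrow> (\<forall>V E I \<phi>. ext_graph V E I \<and> card V \<le> N \<and> card V - card I = Suc k \<and> E \<noteq> {}
      \<and> inj_on \<phi> I \<and> \<phi> ` I \<subseteq> {..<n} \<longrightarrow>
     \<bar>real (Psi n G V E I \<phi>) - scaling V E I n (pp (time n i))\<bar>
       \<le> dev c B k n (zeta n (time n i)) (gsum V E I n (pp (time n i))) * scaling V E I n (pp (time n i)))"

lemma Psi_cong: "(\<And>a. a \<in> I \<Longrightarrow> \<phi> a = \<phi>' a) \<Longrightarrow> Psi n G V E I \<phi> = Psi n G V E I \<phi>'"
  unfolding Psi_def by (intro arg_cong[of _ _ card]) auto

lemma tr_process_support:
  assumes "xs \<in> set_pmf (tr_process n)"
  shows "length xs = Suc (n choose 2)" "xs ! 0 = complete_graph n"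
  using tr_run_support[OF order.refl assms[unfolded tr_process_def]] by auto

lemma graph_at_eq_nth:
  assumes "xs \<in> set_pmf (tr_process n)" "i \<le> n choose 2"
  shows "graph_at xs i = xs ! i"
  using tr_process_support(1)[OF assms(1)] assms(2) by (simp add: graph_at_def)

text \<open>Union bound of \<open>deviation_tail\<close> over extension graphs on
  \<open>{..<N}\<close>, root maps, times and the two signs: polynomially many events, each of
  probability at most \<open>exp (- (ln n)\<^sup>2)\<close>.\<close>

lemma whp_concentrated:
  fixes C A :: real
  assumes hpos: "eventually (\<lambda>n. 0 < pp (Tmax n)) sequentially"
    and hreq: "filterlim (\<lambda>n. ln (1 / zeta n (Tmax n)) / ln (ln (real n))) at_top sequentially"
    and C: "C > 0" and A: "A > 0"
    and ub: "whp (\<lambda>n xs. \<forall>i\<le>tau_star_idx C Tmax n xs. upper_bounds n A N k (pp (time n i)) (graph_at xs i))"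
  shows "whp (\<lambda>n xs. \<forall>i\<le>tau_star_idx C Tmax n xs.
      concentrated (dev_const C N) (18 * real N ^ 2 * A) N k n i (graph_at xs i))"
proof -
  define B where "B = 18 * real N ^ 2 * A"
  define c where "c = dev_const C N"
  define D where "D V E I n i = dev c B k n (zeta n (time n i)) (gsum V E I n (pp (time n i)))" for V :: "nat set" and E I n i
  define adm where "adm n i \<longleftrightarrow> i \<le> n choose 2 \<and> 1 / sqrt (real n) \<le> pp (time n i)
     \<and> 8 * real N ^ 2 * (1 + 2 * (3 * C + real N ^ 2)) * zeta n (time n i) \<le> 1" for n i
  define Fset where "Fset n V E I \<phi> T \<sigma> = {xs. (\<forall>j<T. regular C n (xs ! j) j \<and> upper_bounds n A N k (pp (time n j)) (xs ! j))
         \<and> D V E I n T * scaling V E I n (pp (time n T)) \<le> \<sigma> * (real (Psi n (xs ! T) V E I \<phi>) - scaling V E I n (pp (time n T)))}"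
     for n V E I \<phi> T and \<sigma> :: real
  define ok where "ok n V E I \<phi> T \<sigma> \<longleftrightarrow> ext_graph V E I \<and> card V \<le> N \<and> card V - card I = Suc k \<and> E \<noteq> {}
      \<and> inj_on \<phi> I \<and> \<phi> ` I \<subseteq> {..<n} \<and> adm n T \<and> (\<sigma> = 1 \<or> \<sigma> = -1)" for n V E I \<phi> T and \<sigma> :: real
  \<comment> \<open>Index tuples that describe no valid situation get the empty event, so the
    probability bound holds for all of them.\<close>
  define F where "F n = (\<lambda>(V, E, I, \<phi>, T, \<sigma>). if ok n V E I \<phi> T \<sigma> then Fset n V E I \<phi> T \<sigma> else {})" for n
  define X where "X n = Pow {..<N} \<times> Pow (Pow {..<N}) \<times> Pow {..<N} \<times> ({..<N} \<rightarrow>\<^sub>E {..<n}) \<times> {..n choose 2} \<times> {1, -1 :: real}" for n :: nat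
  \<comment> \<open>Choices of \<open>V\<close>, \<open>E\<close> and \<open>I\<close>, then
    \<open>n ^ N\<close> root maps, at most \<open>2 * n ^ 2\<close> times and two signs.\<close>
  define cn where "cn n = 2 ^ N * 2 ^ 2 ^ N * 2 ^ N * 4 * real n powr (real N + 2)" for n :: nat
  have "whp (\<lambda>n xs. \<forall>i\<le>tau_star_idx C Tmax n xs. concentrated c B N k n i (graph_at xs i))"
  proof (rule whp_union_bound[OF ub, where X = X and F = F and c = cn and b = "\<lambda>n. exp (- (ln (real n))\<^sup>2)"])
    show "(\<lambda>n. cn n * exp (- (ln (real n))\<^sup>2)) \<longlonglongrightarrow> 0"
      unfolding cn_def by (rule polynomial_times_exp_ln_square)
    have zs: "eventually (\<lambda>n. \<forall>i. admissible Tmax n i \<longrightarrow> adm n i) sequentially"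
      using admissible_bounds[OF hpos hreq zero_le_one] eventually_ln_ge[of "8 * real N ^ 2 * (1 + 2 * (3 * C + real N ^ 2))"] eventually_ln_ge[of 1]
    proof eventually_elim
      case (elim n)
      show ?case
      proof (intro allI impI)
        fix i assume "admissible Tmax n i"
        then have i: "1 / sqrt (real n) \<le> pp (time n i)" "zeta n (time n i) \<le> ln (real n) powr (- 1)" "i \<le> n choose 2" using elim by auto
        let ?q = "8 * real N ^ 2 * (1 + 2 * (3 * C + real N ^ 2))"
        have "?q \<ge> 0" using C by (intro mult_nonneg_nonneg add_nonneg_nonneg) auto
        then have "?q * zeta n (time n i) \<le> ln (real n) * (ln (real n) powr (- 1))"
          using elim i by (intro order.trans[OF mult_left_mono[OF i(2)] mult_right_mono]) auto
        also have "\<dots> = 1" using elim by (simp add: powr_minus_divide)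
        finally show "adm n i" using i by (simp add: adm_def)
      qed
    qed
    show "eventually (\<lambda>n. (\<forall>xs\<in>set_pmf (tr_process n). (\<forall>i\<le>tau_star_idx C Tmax n xs. upper_bounds n A N k (pp (time n i)) (graph_at xs i)) \<longrightarrow>
          (\<forall>i\<le>tau_star_idx C Tmax n xs. concentrated c B N k n i (graph_at xs i)) \<or> (\<exists>x\<in>X n. xs \<in> F n x))
        \<and> finite (X n) \<and> real (card (X n)) \<le> cn n
        \<and> (\<forall>x\<in>X n. measure_pmf.prob (tr_process n) (F n x) \<le> exp (- (ln (real n))\<^sup>2)) \<and> 0 \<le> exp (- (ln (real n))\<^sup>2)) sequentially"
      using zs eventually_regular_complete_graph[OF C] eventually_ln_ge[of 1] eventually_real_ge[of "60 * real N ^ 2"] eventually_real_ge[of 2]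
    proof eventually_elim
      case (elim n)
      have n2: "n \<ge> 2" using elim by simp
      have fin: "finite (X n)" unfolding X_def by (intro finite_cartesian_product finite_PiE) auto
      have "card (X n) = 2 ^ N * (2 ^ 2 ^ N * (2 ^ N * (n ^ N * (Suc (n choose 2) * 2))))"
        by (simp add: X_def card_cartesian_product card_Pow card_PiE)
      then have "real (card (X n)) = 2 ^ N * 2 ^ 2 ^ N * 2 ^ N * (real n ^ N * (real (Suc (n choose 2)) * 2))" by (simp add: algebra_simps)
      also have "\<dots> \<le> 2 ^ N * 2 ^ 2 ^ N * 2 ^ N * (real n ^ N * (2 * real n ^ 2 * 2))"
      proof (intro mult_left_mono mult_right_mono)
        have "n choose 2 \<le> n ^ 2" by (rule binomial_le_pow[OF n2])
        moreover have "1 \<le> n ^ 2" using n2 by simp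
        ultimately have "real (Suc (n choose 2)) \<le> real (2 * n ^ 2)" unfolding of_nat_le_iff by linarith
        then show "real (Suc (n choose 2)) \<le> 2 * (real n)\<^sup>2" by simp
      qed auto
      also have "\<dots> = cn n" using n2 by (simp add: cn_def powr_add powr_realpow powr_numeral)
      finally have crd: "real (card (X n)) \<le> cn n" .
      have prob: "measure_pmf.prob (tr_process n) (F n x) \<le> exp (- (ln (real n))\<^sup>2)" for x
      proof -
        obtain V E I \<phi> T \<sigma> where x: "x = (V, E, I, \<phi>, T, \<sigma>)" by (metis prod.collapse)
        show ?thesis
        proof (cases "ok n V E I \<phi> T \<sigma>")
          case True
          have "measure_pmf.prob (tr_process n) (Fset n V E I \<phi> T \<sigma>) \<le> exp (- (ln (real n))\<^sup>2)"
            unfolding Fset_def D_def c_def B_def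
            by (rule deviation_tail) (use True elim C A in \<open>auto simp: ok_def adm_def\<close>)
          then show ?thesis using True by (simp add: x F_def)
        qed (simp add: x F_def)
      qed
      have cover: "(\<forall>i\<le>tau_star_idx C Tmax n xs. concentrated c B N k n i (graph_at xs i)) \<or> (\<exists>x\<in>X n. xs \<in> F n x)"
        if xs: "xs \<in> set_pmf (tr_process n)" and u: "\<forall>i\<le>tau_star_idx C Tmax n xs. upper_bounds n A N k (pp (time n i)) (graph_at xs i)" for xs
      proof (rule disjCI)
        assume nF: "\<not> (\<exists>x\<in>X n. xs \<in> F n x)"
        show "\<forall>i\<le>tau_star_idx C Tmax n xs. concentrated c B N k n i (graph_at xs i)"
        proof (intro allI impI, unfold concentrated_def, intro allI impI)
          fix T V E I and \<phi> :: "nat \<Rightarrow> nat"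
          assume T: "T \<le> tau_star_idx C Tmax n xs"
            and H: "ext_graph V E I \<and> card V \<le> N \<and> card V - card I = Suc k \<and> E \<noteq> {} \<and> inj_on \<phi> I \<and> \<phi> ` I \<subseteq> {..<n}"
          have aT: "adm n T" using elim before_tau_star(1)[OF T] by blast
          then have gT: "graph_at xs T = xs ! T" using graph_at_eq_nth[OF xs] by (simp add: adm_def)
          have gj: "graph_at xs j = xs ! j" if "j < T" for j
            using graph_at_eq_nth[OF xs, of j] aT that by (simp add: adm_def)
          have pre: "\<forall>j<T. regular C n (xs ! j) j \<and> upper_bounds n A N k (pp (time n j)) (xs ! j)"
          proof (intro allI impI conjI)
            fix j assume j: "j < T"
            show "upper_bounds n A N k (pp (time n j)) (xs ! j)" using u j T gj[OF j] by (metis less_imp_le order.trans)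
            show "regular C n (xs ! j) j"
            proof (cases "j = 0")
              case True
              then show ?thesis using elim tr_process_support(2)[OF xs] by simp
            next
              case False
              then show ?thesis using before_tau_star(2)[OF T, of j] j gj[OF j] by simp
            qed
          qed
          have fV: "finite V" "I \<subseteq> V" using H by (auto simp: ext_graph_def)
          obtain f where f: "bij_betw f V {0..<card V}" using ex_bij_betw_finite_nat[OF fV(1)] by blast
          then have inj: "inj_on f V" and im: "f ` V = {0..<card V}" by (auto simp: bij_betw_def)
          have E: "ext_graph V E I" using H by simp
          note rl = relabel[OF E inj]
          let ?V = "f ` V" let ?E = "(`) f ` E" let ?I = "f ` I"
          \<comment> \<open>Root maps in \<open>X n\<close> are total on \<open>{..<N}\<close>; the
            value 0 outside the roots is a legal filler that does not affect the count.\<close>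
          define \<phi>' where "\<phi>' x = (if x \<in> ?I then (\<phi> \<circ> inv_into V f) x else if x < N then 0 else undefined)" for x
          have VN: "?V \<subseteq> {..<N}" using im H by auto
          have IV: "?I \<subseteq> ?V" using fV by auto
          have EV: "e \<subseteq> ?V" if eE: "e \<in> ?E" for e 
          proof -
            obtain e' where "e' \<in> E" "e = f ` e'" using eE by blast
            moreover from this have "e' \<subseteq> V" using E by (simp add: ext_graph_def)
            ultimately show ?thesis by (simp add: image_mono)
          qed
          have val: "\<phi>' (f a) = \<phi> a" if "a \<in> I" for a using that fV inv_into_f_f[OF inj, of a] by (auto simp: \<phi>'_def)
          have inj': "inj_on \<phi>' ?I"
          proof (rule inj_onI)
            fix x y assume "x \<in> ?I" "y \<in> ?I" "\<phi>' x = \<phi>' y"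
            then show "x = y" using val H by (auto dest: inj_onD)
          qed
          have ran': "\<phi>' ` ?I \<subseteq> {..<n}" using val H by auto
          have PE: "\<phi>' \<in> {..<N} \<rightarrow>\<^sub>E {..<n}"
          proof (rule PiE_I)
            fix x assume "x \<in> {..<N}"
            then show "\<phi>' x \<in> {..<n}" using ran' n2 by (cases "x \<in> ?I") (auto simp: \<phi>'_def)
          next
            fix x assume "x \<notin> {..<N}"
            then show "\<phi>' x = undefined" using IV VN by (auto simp: \<phi>'_def)
          qed
          have inX: "(?V, ?E, ?I, \<phi>', T, \<sigma>) \<in> X n" if "\<sigma> = 1 \<or> \<sigma> = -1" for \<sigma> :: real
          proof -
            have "?V \<in> Pow {..<N}" "?I \<in> Pow {..<N}" "?E \<in> Pow (Pow {..<N})" using VN IV EV by blast+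
            moreover have "T \<in> {..n choose 2}" using aT by (simp add: adm_def)
            moreover have "\<sigma> \<in> {1, -1}" using that by simp
            ultimately show ?thesis using PE unfolding X_def by blast
          qed
          have ok': "ok n ?V ?E ?I \<phi>' T \<sigma>" if "\<sigma> = 1 \<or> \<sigma> = -1" for \<sigma> :: real
            unfolding ok_def using rl(1,2,3) H inj' ran' aT that by auto
          have P: "Psi n G ?V ?E ?I \<phi>' = Psi n G V E I \<phi>" for G
            using rl(5)[of n G \<phi>] Psi_cong[of ?I \<phi>' "\<phi> \<circ> inv_into V f" n G ?V ?E] by (simp add: \<phi>'_def)
          have S: "scaling ?V ?E ?I n p = scaling V E I n p" for p using rl(2,3,4) by (simp add: scaling_def)
          have DD: "D ?V ?E ?I n T = D V E I n T" by (simp add: D_def rl(6))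
          have "\<not> D V E I n T * scaling V E I n (pp (time n T)) \<le> \<sigma> * (real (Psi n (xs ! T) V E I \<phi>) - scaling V E I n (pp (time n T)))"
            if s: "\<sigma> = 1 \<or> \<sigma> = -1" for \<sigma> :: real
          proof -
            have "xs \<notin> F n (?V, ?E, ?I, \<phi>', T, \<sigma>)" using nF inX[OF s] by blast
            then have "xs \<notin> Fset n ?V ?E ?I \<phi>' T \<sigma>" using ok'[OF s] by (simp add: F_def)
            then show ?thesis using pre by (simp add: Fset_def P S DD)
          qed
          \<comment> \<open>The two signs exclude the upper and the lower tail.\<close>
          from this[of 1] this[of "-1"]
          show "\<bar>real (Psi n (graph_at xs T) V E I \<phi>) - scaling V E I n (pp (time n T))\<bar>
             \<le> dev c B k n (zeta n (time n T)) (gsum V E I n (pp (time n T))) * scaling V E I n (pp (time n T))"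
            unfolding gT D_def by (simp add: abs_le_iff)
        qed
      qed
      show ?case using fin crd prob cover by simp
    qed
  qed
  then show ?thesis by (simp add: B_def c_def)
qed

section \<open>Crude upper bounds by induction on the number of free vertices\<close>

lemma no_edges_if_no_free_vertices:
  assumes "ext_graph V E I" "card V - card I = 0"
  shows "V = I" "E = {}"
proof -
  have V: "finite V" "I \<subseteq> V" using assms by (auto simp: ext_graph_def)
  then have "card (V - I) = 0" using assms by (simp add: card_Diff_subset finite_subset)
  then show "V = I" using V by auto
  then show "E = {}" using assms(1) by (auto simp: ext_graph_def)
qed

lemma upper_bounds_0:
  assumes "n > 0" "p > 0"
  shows "upper_bounds n 1 N 0 p G"
  unfolding upper_bounds_def
proof (intro allI impI)
  fix V E I \<phi> assume H: "ext_graph V E I \<and> card V \<le> N \<and> card V - card I \<le> 0"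
  then have e: "V = I" "E = {}" using no_edges_if_no_free_vertices[of V E I] by auto
  have "finite V" "I \<subseteq> V" using H by (auto simp: ext_graph_def)
  then have "Psi n G V E I \<phi> \<le> n ^ (card V - card I)" by (rule Psi_le_power)
  then have "real (Psi n G V E I \<phi>) \<le> 1" using e by simp
  also have "\<dots> \<le> 1 + gsum V E I n p" using gsum_nonneg[OF assms] by simp
  finally show "real (Psi n G V E I \<phi>) \<le> 1 * ln (real n) ^ (3 * 0) * (scaling V E I n p * (1 + gsum V E I n p))"
    using e by (simp add: scaling_def)
qed

text \<open>Disposes of the root maps that \<open>upper_bounds\<close> admits but
  \<open>concentrated\<close> does not.\<close>

lemma Psi_eq_0:
  assumes "\<not> (inj_on \<phi> I \<and> \<phi> ` I \<subseteq> {..<n})" "I \<subseteq> V"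
  shows "Psi n G V E I \<phi> = 0"
proof -
  have "copies n G V E I \<phi> = {}"
  proof (rule equals0I)
    fix \<psi> assume \<psi>: "\<psi> \<in> copies n G V E I \<phi>"
    then have eq: "\<And>a. a \<in> I \<Longrightarrow> \<phi> a = \<psi> a" and "inj_on \<psi> V" and r: "\<psi> \<in> V \<rightarrow>\<^sub>E {..<n}" by (auto simp: copies_def)
    then have "inj_on \<psi> I" using assms(2) inj_on_subset by blast
    then have "inj_on \<phi> I" using eq by (simp add: inj_on_def)
    moreover have "\<phi> ` I \<subseteq> {..<n}" using eq r assms(2) by auto
    ultimately show False using assms(1) by blast
  qed
  then show ?thesis by (simp add: Psi_card_copies)
qed

lemma sqrt_le_one_plus: "y \<ge> 0 \<Longrightarrow> sqrt y \<le> 1 + y"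
  by (rule real_le_lsqrt) (auto simp: power2_eq_square algebra_simps)

text \<open>With \<open>y = B * L * g\<close>, \<open>\<zeta> \<le> 1\<close> and
  \<open>sqrt y \<le> 1 + y\<close>, concentration gives
  \<open>\<Psi> \<le> S * (1 + 2 * c + 2 * c * y)\<close>. The new constant dominates these
  coefficients and the old constant.\<close>

lemma upper_bounds_Suc:
  assumes n: "n > 0" and p: "pp (time n i) > 0" and l: "ln (real n) \<ge> 1" and z: "zeta n (time n i) \<le> 1"
    and c: "c \<ge> 0" "B \<ge> 0" "A \<ge> 0"
    and ub: "upper_bounds n A N k (pp (time n i)) G" and cc: "concentrated c B N k n i G"
  shows "upper_bounds n (A + 1 + 2 * c + 2 * c * B) N (Suc k) (pp (time n i)) G"
  unfolding upper_bounds_def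
proof (intro allI impI)
  fix V E I \<phi> assume H: "ext_graph V E I \<and> card V \<le> N \<and> card V - card I \<le> Suc k"
  define p where "p = pp (time n i)"
  define S where "S = scaling V E I n p"
  define g where "g = gsum V E I n p"
  define L where "L = ln (real n) ^ (3 * k + 3)"
  define A' where "A' = A + 1 + 2 * c + 2 * c * B"
  have S: "S > 0" unfolding S_def by (rule scaling_pos[OF n]) (use p in \<open>simp add: p_def\<close>)
  have g: "g \<ge> 0" unfolding g_def by (rule gsum_nonneg[OF n]) (use p in \<open>simp add: p_def\<close>)
  have L1: "L \<ge> 1" unfolding L_def using l by (rule one_le_power)
  have cB: "0 \<le> c * B" using c by simp
  have A': "A' \<ge> A" "A' \<ge> 1" "A' \<ge> 1 + 2 * c" "A' \<ge> 2 * c * B" "A' \<ge> 0" using c cB by (auto simp: A'_def)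
  have V: "finite V" "I \<subseteq> V" using H by (auto simp: ext_graph_def)
  have Sg: "0 \<le> S * (1 + g)" "S \<le> S * (1 + g)" using S g by (auto simp: mult_le_cancel_left1)
  have "real (Psi n G V E I \<phi>) \<le> A' * L * (S * (1 + g))"
  proof (cases "card V - card I \<le> k")
    case True
    have "real (Psi n G V E I \<phi>) \<le> A * ln (real n) ^ (3 * k) * (S * (1 + g))"
      using ub H True by (simp add: upper_bounds_def S_def g_def p_def)
    also have "\<dots> \<le> A' * L * (S * (1 + g))"
      unfolding L_def using A' c l Sg by (intro mult_right_mono mult_mono power_increasing) auto
    finally show ?thesis .
  next
    case False
    then have k: "card V - card I = Suc k" using H by simp
    show ?thesis
    proof (cases "inj_on \<phi> I \<and> \<phi> ` I \<subseteq> {..<n}")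
      case False
      then show ?thesis using Psi_eq_0[OF False V(2)] A' L1 Sg by simp
    next
      case \<phi>: True
      show ?thesis
      proof (cases "E = {}")
        case True
        have "real (Psi n G V E I \<phi>) \<le> real (n ^ (card V - card I))" using Psi_le_power[OF V] by (simp only: of_nat_le_iff)
        also have "\<dots> = S" using True by (simp add: S_def scaling_def)
        also have "\<dots> \<le> 1 * 1 * (S * (1 + g))" using Sg by simp
        also have "\<dots> \<le> A' * L * (S * (1 + g))" using A' L1 Sg by (intro mult_right_mono mult_mono) auto
        finally show ?thesis .
      next
        case E: False
        define y where "y = B * L * g"
        have y: "y \<ge> 0" using c L1 g by (simp add: y_def)
        have "\<bar>real (Psi n G V E I \<phi>) - S\<bar> \<le> c * (zeta n (time n i) + sqrt y + y) * S"
          using cc[unfolded concentrated_def, rule_format, of V E I \<phi>] H k \<phi> E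
          by (simp add: dev_def S_def g_def p_def y_def L_def)
        also have "\<dots> \<le> c * (1 + (1 + y) + y) * S"
          using z sqrt_le_one_plus[OF y] c S by (intro mult_right_mono mult_left_mono add_mono) auto
        finally have "real (Psi n G V E I \<phi>) \<le> S * ((1 + 2 * c) + (2 * c * B) * (L * g))"
          by (simp add: y_def algebra_simps abs_le_iff)
        also have "\<dots> \<le> S * (A' * L + A' * (L * g))"
        proof (intro mult_left_mono add_mono mult_right_mono)
          show "1 + 2 * c \<le> A' * L" using A' L1 c mult_mono[of "1 + 2 * c" A' 1 L] by simp
        qed (use A' L1 g S in auto)
        also have "\<dots> = A' * L * (S * (1 + g))" by (simp add: algebra_simps)
        finally show ?thesis .
      qed
    qed
  qed
  then show "real (Psi n G V E I \<phi>) \<le> (A + 1 + 2 * c + 2 * c * B) * ln (real n) ^ (3 * Suc k)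
      * (scaling V E I n (pp (time n i)) * (1 + gsum V E I n (pp (time n i))))"
    by (simp add: A'_def L_def S_def g_def p_def add.commute)
qed

text \<open>The induction alternates: upper bounds for at most \<open>k\<close> free vertices limit
  the loss per step and yield concentration for \<open>k + 1\<close>, which in turn yields the upper
  bounds for \<open>k + 1\<close>.\<close>

lemma whp_upper_bounds:
  fixes C :: real
  assumes hpos: "eventually (\<lambda>n. 0 < pp (Tmax n)) sequentially"
    and hreq: "filterlim (\<lambda>n. ln (1 / zeta n (Tmax n)) / ln (ln (real n))) at_top sequentially"
    and C: "C > 0"
  shows "\<exists>A>0. whp (\<lambda>n xs. \<forall>i\<le>tau_star_idx C Tmax n xs. upper_bounds n A N k (pp (time n i)) (graph_at xs i))"
proof -
  have nice: "eventually (\<lambda>n. n > 0 \<and> ln (real n) \<ge> 1 \<and> (\<forall>i. admissible Tmax n i \<longrightarrow> pp (time n i) > 0 \<and> zeta n (time n i) \<le> 1)) sequentially"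
    using admissible_bounds[OF hpos hreq order.refl] eventually_ln_ge[of 1] eventually_gt_at_top[of 0]
  proof eventually_elim
    case (elim n)
    have pos: "0 < 1 / sqrt (real n)" using elim by simp
    have "pp (time n i) > 0 \<and> zeta n (time n i) \<le> 1" if "admissible Tmax n i" for i
    proof -
      have "1 / sqrt (real n) \<le> pp (time n i)" "zeta n (time n i) \<le> ln (real n) powr - 0" using elim that by blast+
      moreover have "ln (real n) powr - 0 \<le> 1" by simp
      ultimately show ?thesis using pos by linarith
    qed
    then show ?case using elim by blast
  qed
  show ?thesis
  proof (induction k)
    case 0
    have "whp (\<lambda>n xs. \<forall>i\<le>tau_star_idx C Tmax n xs. upper_bounds n 1 N 0 (pp (time n i)) (graph_at xs i))"
      by (rule whp_mono[OF whp_True], use nice in eventually_elim) (use upper_bounds_0 before_tau_star(1) in blast)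
    then show ?case by (intro exI[of _ 1]) simp
  next
    case (Suc k)
    then obtain A where A: "A > 0" and ub: "whp (\<lambda>n xs. \<forall>i\<le>tau_star_idx C Tmax n xs. upper_bounds n A N k (pp (time n i)) (graph_at xs i))"
      by blast
    define c where "c = dev_const C N"
    define B where "B = 18 * real N ^ 2 * A"
    have c: "c \<ge> 0" "B \<ge> 0" using C A by (auto simp: c_def B_def dev_const_def intro!: add_nonneg_nonneg mult_nonneg_nonneg)
    have cc: "whp (\<lambda>n xs. \<forall>i\<le>tau_star_idx C Tmax n xs. concentrated c B N k n i (graph_at xs i))"
      unfolding c_def B_def by (rule whp_concentrated[OF hpos hreq C A ub])
    have "whp (\<lambda>n xs. \<forall>i\<le>tau_star_idx C Tmax n xs. upper_bounds n (A + 1 + 2 * c + 2 * c * B) N (Suc k) (pp (time n i)) (graph_at xs i))"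
    proof (rule whp_mono[OF whp_conj[OF ub cc]], use nice in eventually_elim, intro ballI impI allI)
      fix n xs i
      assume n: "n > 0 \<and> ln (real n) \<ge> 1 \<and> (\<forall>i. admissible Tmax n i \<longrightarrow> pp (time n i) > 0 \<and> zeta n (time n i) \<le> 1)"
        and h: "(\<forall>i\<le>tau_star_idx C Tmax n xs. upper_bounds n A N k (pp (time n i)) (graph_at xs i)) \<and>
            (\<forall>i\<le>tau_star_idx C Tmax n xs. concentrated c B N k n i (graph_at xs i))"
        and i: "i \<le> tau_star_idx C Tmax n xs"
      have a: "admissible Tmax n i" by (rule before_tau_star(1)[OF i])
      show "upper_bounds n (A + 1 + 2 * c + 2 * c * B) N (Suc k) (pp (time n i)) (graph_at xs i)"
        by (rule upper_bounds_Suc) (use n h i a c A in auto)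
    qed
    moreover have "A + 1 + 2 * c + 2 * c * B > 0" using A c mult_nonneg_nonneg[OF c] by (intro add_pos_nonneg) auto
    ultimately show ?case by blast
  qed
qed

section \<open>Deviations for balanced extension graphs\<close>

text \<open>Balancedness gives \<open>eU \<le> e * kU / k\<close>, so the scaling of
  \<open>U\<close> is at least \<open>S powr (kU / k)\<close>, with an exponent between
  \<open>1 / k\<close> and 1. The factor 2 covers \<open>S\<close> between 1/2 and 1.\<close>

lemma balanced_scaling_ge:
  assumes E: "ext_graph V E I" and bal: "balanced V E I" and U: "U \<in> edge_hosts V E I"
    and n: "n > 0" and p: "0 < p" "p \<le> 1" and S: "scaling V E I n p \<ge> 1/2"
  shows "scaling V E I n p powr (1 / real (card V - card I)) / 2 \<le> scaling U (induced E U) I n p"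
proof -
  define k where "k = real (card V - card I)"
  define kU where "kU = real (card U - card I)"
  define e where "e = real (card E)"
  define eU where "eU = real (card (induced E U))"
  let ?S = "scaling V E I n p"
  have V: "finite V" "I \<subseteq> V" and U': "I \<subseteq> U" "U \<subseteq> V" "induced E U \<noteq> {}" using E U by (auto simp: ext_graph_def edge_hosts_def)
  have fU: "finite U" by (rule finite_subset[OF U'(2) V(1)])
  have "I \<noteq> U" using U' E by (auto simp: induced_def ext_graph_def)
  then have "card I < card U" using U' fU by (intro psubset_card_mono) auto
  moreover have "card U \<le> card V" using U' V by (simp add: card_mono)
  ultimately have k: "1 \<le> kU" "kU \<le> k" by (auto simp: k_def kU_def)
  have "subext U (induced E U) I V E I" using E U' fU by (auto simp: subext_def ext_graph_def induced_def)
  then have "eU / kU \<le> e / k" using bal by (auto simp: balanced_def density_def e_def eU_def k_def kU_def)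
  then have eU: "eU \<le> e * (kU / k)" using k by (simp add: field_simps)
  have Sk: "?S powr (kU / k) = real n powr kU * p powr (e * (kU / k))"
    using n p k by (simp add: scaling_def k_def[symmetric] powr_mult powr_powr e_def flip: powr_realpow)
  have SU: "scaling U (induced E U) I n p = real n powr kU * p powr eU"
    using n p by (simp add: scaling_def kU_def eU_def powr_realpow)
  have "p powr (e * (kU / k)) \<le> p powr eU" using eU p by (intro powr_mono') auto
  then have 1: "?S powr (kU / k) \<le> scaling U (induced E U) I n p" unfolding Sk SU by (intro mult_left_mono) auto
  have S0: "?S > 0" using S by simp
  have "?S powr (1 / k) / 2 \<le> ?S powr (kU / k)"
  proof (cases "?S \<ge> 1")
    case True
    have "?S powr (1 / k) \<le> ?S powr (kU / k)" using True k by (intro powr_mono divide_right_mono) auto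
    moreover have "0 \<le> ?S powr (1 / k)" by simp
    ultimately show ?thesis by linarith
  next
    case False
    have "?S powr (1 / k) \<le> 1" using False S0 k by (intro powr_le1) auto
    moreover have "?S powr 1 \<le> ?S powr (kU / k)" using False S0 k by (intro powr_mono') auto
    ultimately show ?thesis using S S0 by simp
  qed
  then show ?thesis using 1 by (simp add: k_def)
qed

lemma half_powr_le_2:
  fixes S a :: real
  assumes "S \<ge> 1/2" "0 \<le> a" "a \<le> 1"
  shows "S powr (- a) \<le> 2"
proof -
  have "S powr (- a) \<le> (1/2) powr (- a)" using assms by (intro powr_mono2') auto
  also have "\<dots> = 2 powr a" by (simp add: powr_minus powr_divide)
  also have "\<dots> \<le> 2 powr 1" using assms by (intro powr_mono) auto
  finally show ?thesis by simp
qed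

lemma half_powr_antimono:
  fixes S a b :: real
  assumes S: "S \<ge> 1/2" and ab: "0 \<le> a" "a \<le> b" "b \<le> 1"
  shows "S powr (- b) \<le> 2 * S powr (- a)"
proof -
  have "S powr (- b) = S powr (- (b - a)) * S powr (- a)" using S by (simp add: powr_add[symmetric])
  also have "\<dots> \<le> 2 * S powr (- a)" using ab by (intro mult_right_mono half_powr_le_2[OF S]) auto
  finally show ?thesis .
qed

text \<open>There are at most \<open>2 ^ N\<close> hosts. In each term one factor 2 comes from
  \<open>balanced_scaling_ge\<close>, the other from replacing the exponent \<open>1 / k\<close> by
  \<open>1 / N\<close>.\<close>

lemma balanced_gsum_le:
  assumes E: "ext_graph V E I" and bal: "balanced V E I" and N: "card V \<le> N"
    and n: "n > 0" and p: "0 < p" "p \<le> 1" and S: "scaling V E I n p \<ge> 1/2" and k: "card V - card I \<ge> 1"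
  shows "gsum V E I n p \<le> 2 ^ N * 4 * scaling V E I n p powr (- (1 / real N))"
proof -
  define k' where "k' = real (card V - card I)"
  let ?S = "scaling V E I n p"
  have k': "k' \<ge> 1" "k' \<le> real N" using k N by (auto simp: k'_def)
  have S0: "?S > 0" using S by simp
  have V: "finite V" using E by (simp add: ext_graph_def)
  have one: "1 / scaling U (induced E U) I n p \<le> 4 * ?S powr (- (1 / real N))" if U: "U \<in> edge_hosts V E I" for U
  proof -
    have b: "?S powr (1 / k') / 2 \<le> scaling U (induced E U) I n p"
      unfolding k'_def by (rule balanced_scaling_ge[OF E bal U n p S])
    have "1 / scaling U (induced E U) I n p \<le> 1 / (?S powr (1 / k') / 2)"
      using b S0 by (intro divide_left_mono mult_pos_pos) (auto intro: scaling_pos n p)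
    also have "\<dots> = 2 * ?S powr (- (1 / k'))" by (simp add: powr_minus_divide)
    also have "\<dots> \<le> 2 * (2 * ?S powr (- (1 / real N)))"
    proof (rule mult_left_mono)
      show "?S powr (- (1 / k')) \<le> 2 * ?S powr (- (1 / real N))"
        by (rule half_powr_antimono[OF S]) (use k' in \<open>auto simp: divide_le_eq intro!: divide_left_mono\<close>)
    qed simp
    finally show ?thesis by simp
  qed
  have "gsum V E I n p \<le> (\<Sum>U\<in>edge_hosts V E I. 4 * ?S powr (- (1 / real N)))"
    unfolding gsum_def by (rule sum_mono) (rule one)
  also have "\<dots> = real (card (edge_hosts V E I)) * (4 * ?S powr (- (1 / real N)))" by simp
  also have "\<dots> \<le> 2 ^ N * (4 * ?S powr (- (1 / real N)))"
  proof (rule mult_right_mono)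
    have "card (edge_hosts V E I) \<le> card (Pow V)" using V by (intro card_mono) (auto simp: edge_hosts_def)
    also have "\<dots> \<le> 2 ^ N" using V N by (simp add: card_Pow power_increasing)
    finally show "real (card (edge_hosts V E I)) \<le> 2 ^ N" by (metis of_nat_le_iff of_nat_numeral of_nat_power)
  qed simp
  finally show ?thesis by simp
qed

text \<open>The square root dominates: it halves the exponent \<open>1 / N\<close>, and the linear
  term is at most twice as large in \<open>s\<close> because \<open>s \<le> 2\<close>. So
  \<open>1 + 3 * b\<close> is \<open>(1 + b) + 2 * b\<close>.\<close>

lemma balanced_dev_le:
  assumes E: "ext_graph V E I" and bal: "balanced V E I" and N: "card V \<le> N"
    and n: "n > 0" "ln (real n) \<ge> 1" and p: "0 < p" "p \<le> 1" and S: "scaling V E I n p \<ge> 1/2" and k: "card V - card I \<ge> 1"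
    and c: "c \<ge> 0" "B \<ge> 0"
  shows "dev c B k' n z (gsum V E I n p)
     \<le> c * (z + (1 + 3 * (B * (2 ^ N * 4))) * ln (real n) ^ (3 * k' + 3) * scaling V E I n p powr (- (1 / (2 * real N))))"
proof -
  let ?S = "scaling V E I n p" let ?g = "gsum V E I n p"
  define L where "L = ln (real n) ^ (3 * k' + 3)"
  define b where "b = B * (2 ^ N * 4)"
  define s where "s = ?S powr (- (1 / (2 * real N)))"
  have N1: "real N \<ge> 1" using N k by simp
  have S0: "?S > 0" using S by simp
  have L1: "L \<ge> 1" unfolding L_def using n by (intro one_le_power)
  have b0: "b \<ge> 0" using c by (simp add: b_def)
  have s: "s > 0" "s \<le> 2" using S0 half_powr_le_2[OF S, of "1 / (2 * real N)"] N1 by (auto simp: s_def divide_le_eq)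
  have ss: "?S powr (- (1 / real N)) = s * s" using N1 by (simp add: s_def powr_add[symmetric] field_simps)
  have "B * L * ?g \<le> B * L * (2 ^ N * 4 * (s * s))"
    using balanced_gsum_le[OF E bal N n(1) p S k] c L1 unfolding ss by (intro mult_left_mono) auto
  also have "\<dots> = b * L * (s * s)" by (simp add: b_def)
  finally have y: "B * L * ?g \<le> b * L * (s * s)" .
  have "sqrt (B * L * ?g) \<le> sqrt (b * L * (s * s))" using y by simp
  also have "\<dots> = sqrt (b * L) * s" using s by (simp add: real_sqrt_mult)
  also have "\<dots> \<le> (1 + b * L) * s" using s sqrt_le_one_plus[of "b * L"] b0 L1 by (intro mult_right_mono) auto
  also have "\<dots> \<le> (L + b * L) * s" using s L1 by (intro mult_right_mono) auto
  finally have 1: "sqrt (B * L * ?g) \<le> (1 + b) * L * s" by (simp add: algebra_simps)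
  have "b * L * (s * s) \<le> b * L * (2 * s)" using s b0 L1 by (intro mult_left_mono mult_right_mono) auto
  then have 2: "B * L * ?g \<le> 2 * b * L * s" using y by simp
  have "z + sqrt (B * L * ?g) + B * L * ?g \<le> z + (1 + 3 * b) * L * s"
    using 1 2 by (simp add: algebra_simps)
  then have "c * (z + sqrt (B * L * ?g) + B * L * ?g) \<le> c * (z + (1 + 3 * b) * L * s)" using c by (intro mult_left_mono)
  then show ?thesis by (simp add: dev_def L_def b_def s_def)
qed

subsection \<open>Balanced extension graphs\<close>

lemma time_less: "n > 0 \<Longrightarrow> j < i \<Longrightarrow> time n j < time n i"
  by (simp add: time_def divide_strict_right_mono)

text \<open>Only strictly earlier times are covered: at the threshold time itself the scaling may
  already have dropped below the bound.\<close>

lemma before_t_H_minus: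
  assumes "n > 0" "ereal (time n i) \<le> t_H_minus n V E I r" "j < i"
  shows "zeta n (time n j) powr (- r) < scaling V E I n (pp (time n j))"
proof (rule ccontr)
  assume "\<not> ?thesis"
  then have "t_H_minus n V E I r \<le> ereal (time n j)"
    unfolding t_H_minus_def by (intro Inf_lower) (auto simp: not_less)
  then show False using assms(2) time_less[OF assms(1,3)] by (metis ereal_less_eq(3) linorder_not_less order.trans)
qed

lemma before_t_H:
  assumes "n > 0" "ereal (time n i) \<le> t_H n V E I" "j < i"
  shows "1 < scaling V E I n (pp (time n j))"
proof (rule ccontr)
  assume "\<not> ?thesis"
  then have "t_H n V E I \<le> ereal (time n j)"
    unfolding t_H_def by (intro Inf_lower) (auto simp: not_less)
  then show False using assms(2) time_less[OF assms(1,3)] by (metis ereal_less_eq(3) linorder_not_less order.trans)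
qed

text \<open>Times lie on a grid: without a crossing up to \<open>i\<close>, the infimum would be at
  least the next grid point.\<close>

lemma after_t_H_minus:
  assumes n: "n > 0" and t: "t_H_minus n V E I r \<le> ereal (time n i)"
  shows "\<exists>j\<le>i. scaling V E I n (pp (time n j)) \<le> zeta n (time n j) powr (- r)"
proof (rule ccontr)
  assume no: "\<not> ?thesis"
  have "ereal (time n (Suc i)) \<le> t_H_minus n V E I r"
    unfolding t_H_minus_def
  proof (rule Inf_greatest)
    fix x assume "x \<in> {ereal (time n j) | j. scaling V E I n (pp (time n j)) \<le> zeta n (time n j) powr (- r)}"
    then obtain j where j: "x = ereal (time n j)" "scaling V E I n (pp (time n j)) \<le> zeta n (time n j) powr (- r)" by auto
    then have "Suc i \<le> j" using no by (meson not_less_eq_eq)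
    then show "ereal (time n (Suc i)) \<le> x" using j(1) by (simp add: time_def divide_right_mono)
  qed
  then have "ereal (time n (Suc i)) \<le> ereal (time n i)" using t order.trans by blast
  then show False using time_less[OF n, of i "Suc i"] by simp
qed

text \<open>As \<open>n\<^sup>2 p \<ge> n\<close>, one step lowers the scaling by a relative amount
  of at most \<open>6 * N\<^sup>2 / n \<le> 1/10\<close>. This carries bounds before a threshold
  over to the threshold itself.\<close>

lemma scaling_Suc_ge_half:
  assumes n: "n > 0" and e: "real (card E) \<le> real N ^ 2" and nN: "60 * real N ^ 2 \<le> real n"
    and p: "1 / sqrt (real n) \<le> pp (time n (Suc j))"
  shows "scaling V E I n (pp (time n j)) / 2 \<le> scaling V E I n (pp (time n (Suc j)))"
proof -
  define x where "x = 6 / ((real n)\<^sup>2 * pp (time n j))"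
  define s where "s = sqrt (real n)"
  have s: "s \<ge> 1" "s * s = real n" using n by (auto simp: s_def)
  have pj: "1 / s \<le> pp (time n j)" using p pp_time_antimono[OF n, of j "Suc j"] by (simp add: s_def)
  have "0 < 1 / s" using s by simp
  then have p0: "pp (time n j) > 0" using pj by linarith
  have "1 \<le> s * pp (time n j)" using pj s by (simp add: divide_le_eq mult.commute)
  then have "1 * 1 \<le> s * (s * pp (time n j))" using s by (intro mult_mono) auto
  then have "real n * 1 \<le> real n * (s * (s * pp (time n j)))" by (intro mult_left_mono) auto
  also have "\<dots> = (real n)\<^sup>2 * pp (time n j)" using s(2) by (simp add: power2_eq_square)
  finally have np: "real n \<le> (real n)\<^sup>2 * pp (time n j)" by simp
  have "x \<le> 6 / real n" unfolding x_def using np n by (intro divide_left_mono) auto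
  have x0: "0 \<le> x" using p0 by (simp add: x_def)
  have "real (card E) * x \<le> real N ^ 2 * (6 / real n)" using e \<open>x \<le> 6 / real n\<close> x0 by (intro mult_mono) auto
  also have "\<dots> \<le> 1/10" using nN n by (simp add: divide_le_eq)
  finally have ex: "real (card E) * x \<le> 1/2" by simp
  have S: "scaling V E I n (pp (time n (Suc j))) = scaling V E I n (pp (time n j)) * (1 - x) ^ card E"
    using pp_time_Suc[OF n p0] by (simp add: scaling_def x_def power_mult_distrib)
  have "1/2 \<le> (1 - x) ^ card E"
  proof (cases "card E = 0")
    case False
    then have "x \<le> real (card E) * x" using x0 mult_right_mono[of 1 "real (card E)" x] by simp
    then have "1 - real (card E) * x \<le> (1 - x) ^ card E" using ex x0 by (intro power_one_minus_bounds) auto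
    then show ?thesis using ex by linarith
  qed simp
  then have "scaling V E I n (pp (time n j)) * (1/2) \<le> scaling V E I n (pp (time n j)) * (1 - x) ^ card E"
    using scaling_pos[OF n p0, of V E I] by (intro mult_left_mono) auto
  then show ?thesis by (simp add: S)
qed

text \<open>Strict balancedness compares only with fewer edges, so the case left is a subextension
  with all edges and fewer vertices. Deleting one edge from it gives
  \<open>(e - 1) / a < e / b\<close> with \<open>a + 1 \<le> b\<close>, hence \<open>e < b\<close>,
  against density at least 1.\<close>

lemma strictly_balanced_imp_balanced:
  assumes E: "ext_graph V E I" and sb: "strictly_balanced V E I" and k: "1 \<le> card V - card I" "card V - card I \<le> card E"
  shows "balanced V E I"
  unfolding balanced_def
proof (intro allI impI)
  fix VK EK assume K: "subext VK EK I V E I"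
  show "density VK EK I \<le> density V E I"
  proof (cases "EK = E")
    case False
    then have "EK \<subset> E" using K by (auto simp: subext_def)
    then have "density VK EK I < density V E I" using K sb unfolding strictly_balanced_def by blast
    then show ?thesis by simp
  next
    case True
    have V: "finite V" "VK \<subseteq> V" "I \<subseteq> VK" using E K by (auto simp: ext_graph_def subext_def)
    show ?thesis
    proof (cases "VK = V")
      case True
      then show ?thesis using \<open>EK = E\<close> by simp
    next
      case False
      then have lt: "card VK < card V" using V by (simp add: psubsetI psubset_card_mono)
      have fE: "finite E" by (rule ext_graph_finite_edges[OF E])
      obtain h where h: "h \<in> E" using k by (cases "E = {}") auto
      have "VK \<noteq> I" using K h \<open>EK = E\<close> by (auto simp: subext_def ext_graph_def)
      then have "card I < card VK" using V finite_subset by (intro psubset_card_mono) auto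
      then have kK: "1 \<le> card VK - card I" "Suc (card VK - card I) \<le> card V - card I" using lt by auto
      have "subext VK (E - {h}) I V E I" using K \<open>EK = E\<close> by (auto simp: subext_def ext_graph_def)
      moreover have "E - {h} \<subset> E" using h by auto
      ultimately have d: "density VK (E - {h}) I < density V E I" using sb by (auto simp: strictly_balanced_def)
      define e where "e = real (card E)"
      define a where "a = real (card VK - card I)"
      define b where "b = real (card V - card I)"
      have "card E \<ge> 1" using k by simp
      then have "real (card (E - {h})) = e - 1" using h fE by (simp add: e_def of_nat_diff)
      then have "(e - 1) / a < e / b" using d by (simp add: density_def e_def a_def b_def)
      moreover have ab: "1 \<le> a" "a + 1 \<le> b" "b \<le> e" using kK k unfolding a_def b_def e_def by linarith+
      ultimately have "(e - 1) * b < e * a" by (simp add: divide_less_eq less_divide_eq field_simps)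
      also have "\<dots> \<le> e * (b - 1)" using ab by (intro mult_left_mono) auto
      finally have False using ab by (simp add: algebra_simps)
      then show ?thesis ..
    qed
  qed
qed

text \<open>The deterministic part. With \<open>s = sqrt \<delta> = 1 / (4 * N)\<close>, the
  deviation exponent satisfies \<open>s / (2 * N) = 2 * \<delta>\<close>: one
  \<open>\<delta>\<close> is the claimed saving, the other beats the logarithms. After the
  threshold, \<open>S powr (- s)\<close> dominates both error terms.\<close>

lemma extension_count_estimates:
  fixes \<delta> c B :: real
  assumes E: "ext_graph V E I" and N: "card V \<le> N" "N \<ge> 1" and \<delta>: "\<delta> = 1 / (16 * real N ^ 2)"
    and n: "60 * real N ^ 2 \<le> real n" "real N ^ 4 \<le> real n" and l: "ln (real n) \<ge> 1" "ln (real n) \<ge> c * (1 + 2 * (1 + 3 * (B * (2 ^ N * 4))))"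
    and c: "c \<ge> 0" "B \<ge> 0"
    and p: "1 / sqrt (real n) \<le> pp (time n i)" and z: "zeta n (time n i) \<le> ln (real n) powr (- ((3 * real N + 1) / \<delta>))"
    and \<phi>: "inj_on \<phi> I" "\<phi> ` I \<subseteq> {..<n}"
    and cc: "\<And>k. card V - card I = Suc k \<Longrightarrow> concentrated c B N k n i G"
    and S_def: "S = scaling V E I n (pp (time n i))" and \<Psi>_def: "\<Psi> = real (Psi n G V E I \<phi>)"
  shows "balanced V E I \<and> ereal (time n i) \<le> t_H_minus n V E I (sqrt \<delta>) \<Longrightarrow> \<bar>\<Psi> - S\<bar> \<le> S * zeta n (time n i) powr \<delta>"
    and "strictly_balanced V E I \<and> t_H_minus n V E I (sqrt \<delta>) \<le> ereal (time n i) \<and> ereal (time n i) \<le> t_H n V E I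
       \<Longrightarrow> \<bar>\<Psi> - S\<bar> \<le> S powr (1 - sqrt \<delta>) * ln (real n) powr (3 * exp (real (card V - card I)))"
proof -
  define L where "L = ln (real n)"
  define Z where "Z j = zeta n (time n j)" for j
  define s where "s = 1 / (4 * real N)"
  define b where "b = 1 + 3 * (B * (2 ^ N * 4))"
  define ss where "ss = sqrt (real n)"
  have N1: "real N \<ge> 1" using N by simp
  have s: "sqrt \<delta> = s" "0 < s" "s \<le> 1/4" "s * s = \<delta>" using N1
    by (auto simp: \<delta> s_def real_sqrt_divide real_sqrt_mult power2_eq_square divide_le_eq)
  have \<delta>01: "0 < \<delta>" "\<delta> \<le> 1/16" using N1 by (auto simp: \<delta> divide_le_eq)
  have L1: "L \<ge> 1" using l by (simp add: L_def)
  have n1: "real n > 1"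
  proof (rule ccontr)
    assume "\<not> 1 < real n"
    then have "n = 0 \<or> n = 1" by auto
    then show False using l(1) by auto
  qed
  then have n0: "n > 0" by simp
  have ss: "ss > 1" "ss * ss = real n" using n1 by (auto simp: ss_def)
  have pj: "1 / ss \<le> pp (time n j)" "pp (time n j) > 0" if "j \<le> i" for j
  proof -
    show "1 / ss \<le> pp (time n j)" using p pp_time_antimono[OF n0 that] by (simp add: ss_def)
    moreover have "0 < 1 / ss" using ss by simp
    ultimately show "pp (time n j) > 0" by linarith
  qed
  have Zlow: "1 / ss \<le> Z j" if "j \<le> i" for j
  proof -
    have "1 / ss \<le> L / (ss * pp (time n j))"
      using L1 ss pj(2)[OF that] pp_time_le_1[of n j] by (intro frac_le) (auto simp: mult_left_le)
    then show ?thesis by (simp add: Z_def zeta_def L_def ss_def)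
  qed
  have Z0: "Z j > 0" if "j \<le> i" for j
  proof -
    have "0 < 1 / ss" using ss by simp
    then show ?thesis using Zlow[OF that] by linarith
  qed
  have Zss: "Z j powr (- s) \<le> ss powr s" if "j \<le> i" for j
  proof -
    have "Z j powr (- s) \<le> (1 / ss) powr (- s)" using Zlow[OF that] ss s by (intro powr_mono2') auto
    also have "\<dots> = ss powr s" using ss by (simp add: powr_minus powr_divide)
    finally show ?thesis .
  qed
  have ss_s: "ss powr s < ss" using powr_less_mono[of s 1 ss] ss s by simp
  have Zm: "Z j \<le> Z i" if "j \<le> i" for j unfolding Z_def by (rule zeta_mono) (use n0 l that pj(2)[of i] in auto)
  have ZL: "Z i \<le> L powr (- ((3 * real N + 1) / \<delta>))" using z by (simp add: Z_def L_def)
  have "L powr (- ((3 * real N + 1) / \<delta>)) \<le> L powr 0" using L1 \<delta>01 by (intro powr_mono) auto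
  then have Z1: "Z i \<le> 1" using ZL L1 by simp
  have S0: "S > 0" unfolding S_def by (rule scaling_pos[OF n0 pj(2)]) simp
  have V: "finite V" "I \<subseteq> V" using E by (auto simp: ext_graph_def)
  have eN: "real (card E) \<le> real N ^ 2" by (rule card_edges_le[OF E N(1)])
  have half: "scaling V E I n (pp (time n j)) / 2 \<le> S" if "i = Suc j" for j
    unfolding S_def that by (rule scaling_Suc_ge_half[OF n0 eN n(1)]) (use p that in simp)
  \<comment> \<open>Without edges the count never changes and equals the one in
    \<open>K_n\<close>.\<close>
  have empty: "\<bar>\<Psi> - S\<bar> \<le> S * (real N ^ 2 / real n)" if "E = {}"
  proof -
    have Nn: "N \<le> n" using n N1 self_le_power[of "real N" 2] by linarith
    have "Psi n G V E I \<phi> = Psi n (complete_graph n) V E I \<phi>" by (simp add: Psi_def that)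
    then show ?thesis
      using Psi_complete_graph_bounds[OF E N(1) Nn n0 \<phi>] that
      by (auto simp: \<Psi>_def S_def scaling_def algebra_simps abs_le_iff)
  qed
  have NZ: "real N ^ 2 / real n \<le> Z i"
  proof -
    have "real N ^ 2 \<le> ss" unfolding ss_def using n(2) by (intro real_le_rsqrt) (simp add: power_mult[symmetric])
    then have "real N ^ 2 / real n \<le> ss / real n" by (intro divide_right_mono) auto
    also have "\<dots> = 1 / ss" unfolding ss(2)[symmetric] using ss(1) by simp
    finally show ?thesis using Zlow[of i] by simp
  qed
  have dev: "\<bar>\<Psi> - S\<bar> \<le> c * (Z i + b * L ^ (3 * (card V - card I)) * S powr (- (1 / (2 * real N)))) * S"
    if bal: "balanced V E I" and Sh: "S \<ge> 1/2" and Ene: "E \<noteq> {}"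
  proof -
    obtain k where k: "card V - card I = Suc k" using Ene no_edges_if_no_free_vertices(2)[OF E] by (cases "card V - card I") auto
    have "\<bar>\<Psi> - S\<bar> \<le> dev c B k n (Z i) (gsum V E I n (pp (time n i))) * S"
      using cc[OF k, unfolded concentrated_def] E N k Ene \<phi> by (simp add: \<Psi>_def S_def Z_def)
    also have "\<dots> \<le> c * (Z i + b * L ^ (3 * k + 3) * S powr (- (1 / (2 * real N)))) * S"
      unfolding b_def L_def S_def
      by (intro mult_right_mono balanced_dev_le[OF E bal N(1) n0 l(1) pj(2)[OF order.refl] pp_time_le_1 _ _ c])
         (use Sh S0 k in \<open>auto simp: S_def\<close>)
    finally show ?thesis by (simp add: k add.commute)
  qed
  have b1: "b \<ge> 1" using c by (simp add: b_def)
  have cb: "c * (1 + 2 * b) \<le> L" using l(2) by (simp add: L_def b_def)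
  \<comment> \<open>For large \<open>n\<close> a single extra logarithm absorbs all
    constants.\<close>
  have combine: "c * (Z i + b * L ^ q * u) \<le> L ^ Suc q * v" if "Z i \<le> v" "u \<le> 2 * v" "0 \<le> v" for q u v
  proof -
    have Lq: "1 \<le> L ^ q" using L1 by (rule one_le_power)
    have "Z i + b * L ^ q * u \<le> L ^ q * v + b * L ^ q * (2 * v)"
      using that Lq b1 mult_right_mono[OF Lq that(3)] by (intro add_mono mult_left_mono) auto
    then have "c * (Z i + b * L ^ q * u) \<le> c * (L ^ q * v + b * L ^ q * (2 * v))" using c by (intro mult_left_mono)
    also have "\<dots> = (c * (1 + 2 * b)) * (L ^ q * v)" by (simp add: algebra_simps)
    also have "\<dots> \<le> L * (L ^ q * v)" using cb Lq that by (intro mult_right_mono) auto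
    finally show ?thesis by simp
  qed
  {
    assume H: "balanced V E I \<and> ereal (time n i) \<le> t_H_minus n V E I (sqrt \<delta>)"
    show "\<bar>\<Psi> - S\<bar> \<le> S * zeta n (time n i) powr \<delta>"
    proof (cases "E = {}")
      case True
      have "Z i \<le> Z i powr \<delta>" using powr_mono'[of \<delta> 1 "Z i"] Z0[of i] Z1 \<delta>01 by simp
      then have "S * (real N ^ 2 / real n) \<le> S * Z i powr \<delta>" using NZ S0 by (intro mult_left_mono) auto
      then show ?thesis using empty[OF True] by (simp add: Z_def)
    next
      case False
      define q where "q = 3 * (card V - card I)"
      have k1: "card V - card I \<ge> 1" using False no_edges_if_no_free_vertices(2)[OF E] by (cases "card V - card I") auto
      \<comment> \<open>The threshold controls the previous time; the step to \<open>i\<close> costs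
        the factor 2. At \<open>i = 0\<close> the scaling is a power of \<open>n\<close>.\<close>
      have Slow: "Z i powr (- s) / 2 \<le> S"
      proof (cases i)
        case 0
        have "Z i powr (- s) \<le> real n ^ 1" using Zss[of i] ss_s ss mult_mono[of 1 ss ss ss] by simp
        also have "\<dots> \<le> real n ^ (card V - card I)" using k1 n1 by (intro power_increasing) auto
        also have "\<dots> = S" by (simp add: S_def 0 pp_def time_def scaling_def)
        finally have "Z i powr (- s) \<le> S" .
        then show ?thesis using S0 by simp
      next
        case (Suc j)
        have "Z i powr (- s) \<le> Z j powr (- s)" using Zm[of j] Z0[of j] Suc s by (intro powr_mono2') auto
        also have "\<dots> < scaling V E I n (pp (time n j))"
          using before_t_H_minus[OF n0, of i V E I s j] H Suc s(1) by (simp add: Z_def)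
        also have "\<dots> \<le> 2 * S" using half[OF Suc] by simp
        finally show ?thesis by simp
      qed
      have "1 \<le> Z i powr (- s)" using Z0[of i] Z1 s powr_mono2'[of "-s" "Z i" 1] by simp
      then have Sh: "S \<ge> 1/2" using Slow by simp
      have v1: "Z i \<le> Z i powr (2 * \<delta>)" using powr_mono'[of "2 * \<delta>" 1 "Z i"] Z0[of i] Z1 \<delta>01 by simp
      have v2: "S powr (- (1 / (2 * real N))) \<le> 2 * Z i powr (2 * \<delta>)"
      proof -
        have "S powr (- (1 / (2 * real N))) \<le> (Z i powr (- s) * (1/2)) powr (- (1 / (2 * real N)))"
          using Slow Z0[of i] by (intro powr_mono2') auto
        also have "\<dots> = Z i powr (- s * - (1 / (2 * real N))) * (1/2) powr (- (1 / (2 * real N)))"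
          by (simp only: powr_mult powr_powr)
        also have "- s * - (1 / (2 * real N)) = 2 * \<delta>" by (simp add: s_def \<delta> power2_eq_square)
        also have "Z i powr (2 * \<delta>) * (1/2) powr (- (1 / (2 * real N))) \<le> Z i powr (2 * \<delta>) * 2"
          using N1 half_powr_le_2[of "1/2" "1 / (2 * real N)"] by (intro mult_left_mono) (auto simp: divide_le_eq)
        finally show ?thesis by simp
      qed
      have "\<bar>\<Psi> - S\<bar> \<le> c * (Z i + b * L ^ q * S powr (- (1 / (2 * real N)))) * S"
        using dev[OF _ Sh False] H by (simp add: q_def)
      also have "\<dots> \<le> L ^ Suc q * Z i powr (2 * \<delta>) * S"
        using combine[OF v1 v2, of q] S0 by (intro mult_right_mono) auto
      also have "\<dots> \<le> Z i powr \<delta> * S"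
      proof (rule mult_right_mono)
        have "Z i powr \<delta> \<le> (L powr (- ((3 * real N + 1) / \<delta>))) powr \<delta>" using ZL Z0[of i] \<delta>01 by (intro powr_mono2) auto
        also have "\<dots> = L powr (- (3 * real N + 1))" using \<delta>01 by (simp add: powr_powr)
        also have "\<dots> \<le> L powr (- real (Suc q))"
          using L1 N by (intro powr_mono) (auto simp: q_def)
        finally have "L ^ Suc q * Z i powr \<delta> \<le> L ^ Suc q * L powr (- real (Suc q))" using L1 by (intro mult_left_mono) auto
        also have "\<dots> = 1" using L1 by (simp add: powr_minus powr_realpow del: power_Suc of_nat_Suc)
        finally have "(L ^ Suc q * Z i powr \<delta>) * Z i powr \<delta> \<le> 1 * Z i powr \<delta>" by (intro mult_right_mono) auto
        moreover have "Z i powr (2 * \<delta>) = Z i powr \<delta> * Z i powr \<delta>" by (simp add: powr_add[symmetric])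
        ultimately show "L ^ Suc q * Z i powr (2 * \<delta>) \<le> Z i powr \<delta>" by simp
      qed (use S0 in simp)
      finally show ?thesis by (simp add: Z_def mult.commute)
    qed
  next
    assume H: "strictly_balanced V E I \<and> t_H_minus n V E I (sqrt \<delta>) \<le> ereal (time n i) \<and> ereal (time n i) \<le> t_H n V E I"
    define k where "k = card V - card I"
    show "\<bar>\<Psi> - S\<bar> \<le> S powr (1 - sqrt \<delta>) * ln (real n) powr (3 * exp (real (card V - card I)))"
    proof (cases "k = 0")
      case True
      then have Ee: "E = {}" using no_edges_if_no_free_vertices(2)[OF E] by (simp add: k_def)
      have S1: "S = 1" using True Ee by (simp add: S_def scaling_def k_def)
      have "real N ^ 2 / real n \<le> 1" using NZ Z1 by simp
      then have "\<bar>\<Psi> - S\<bar> \<le> 1" using empty[OF Ee] S1 by simp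
      also have "1 \<le> L powr (3 * exp (real k))" using L1 by (intro ge_one_powr_ge_zero) auto
      finally show ?thesis using S1 by (simp add: L_def k_def)
    next
      case False
      then have k1: "k \<ge> 1" by simp
      obtain j where j: "j \<le> i" "scaling V E I n (pp (time n j)) \<le> Z j powr (- s)"
        using after_t_H_minus[OF n0, of V E I s i] H s(1) by (auto simp: Z_def)
      \<comment> \<open>With no more edges than free vertices,
        \<open>S \<ge> (n p) ^ k \<ge> sqrt n\<close>, which exceeds
        \<open>\<zeta> powr (- s)\<close>; then no crossing at \<open>j\<close> could have
        occurred.\<close>
      have ek: "k \<le> card E"
      proof (rule ccontr)
        assume "\<not> k \<le> card E"
        then have "card E \<le> k" by simp
        have "ss ^ 1 \<le> ss ^ k" using ss k1 by (intro power_increasing) auto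
        also have "\<dots> \<le> (real n * pp (time n j)) ^ k"
        proof (rule power_mono)
          have "real n * (1 / ss) \<le> real n * pp (time n j)" using pj(1)[OF j(1)] by (intro mult_left_mono) auto
          moreover have "real n * (1 / ss) = ss" using ss by (simp add: divide_eq_eq)
          ultimately show "ss \<le> real n * pp (time n j)" by simp
        qed (use ss in simp)
        also have "\<dots> = real n ^ k * pp (time n j) ^ k" by (simp add: power_mult_distrib)
        also have "\<dots> \<le> real n ^ k * pp (time n j) ^ card E"
          using \<open>card E \<le> k\<close> pj(2)[OF j(1)] pp_time_le_1[of n j] by (intro mult_left_mono power_decreasing) auto
        also have "\<dots> = scaling V E I n (pp (time n j))" by (simp add: scaling_def k_def)
        also have "\<dots> \<le> ss powr s" using j Zss[OF j(1)] by linarith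
        finally show False using ss_s by simp
      qed
      have Ene: "E \<noteq> {}" using ek k1 by auto
      have bal: "balanced V E I" by (rule strictly_balanced_imp_balanced[OF E]) (use H k1 ek in \<open>auto simp: k_def\<close>)
      have Sh: "S \<ge> 1/2"
      proof (cases i)
        case 0
        have "1 \<le> real n ^ (card V - card I)" using n1 by (intro one_le_power) auto
        then show ?thesis by (simp add: S_def 0 pp_def time_def scaling_def)
      next
        case (Suc j)
        have "1 < scaling V E I n (pp (time n j))" by (rule before_t_H[OF n0, of i]) (use H Suc in auto)
        then show ?thesis using half[OF Suc] by simp
      qed
      \<comment> \<open>After the crossing at \<open>j\<close> the order persists: when
        \<open>p\<close> shrinks by a factor \<open>r\<close>, the scaling shrinks by
        \<open>r ^ card E\<close> and the threshold only by \<open>r powr s\<close>.\<close>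
      have SZ: "S \<le> Z i powr (- s)"
      proof -
        define r where "r = pp (time n i) / pp (time n j)"
        have r: "0 < r" "r \<le> 1" using pj(2)[OF j(1)] pj(2)[of i] pp_time_antimono[OF n0 j(1)] by (auto simp: r_def)
        have pir: "pp (time n i) = pp (time n j) * r" using pj(2)[OF j(1)] by (simp add: r_def)
        have Zr: "Z j = Z i * r" using r pj(2)[OF j(1)] unfolding Z_def zeta_def pir by simp
        have "S = scaling V E I n (pp (time n j)) * r ^ card E" by (simp add: S_def scaling_def pir power_mult_distrib)
        also have "\<dots> \<le> Z j powr (- s) * r powr s"
        proof (intro mult_mono j(2))
          have "r ^ card E = r powr real (card E)" using r by (simp add: powr_realpow)
          also have "\<dots> \<le> r powr s" using r s ek k1 by (intro powr_mono') auto
          finally show "r ^ card E \<le> r powr s" .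
        qed (use r in auto)
        also have "\<dots> = Z i powr (- s)" using r Z0[of i] by (simp add: Zr powr_mult powr_minus)
        finally show ?thesis .
      qed
      have v1: "Z i \<le> S powr (- s)"
      proof -
        have "Z i powr 1 \<le> Z i powr \<delta>" using Z0[of i] Z1 \<delta>01 by (intro powr_mono') auto
        also have "\<dots> = (Z i powr (- s)) powr (- s)" by (simp add: powr_powr s(4))
        also have "\<dots> \<le> S powr (- s)" using SZ S0 s by (intro powr_mono2') auto
        finally show ?thesis using Z0[of i] by simp
      qed
      have v2: "S powr (- (1 / (2 * real N))) \<le> 2 * S powr (- s)"
        by (rule half_powr_antimono[OF Sh]) (use N1 s in \<open>auto simp: s_def divide_le_eq intro!: divide_left_mono\<close>)
      have "\<bar>\<Psi> - S\<bar> \<le> c * (Z i + b * L ^ (3 * k) * S powr (- (1 / (2 * real N)))) * S"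
        using dev[OF bal Sh Ene] by (simp add: k_def)
      also have "\<dots> \<le> L ^ Suc (3 * k) * S powr (- s) * S"
        using combine[OF v1 v2, of "3 * k"] S0 by (intro mult_right_mono) auto
      also have "\<dots> = S powr (1 - s) * L ^ Suc (3 * k)" using S0 by (simp add: powr_diff powr_minus divide_inverse)
      also have "\<dots> \<le> S powr (1 - s) * L powr (3 * exp (real k))"
      proof (rule mult_left_mono)
        have "L ^ Suc (3 * k) = L powr real (Suc (3 * k))" using L1 by (subst powr_realpow) auto
        also have "\<dots> \<le> L powr (3 * exp (real k))"
        proof (rule powr_mono[OF _ L1])
          \<comment> \<open>The exponent produced is \<open>3 k + 1\<close>, well below
            \<open>3 exp k\<close> because \<open>1 + k \<le> exp k\<close>.\<close>
          have "real (Suc (3 * k)) = 1 + 3 * real k" by simp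
          then show "real (Suc (3 * k)) \<le> 3 * exp (real k)" using exp_ge_add_one_self[of "real k"] by linarith
        qed
        finally show "L ^ Suc (3 * k) \<le> L powr (3 * exp (real k))" .
      qed simp
      finally show ?thesis by (simp add: s(1) L_def k_def)
    qed
  }
qed

text \<open>\<open>Tmax\<close> expresses the standing requirement as a horizon. The constant
  \<open>\<delta>\<close> depends on \<open>L\<close> only; what remains is to intersect the
  concentration events and apply \<open>extension_count_estimates\<close>.\<close>

theorem theorem3p2:
  fixes C :: real and Tmax :: "nat \<Rightarrow> real" and L :: real
  assumes C_pos: "C > 0"
    and horizon_pos: "eventually (\<lambda>n. 0 < pp (Tmax n)) sequentially"
    and horizon_req: "filterlim (\<lambda>n. ln (1 / zeta n (Tmax n)) / ln (ln (real n))) at_top sequentially"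
    and L_pos: "L > 0"
  shows "\<exists>\<delta>::real. 0 < \<delta> \<and> \<delta> < 1 \<and>
    (\<lambda>n. measure_pmf.prob (tr_process n)
       {xs. \<forall>i \<le> tau_star_idx C Tmax n xs.
          \<forall>V E I. ext_graph V E I \<and> real (card V) \<le> L \<longrightarrow>
          (\<forall>\<phi>. inj_on \<phi> I \<and> \<phi> ` I \<subseteq> {..<n} \<longrightarrow>
             (let t = time n i; S = scaling V E I n (pp t); z = zeta n t;
                  \<Psi> = real (Psi n (graph_at xs i) V E I \<phi>) in
              (balanced V E I \<and> ereal t \<le> t_H_minus n V E I (sqrt \<delta>) \<longrightarrow>
                 \<bar>\<Psi> - S\<bar> \<le> S * z powr \<delta>)
            \<and> (strictly_balanced V E I \<and> t_H_minus n V E I (sqrt \<delta>) \<le> ereal t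
                 \<and> ereal t \<le> t_H n V E I \<longrightarrow>
                 \<bar>\<Psi> - S\<bar> \<le> S powr (1 - sqrt \<delta>) *
                    ln (real n) powr (3 * exp (real (card V - card I))))))})
    \<longlonglongrightarrow> 1"
proof -
  define N where "N = max 1 (nat \<lfloor>L\<rfloor>)"
  define \<delta> where "\<delta> = 1 / (16 * real N ^ 2)"
  define c where "c = dev_const C N"
  have N: "N \<ge> 1" by (simp add: N_def)
  then have "1 \<le> real N ^ 2" by simp
  then have "1 < 16 * real N ^ 2" by linarith
  then have \<delta>: "0 < \<delta>" "\<delta> < 1" using N by (auto simp: \<delta>_def divide_less_eq)
  have c0: "c \<ge> 0" using C_pos by (auto simp: c_def dev_const_def intro!: add_nonneg_nonneg mult_nonneg_nonneg)
  \<comment> \<open>\<open>c\<close> is common to all \<open>k\<close>, whereas \<open>B\<close>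
    inherits the constant of the upper bounds, which depends on \<open>k\<close>.\<close>
  have "\<forall>k. \<exists>B\<ge>0. whp (\<lambda>n xs. \<forall>i\<le>tau_star_idx C Tmax n xs. concentrated c B N k n i (graph_at xs i))"
  proof
    fix k
    obtain A where A: "A > 0" "whp (\<lambda>n xs. \<forall>i\<le>tau_star_idx C Tmax n xs. upper_bounds n A N k (pp (time n i)) (graph_at xs i))"
      using whp_upper_bounds[OF horizon_pos horizon_req C_pos] by blast
    show "\<exists>B\<ge>0. whp (\<lambda>n xs. \<forall>i\<le>tau_star_idx C Tmax n xs. concentrated c B N k n i (graph_at xs i))"
      using whp_concentrated[OF horizon_pos horizon_req C_pos A] A(1)
      by (intro exI[of _ "18 * real N ^ 2 * A"]) (simp add: c_def)
  qed
  from choice[OF this] obtain B where B: "\<And>k. B k \<ge> 0"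
    and conc: "\<And>k. whp (\<lambda>n xs. \<forall>i\<le>tau_star_idx C Tmax n xs. concentrated c (B k) N k n i (graph_at xs i))"
    by blast
  define good where "good n i V E I \<phi> G \<longleftrightarrow>
     (let t = time n i; S = scaling V E I n (pp t); z = zeta n t; \<Psi> = real (Psi n G V E I \<phi>) in
              (balanced V E I \<and> ereal t \<le> t_H_minus n V E I (sqrt \<delta>) \<longrightarrow>
                 \<bar>\<Psi> - S\<bar> \<le> S * z powr \<delta>)
            \<and> (strictly_balanced V E I \<and> t_H_minus n V E I (sqrt \<delta>) \<le> ereal t
                 \<and> ereal t \<le> t_H n V E I \<longrightarrow>
                 \<bar>\<Psi> - S\<bar> \<le> S powr (1 - sqrt \<delta>) *
                    ln (real n) powr (3 * exp (real (card V - card I)))))" for n i V E I \<phi> G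
  define D where "D k = c * (1 + 2 * (1 + 3 * (B k * (2 ^ N * 4))))" for k
  have "whp (\<lambda>n xs. \<forall>i\<le>tau_star_idx C Tmax n xs. \<forall>V E I. ext_graph V E I \<and> real (card V) \<le> L \<longrightarrow>
          (\<forall>\<phi>. inj_on \<phi> I \<and> \<phi> ` I \<subseteq> {..<n} \<longrightarrow> good n i V E I \<phi> (graph_at xs i)))"
  proof (rule whp_mono[OF whp_all_le[of N, OF conc]])
    have a0: "0 \<le> (3 * real N + 1) / \<delta>" using \<delta> by simp
    have "eventually (\<lambda>n. \<forall>k\<in>{..N}. D k \<le> ln (real n)) sequentially"
      by (rule eventually_ball_finite) (auto intro: eventually_ln_ge)
    then show "eventually (\<lambda>n. \<forall>xs\<in>set_pmf (tr_process n).
        (\<forall>k\<le>N. \<forall>i\<le>tau_star_idx C Tmax n xs. concentrated c (B k) N k n i (graph_at xs i)) \<longrightarrow>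
        (\<forall>i\<le>tau_star_idx C Tmax n xs. \<forall>V E I. ext_graph V E I \<and> real (card V) \<le> L \<longrightarrow>
          (\<forall>\<phi>. inj_on \<phi> I \<and> \<phi> ` I \<subseteq> {..<n} \<longrightarrow> good n i V E I \<phi> (graph_at xs i)))) sequentially"
      using admissible_bounds[OF horizon_pos horizon_req a0] eventually_ln_ge[of 1]
        eventually_real_ge[of "60 * real N ^ 2"] eventually_real_ge[of "real N ^ 4"]
    proof eventually_elim
      case (elim n)
      show ?case
      proof (intro ballI impI allI)
        fix xs i V E I and \<phi> :: "nat \<Rightarrow> nat"
        assume cc: "\<forall>k\<le>N. \<forall>i\<le>tau_star_idx C Tmax n xs. concentrated c (B k) N k n i (graph_at xs i)"
          and i: "i \<le> tau_star_idx C Tmax n xs" and H: "ext_graph V E I \<and> real (card V) \<le> L"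
          and \<phi>: "inj_on \<phi> I \<and> \<phi> ` I \<subseteq> {..<n}"
        have VN: "card V \<le> N" using H by (simp add: N_def le_nat_floor le_max_iff_disj)
        \<comment> \<open>Concentration at level \<open>k\<close> concerns \<open>Suc k\<close> free
          vertices. With none, the truncated value 0 is a harmless choice.\<close>
        define k where "k = card V - card I - 1"
        have kN: "k \<le> N" using VN by (simp add: k_def)
        have "admissible Tmax n i" by (rule before_tau_star(1)[OF i])
        then have a: "1 / sqrt (real n) \<le> pp (time n i)" "zeta n (time n i) \<le> ln (real n) powr (- ((3 * real N + 1) / \<delta>))"
          using elim by blast+
        have co: "concentrated c (B k) N k' n i (graph_at xs i)" if "card V - card I = Suc k'" for k'
          using cc kN i that by (simp add: k_def)
        have Dk: "c * (1 + 2 * (1 + 3 * (B k * (2 ^ N * 4)))) \<le> ln (real n)" using elim(1) kN by (auto simp: D_def)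
        note est = extension_count_estimates[OF conjunct1[OF H] VN N \<delta>_def _ _ _ Dk c0 B a conjunct1[OF \<phi>] conjunct2[OF \<phi>] co refl refl]
        show "good n i V E I \<phi> (graph_at xs i)"
          unfolding good_def Let_def using est elim by blast
      qed
    qed
  qed
  then show ?thesis using \<delta> unfolding whp_def good_def by blast
qed

end
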